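(* Let $p+q=n$. (i) For $G=\mathrm{Sp}(2n,\mathbb R)$ and $K=U(n)$, \[ m_G=2^n,\qquad q(G)=\frac{n(n+1)}2,\qquad \varepsilon_G=(-1)^{n(n+1)/2}. \] (ii) For $G=\mathrm{Sp}(p,q)$ and $K=\mathrm{Sp}(p)\times\mathrm{Sp}(q)$, \[ m_G=\binom np,\qquad q(G)=2pq,\qquad \varepsilon_G=1. \]
   Context: For a connected linear real semisimple Lie group $G$ with finite center, a maximal compact subgroup $K$ and a compact Cartan subgroup $T\subset K$ of $G$: $W_G=W(G_{\mathbb C},T_{\mathbb C})$ is the absolute Weyl group, $W_K=N_K(T)/T$, $m_G=[W_G:W_K]$, $q(G)=\frac12\dim_{\mathbb R}(G/K)$, $\varepsilon_G=(-1)^{q(G)}$. Here $\mathrm{Sp}(2n,\mathbb R)$ has rank $n$. The groups $\mathrm{Sp}(2n,\mathbb R)$ and $\mathrm{Sp}(p,q)$ are real forms of $\mathrm{Sp}(2n,\mathbb C)$, and $\mathrm{Sp}(m)$ denotes the compact symplectic group of rank $m$. *)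

theory Defs
  imports "HOL-Analysis.Analysis" "HOL-Algebra.Group_Action"
begin

text \<open>
  All groups are groups of complex square matrices. The index type of the matrices is an arbitrary
  finite type, so that sets of matrices live in a Euclidean space over the reals; in particular
  \<open>dim\<close>, \<open>span\<close>, \<open>subspace\<close> and \<open>compact\<close> below always refer to the real vector space structure
  and the usual topology.
\<close>

type_synonym 'm cmat = "((complex, 'm) vec, 'm) vec"

definition conj_transpose :: "('m::finite) cmat \<Rightarrow> 'm cmat" where
  "conj_transpose A = (\<chi> a b. cnj (A $ b $ a))"

definition mat_group :: "('m::finite) cmat set \<Rightarrow> 'm cmat monoid" where
  "mat_group A = \<lparr>carrier = A, monoid.mult = (**), one = mat 1\<rparr>"

definition mat_exp :: "('m::finite) cmat \<Rightarrow> 'm cmat" where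
  "mat_exp X = (\<Sum>k. (((**) X) ^^ k) (mat 1) /\<^sub>R fact k)"


subsection \<open>Closed linear groups, Cartan subgroups, Weyl groups\<close>

text \<open>The Lie algebra of a closed subgroup of the general linear group.\<close>

definition lie_algebra :: "('m::finite) cmat set \<Rightarrow> 'm cmat set" where
  "lie_algebra G = {X. \<forall>t::real. mat_exp (t *\<^sub>R X) \<in> G}"

definition lie_bracket :: "('m::finite) cmat \<Rightarrow> 'm cmat \<Rightarrow> 'm cmat" where
  "lie_bracket X Y = X ** Y - Y ** X"

text \<open>
  \<open>\<hh> + i\<hh>\<close>. For the Lie algebras of compact groups and of real forms treated here this sum is direct,
  so it is a model of the complexification.
\<close>

definition complexify :: "('m::finite) cmat set \<Rightarrow> 'm cmat set" where
  "complexify \<hh> = {X + mat \<i> ** Y | X Y. X \<in> \<hh> \<and> Y \<in> \<hh>}"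

text \<open>
  A Cartan subalgebra of a real semisimple Lie algebra \<open>\<gg>\<close>: a maximal abelian subalgebra \<open>\<hh>\<close> all of
  whose elements \<open>H\<close> are such that \<open>ad H\<close> is semisimple, i.e. diagonalizable on \<open>\<gg> + i\<gg>\<close>. (Real and
  complex spans of the set of eigenvectors agree, as this set is stable under complex scalars.)
\<close>

definition cartan_subalgebra :: "('m::finite) cmat set \<Rightarrow> 'm cmat set \<Rightarrow> bool" where
  "cartan_subalgebra \<gg> \<hh> \<longleftrightarrow>
     subspace \<hh> \<and> \<hh> \<subseteq> \<gg> \<and>
     (\<forall>X\<in>\<hh>. \<forall>Y\<in>\<hh>. lie_bracket X Y = 0) \<and>
     (\<forall>Y\<in>\<gg>. (\<forall>X\<in>\<hh>. lie_bracket X Y = 0) \<longrightarrow> Y \<in> \<hh>) \<and>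
     (\<forall>H\<in>\<hh>. complexify \<gg> \<subseteq>
        span {V \<in> complexify \<gg>. \<exists>c::complex. lie_bracket H V = mat c ** V})"

text \<open>A Cartan subgroup is the centralizer in \<open>G\<close> of a Cartan subalgebra.\<close>

definition compact_cartan_subgroup :: "('m::finite) cmat set \<Rightarrow> 'm cmat set \<Rightarrow> bool" where
  "compact_cartan_subgroup G T \<longleftrightarrow>
     compact T \<and>
     (\<exists>\<hh>. cartan_subalgebra (lie_algebra G) \<hh> \<and> T = {g \<in> G. \<forall>X\<in>\<hh>. g ** X = X ** g})"

text \<open>
  The complexification of a torus \<open>T\<close>: the connected complex Lie subgroup with Lie algebra
  \<open>\<tt> + i\<tt>\<close>. As \<open>\<tt> + i\<tt>\<close> is abelian, it is the image of the exponential map.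
\<close>

definition complex_torus :: "('m::finite) cmat set \<Rightarrow> 'm cmat set" where
  "complex_torus T = mat_exp ` complexify (lie_algebra T)"

definition weyl_group :: "('m::finite) cmat set \<Rightarrow> 'm cmat set \<Rightarrow> 'm cmat set monoid" where
  "weyl_group H T = mat_group (normalizer (mat_group H) T) Mod T"

text \<open>
  \<open>weyl_index GC K T\<close> is \<open>[W\<^sub>G : W\<^sub>K]\<close>, where \<open>GC\<close> is the complexification of \<open>G\<close>,
  \<open>W\<^sub>G = N(T\<^sub>C)/T\<^sub>C\<close> with the normalizer taken in \<open>GC\<close>, and \<open>W\<^sub>K = N\<^sub>K(T)/T\<close> is regarded as a
  subgroup of \<open>W\<^sub>G\<close> through the natural map \<open>nT \<mapsto> nT\<^sub>C\<close>.
\<close>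

definition weyl_index :: "('m::finite) cmat set \<Rightarrow> 'm cmat set \<Rightarrow> 'm cmat set \<Rightarrow> nat" where
  "weyl_index GC K T =
     card (rcosets\<^bsub>weyl_group GC (complex_torus T)\<^esub>
       ((\<lambda>w. w <#>\<^bsub>mat_group GC\<^esub> complex_torus T) ` carrier (weyl_group K T)))"

text \<open>Half the dimension of \<open>G/K\<close>, using \<open>dim (G/K) = dim G - dim K\<close>.\<close>

definition q_inv :: "('m::finite) cmat set \<Rightarrow> 'm cmat set \<Rightarrow> real" where
  "q_inv G K = (real (dim (lie_algebra G)) - real (dim (lie_algebra K))) / 2"

text \<open>The floor is only a coercion: \<open>q_inv G K\<close> is a natural number when \<open>G\<close> has a compact Cartan subgroup.\<close>

definition eps_sign :: "('m::finite) cmat set \<Rightarrow> 'm cmat set \<Rightarrow> int" where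
  "eps_sign G K = (-1) ^ nat \<lfloor>q_inv G K\<rfloor>"


subsection \<open>The symplectic groups\<close>

text \<open>
  With \<open>n = CARD('n)\<close>, the group \<open>Sp(2n, C)\<close> consists of matrices indexed by \<open>'n + 'n\<close>, and
  \<open>sympl_J\<close> is the block matrix with rows \<open>(0, I)\<close> and \<open>(-I, 0)\<close>.
\<close>

definition sympl_J :: "('n::finite + 'n) cmat" where
  "sympl_J = (\<chi> a b. case (a, b) of
      (Inl i, Inr j) \<Rightarrow> if i = j then 1 else 0
    | (Inr i, Inl j) \<Rightarrow> if i = j then - 1 else 0
    | _ \<Rightarrow> 0)"

definition Sp_complex :: "('n::finite + 'n) cmat set" where
  "Sp_complex = {g. transpose g ** sympl_J ** g = sympl_J}"

definition Sp_real :: "('n::finite + 'n) cmat set" where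
  "Sp_real = {g \<in> Sp_complex. \<forall>a b. g $ a $ b \<in> \<real>}"

definition unitary_group :: "('m::finite) cmat set" where
  "unitary_group = {u. conj_transpose u ** u = mat 1}"

text \<open>
  The standard embedding of \<open>U(n)\<close> into \<open>Sp(2n, R)\<close>: \<open>A + iB\<close>, with \<open>A\<close> and \<open>B\<close> real, is sent to the
  block matrix with rows \<open>(A, B)\<close> and \<open>(-B, A)\<close>.
\<close>

definition realify :: "('n::finite) cmat \<Rightarrow> ('n + 'n) cmat" where
  "realify u = (\<chi> a b. case (a, b) of
      (Inl i, Inl j) \<Rightarrow> complex_of_real (Re (u $ i $ j))
    | (Inl i, Inr j) \<Rightarrow> complex_of_real (Im (u $ i $ j))
    | (Inr i, Inl j) \<Rightarrow> - complex_of_real (Im (u $ i $ j))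
    | (Inr i, Inr j) \<Rightarrow> complex_of_real (Re (u $ i $ j)))"

definition U_in_Sp :: "('n::finite + 'n) cmat set" where
  "U_in_Sp = realify ` unitary_group"

text \<open>
  For a set \<open>S\<close> of \<open>p\<close> out of the \<open>n\<close> (quaternionic) coordinates, \<open>sig_matrix S\<close> is the diagonal matrix
  with entry \<open>1\<close> over \<open>S\<close> and \<open>-1\<close> elsewhere, in both halves of \<open>'n + 'n\<close>; up to the order of the
  coordinates it is \<open>diag (I\<^sub>p, - I\<^sub>q, I\<^sub>p, - I\<^sub>q)\<close>. Working with \<open>S\<close> allows \<open>p = 0\<close> and \<open>q = 0\<close>.
\<close>

definition lies_over :: "'n + 'n \<Rightarrow> 'n set \<Rightarrow> bool" where
  "lies_over a S \<longleftrightarrow> case_sum id id a \<in> S"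

definition sig_matrix :: "('n::finite) set \<Rightarrow> ('n + 'n) cmat" where
  "sig_matrix S = (\<chi> a b. if a = b then (if lies_over a S then 1 else - 1) else 0)"

text \<open>\<open>Sp(p, q)\<close>, the intersection of \<open>Sp(2n, C)\<close> and \<open>U(2p, 2q)\<close>, where \<open>p = card S\<close> and \<open>q = n - p\<close>.\<close>

definition Sp_pq :: "('n::finite) set \<Rightarrow> ('n + 'n) cmat set" where
  "Sp_pq S = {g \<in> Sp_complex. conj_transpose g ** sig_matrix S ** g = sig_matrix S}"

text \<open>
  The compact group \<open>Sp(m)\<close>, \<open>m = card S\<close>, acting on the coordinates over \<open>S\<close> and trivially on the
  other ones; the compact group is \<open>Sp(2m, C)\<close> intersected with \<open>U(2m)\<close>.
\<close>

definition Sp_compact_on :: "('n::finite) set \<Rightarrow> ('n + 'n) cmat set" where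
  "Sp_compact_on S = {g \<in> Sp_complex \<inter> unitary_group.
     \<forall>a b. \<not> (lies_over a S \<and> lies_over b S) \<longrightarrow> g $ a $ b = (mat 1 :: ('n + 'n) cmat) $ a $ b}"

definition Sp_times_Sp :: "('n::finite) set \<Rightarrow> ('n + 'n) cmat set" where
  "Sp_times_Sp S = {g ** h | g h. g \<in> Sp_compact_on S \<and> h \<in> Sp_compact_on (- S)}"

end

theory Submission
  imports Defs
begin

text \<open>
  Both groups have the form \<open>{g \<in> Sp(2n, C). g\<^sup>* \<sigma> g = \<sigma>}\<close> with \<open>\<sigma>\<close> quaternionic unitary and \<open>\<sigma>\<^sup>2 = \<plusminus>1\<close>: \<open>\<sigma> = J\<close>
  gives \<open>Sp(2n, R)\<close> and \<open>\<sigma> = diag (\<plusminus>1)\<close> gives \<open>Sp(p, q)\<close>. The maximal compact subgroup \<open>K\<close> is the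
  centralizer of \<open>\<sigma>\<close> in the compact group \<open>Sp(n)\<close>. The Lie algebra of a compact Cartan subgroup \<open>T\<close> in
  \<open>K\<close> and \<open>\<sigma>\<close> form a commuting family, which an element of \<open>Sp(n)\<close> diagonalizes; so \<open>T\<close> becomes the
  diagonal torus and \<open>\<sigma>\<close> a diagonal matrix. The image of \<open>W\<^sub>K\<close> in \<open>W\<^sub>G\<close> is the stabilizer of this matrix,
  and the index is the size of its orbit under signed permutations: \<open>n\<close> free signs \<open>\<plusminus>\<i>\<close> for \<open>J\<close>, and the
  \<open>p\<close>-element subsets for \<open>Sp(p, q)\<close>. Finally \<open>dim G - dim K\<close> is the dimension of the Hermitian part
  of the Lie algebra of \<open>G\<close>.
\<close>

subsection \<open>The matrix exponential and Lie algebras\<close>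

text \<open>The torus \<open>T\<close> is arbitrary, so its conjugacy to the diagonal torus has to
  be proved, and the conjugating matrix must lie in Sp(n), not merely in U(2n): every eigenvector is
  chosen together with its image under the quaternionic structure. Such a conjugation moves the real
  form but leaves Sp(2n, C) fixed, where the index is formed. The stabilizer of \<sigma> in the
  normalizer of T_C is not compact; its elements are brought into K by a polar decomposition whose
  positive factor lies in T_C, and this identifies the stabilizer with the image of W_K, modulo T_C.
  The orbit sizes come from the eigenvalues of \<sigma> on a pair of opposite coordinates: for J
  they are \<open>\<i>\<close> and \<open>- \<i>\<close>, so exchanging the two coordinates flips a
  free sign; for Sp(p, q) they coincide, sign changes act trivially, and only permutations of the n
  pairs count. Hermitian and skew-Hermitian matrices are orthogonal because the conjugate transpose
  is an isometry, which reduces q(G) to counting the free entries of a Hermitian matrix.\<close>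

lemma matrix_mult_add_rdistrib: "((A::('a::semiring_1)^'n^'m) + B) ** C = A ** C + B ** C"
  by (simp add: matrix_matrix_mult_def vec_eq_iff sum.distrib distrib_right)

lemma matrix_minus_left: "(- (A::('a::ring_1)^'n^'m)) ** B = - (A ** B)"
  by (simp add: matrix_matrix_mult_def vec_eq_iff sum_negf)

lemma matrix_minus_right: "(A::('a::ring_1)^'n^'m) ** (- B) = - (A ** B)"
  by (simp add: matrix_matrix_mult_def vec_eq_iff sum_negf)

lemma mat_mult_nth: "(mat c ** A) $ a $ b = c * (A $ a $ b :: 'a::comm_semiring_1)"
  by (simp add: matrix_matrix_mult_def mat_def if_distrib if_distribR cong: if_cong)

lemma mult_mat_nth: "(A ** mat c) $ a $ b = c * (A $ a $ b :: 'a::comm_semiring_1)"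
  by (simp add: matrix_matrix_mult_def mat_def if_distrib if_distribR mult.commute cong: if_cong)

lemma mat_commute: "mat c ** A = A ** mat (c :: 'a::comm_semiring_1)"
  by (simp add: vec_eq_iff mat_mult_nth mult_mat_nth)

lemma bounded_bilinear_matrix_mult:
  "bounded_bilinear ((**) :: ('m::finite) cmat \<Rightarrow> 'm cmat \<Rightarrow> 'm cmat)"
proof -
  have "bilinear ((**) :: ('m::finite) cmat \<Rightarrow> 'm cmat \<Rightarrow> 'm cmat)"
    unfolding bilinear_def
    by (auto intro!: linearI simp: matrix_add_ldistrib matrix_mult_add_rdistrib vec_eq_iff
        matrix_matrix_mult_def scaleR_sum_right sum.distrib distrib_left distrib_right)
  then show ?thesis by (simp add: bilinear_conv_bounded_bilinear)
qed

interpretation matrix_mult: bounded_bilinear "(**) :: ('m::finite) cmat \<Rightarrow> 'm cmat \<Rightarrow> 'm cmat"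
  by (rule bounded_bilinear_matrix_mult)

lemma matrix_left_inverse_unique: "B ** A = mat 1 \<Longrightarrow> A ** C = mat 1 \<Longrightarrow> B = (C :: 'm::finite cmat)"
  by (metis matrix_mul_assoc matrix_mul_lid matrix_mul_rid)

lemma matrix_right_cancel:
  "P ** Q = mat 1 \<Longrightarrow> A ** (P :: 'm::finite cmat) = B ** P \<longleftrightarrow> A = B"
  by (metis matrix_mul_assoc matrix_mul_rid)

lemma conj_transpose_mul: "conj_transpose (A ** B) = conj_transpose B ** conj_transpose (A :: 'm::finite cmat)"
  by (simp add: conj_transpose_def matrix_matrix_mult_def vec_eq_iff mult.commute)

lemma conj_transpose_conj_transpose [simp]: "conj_transpose (conj_transpose A) = (A :: 'm::finite cmat)"
  by (simp add: conj_transpose_def vec_eq_iff)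

lemma conj_transpose_mat [simp]: "conj_transpose (mat c) = (mat (cnj c) :: 'm::finite cmat)"
  by (auto simp: conj_transpose_def vec_eq_iff mat_def)

lemma conj_transpose_add: "conj_transpose (A + B) = conj_transpose A + conj_transpose (B :: 'm::finite cmat)"
  by (simp add: conj_transpose_def vec_eq_iff)

lemma conj_transpose_diff: "conj_transpose (A - B) = conj_transpose A - conj_transpose (B :: 'm::finite cmat)"
  by (simp add: conj_transpose_def vec_eq_iff)

lemma conj_transpose_scaleR: "conj_transpose (r *\<^sub>R A) = r *\<^sub>R conj_transpose (A :: 'm::finite cmat)"
  by (simp add: conj_transpose_def vec_eq_iff)

lemma bounded_linear_conj_transpose: "bounded_linear (conj_transpose :: 'm::finite cmat \<Rightarrow> _)"
  by (auto intro!: linearI simp: conj_transpose_add conj_transpose_scaleR linear_conv_bounded_linear[symmetric])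

lemma bounded_linear_transpose: "bounded_linear (transpose :: 'm::finite cmat \<Rightarrow> _)"
  by (auto intro!: linearI simp: transpose_def vec_eq_iff linear_conv_bounded_linear[symmetric])

lemma unitary_group_commute: "u \<in> unitary_group \<Longrightarrow> u ** conj_transpose u = mat 1"
  by (simp add: unitary_group_def matrix_left_right_inverse)

lemma matrix_funpow_scaleR:
  "(((**) (t *\<^sub>R (X :: 'm cmat))) ^^ k) Y = t ^ k *\<^sub>R (((**) X) ^^ k) (Y :: 'm::finite cmat)"
  by (induction k) (simp_all add: matrix_mult.scaleR_left matrix_mult.scaleR_right)

text \<open>Comparison with the real exponential series: left multiplication by \<open>X\<close> is
  bounded by some constant \<open>C\<close>, so the powers of \<open>X\<close> grow at most like
  those of \<open>C\<close>.\<close>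

lemma mat_exp_sums: "(\<lambda>k. (((**) X) ^^ k) (mat 1) /\<^sub>R fact k) sums mat_exp (X :: 'm::finite cmat)"
proof -
  obtain C where C: "\<And>Y :: 'm cmat. norm (X ** Y) \<le> norm Y * C"
    using bounded_linear.bounded[OF matrix_mult.bounded_linear_right] by metis
  \<comment> \<open>The induction multiplies an inequality by \<open>C\<close>, so its sign matters;
    the bound at the nonzero identity matrix settles it.\<close>
  have C0: "C \<ge> 0"
  proof -
    have "0 \<le> norm (mat 1 :: 'm cmat) * C" using C[of "mat 1"] norm_ge_zero order_trans by blast
    moreover have "(mat 1 :: 'm cmat) \<noteq> 0" by (auto simp: vec_eq_iff mat_def)
    ultimately show ?thesis by (simp add: zero_le_mult_iff)
  qed
  have "norm ((((**) X) ^^ k) (mat 1)) \<le> C ^ k * norm (mat 1 :: 'm cmat)" for k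
  proof (induction k)
    case (Suc k)
    from mult_left_mono[OF this C0] show ?case
      using C[of "(((**) X) ^^ k) (mat 1)"] by (simp add: algebra_simps)
  qed simp
  then have "norm ((((**) X) ^^ k) (mat 1) /\<^sub>R fact k) \<le> (C ^ k /\<^sub>R fact k) * norm (mat 1 :: 'm cmat)" for k
    by (simp add: field_simps)
  moreover have "summable (\<lambda>k. (C ^ k /\<^sub>R fact k) * norm (mat 1 :: 'm cmat))"
    by (rule summable_mult2) (rule summable_exp_generic)
  ultimately have "summable (\<lambda>k. (((**) X) ^^ k) (mat 1) /\<^sub>R fact k)"
    by (rule summable_comparison_test'[rotated])
  then show ?thesis unfolding mat_exp_def by (rule summable_sums)
qed

lemma bounded_linear_mat_exp_sums:
  assumes "bounded_linear f"
  shows "(\<lambda>k. f ((((**) X) ^^ k) (mat 1)) /\<^sub>R fact k) sums f (mat_exp X)"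
proof -
  interpret bounded_linear f by fact
  show ?thesis using sums[OF mat_exp_sums, of X] by (simp add: scaleR)
qed

lemma mat_exp_0 [simp]: "mat_exp 0 = (mat 1 :: 'm::finite cmat)"
proof -
  have "(((**) 0) ^^ k) (mat 1 :: 'm cmat) /\<^sub>R fact k = (if k = 0 then mat 1 else 0)" for k
    by (cases k) auto
  then show ?thesis
    using sums_unique2[OF mat_exp_sums[of "0 :: 'm cmat"]] sums_single[of 0 "\<lambda>_. mat 1 :: 'm cmat"]
    by simp
qed

lemma mat_exp_nth_sums:
  "(\<lambda>k. (((**) X) ^^ k) (mat 1) $ a $ b / fact k) sums (mat_exp (X :: 'm::finite cmat) $ a $ b)"
proof -
  have "bounded_linear (\<lambda>Y :: 'm cmat. Y $ a $ b)"
    by (rule bounded_linear_compose[OF bounded_linear_vec_nth bounded_linear_vec_nth])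
  from bounded_linear_mat_exp_sums[OF this, of X] show ?thesis
    by (simp add: scaleR_conv_of_real divide_inverse mult.commute)
qed

text \<open>Every entry of \<open>mat_exp (t *\<^sub>R X)\<close> is a power series in
  \<open>t\<close>, differentiated termwise in a complex variable and then restricted to the real
  line. The entries are reassembled through inner products with the standard basis.\<close>

lemma mat_exp_has_vector_derivative:
  fixes X :: "'m::finite cmat"
  shows "((\<lambda>t. mat_exp (t *\<^sub>R X)) has_vector_derivative X ** mat_exp (t *\<^sub>R X)) (at t)"
proof -
  have "((\<lambda>t. mat_exp (t *\<^sub>R X) $ a $ b) has_vector_derivative (X ** mat_exp (t *\<^sub>R X)) $ a $ b) (at t)" for a b
  proof -
    define c where "c d k = (((**) X) ^^ k) (mat 1) $ d $ b / fact k" for d k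
    have *: "(\<lambda>k. c d k * of_real t ^ k) sums (mat_exp (t *\<^sub>R X) $ d $ b)" for d t
      using mat_exp_nth_sums[of "t *\<^sub>R X" d b]
      by (simp add: matrix_funpow_scaleR c_def scaleR_conv_of_real[where 'a=complex] mult.commute)
    have "summable (\<lambda>k. c a k * y ^ k)" for y :: complex
    proof (rule powser_inside)
      show "norm y < norm (complex_of_real (norm y + 1))" by simp
      show "summable (\<lambda>k. c a k * complex_of_real (norm y + 1) ^ k)" using * sums_summable by blast
    qed
    then have D: "DERIV (\<lambda>x. \<Sum>k. c a k * x ^ k) (of_real t) :> (\<Sum>k. diffs (c a) k * of_real t ^ k)"
      by (intro termdiffs_strong_converges_everywhere)
    \<comment> \<open>Differentiation cancels one factor of the factorial, and the surplus factor
      \<open>X\<close> of the next power is split off on the left.\<close>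
    have "diffs (c a) k = (\<Sum>d\<in>UNIV. X $ a $ d * c d k)" for k
    proof -
      have "fact (Suc k) = (of_nat (Suc k) * fact k :: complex)" by simp
      moreover have "(1 + of_nat k :: complex) \<noteq> 0" by (metis of_nat_Suc of_nat_neq_0)
      ultimately have "diffs (c a) k = (((**) X) ^^ Suc k) (mat 1) $ a $ b / fact k"
        by (simp only: diffs_def c_def) (simp add: divide_simps)
      then show ?thesis by (simp add: c_def matrix_matrix_mult_def sum_divide_distrib)
    qed
    then have "(\<lambda>k. diffs (c a) k * of_real t ^ k) sums (X ** mat_exp (t *\<^sub>R X)) $ a $ b"
      using sums_sum[of UNIV "\<lambda>d k. X $ a $ d * (c d k * of_real t ^ k)"] sums_mult[OF *]
      by (simp add: sum_distrib_right mult.assoc matrix_matrix_mult_def)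
    with D have "((\<lambda>x. \<Sum>k. c a k * x ^ k) has_field_derivative (X ** mat_exp (t *\<^sub>R X)) $ a $ b) (at (of_real t))"
      by (simp add: sums_iff)
    then have "((\<lambda>t. \<Sum>k. c a k * of_real t ^ k) has_vector_derivative (X ** mat_exp (t *\<^sub>R X)) $ a $ b) (at t)"
      by (rule has_vector_derivative_real_field)
    then show ?thesis using * by (simp add: sums_iff)
  qed
  then have "((\<lambda>t. mat_exp (t *\<^sub>R X) $ a $ b \<bullet> u) has_derivative
      (\<lambda>x. (x *\<^sub>R (X ** mat_exp (t *\<^sub>R X)) $ a $ b) \<bullet> u)) (at t)" for a b u
    unfolding has_vector_derivative_def by (rule has_derivative_inner_left)
  then show ?thesis
    unfolding has_vector_derivative_def
    by (subst has_derivative_componentwise_within) (auto simp: Basis_vec_def inner_axis)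
qed

lemma mat_exp_conjugate:
  fixes P Q X :: "'m::finite cmat"
  assumes "Q ** P = mat 1" "P ** Q = mat 1"
  shows "mat_exp (P ** X ** Q) = P ** mat_exp X ** Q"
proof -
  have "(((**) (P ** X ** Q)) ^^ k) (mat 1) = P ** (((**) X) ^^ k) (mat 1) ** Q" for k
  proof (induction k)
    case (Suc k)
    have "P ** X ** Q ** (P ** Y ** Q) = P ** (X ** Y) ** Q" for Y
      by (metis assms(1) matrix_mul_assoc matrix_mul_rid)
    with Suc show ?case by simp
  qed (simp add: assms)
  moreover have "bounded_linear (\<lambda>Y. P ** Y ** Q)"
    using bounded_linear_compose[of "\<lambda>Z. Z ** Q" "\<lambda>Y. P ** Y"]
    by (simp add: matrix_mult.bounded_linear_left matrix_mult.bounded_linear_right)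
  ultimately have "(\<lambda>k. (((**) (P ** X ** Q)) ^^ k) (mat 1) /\<^sub>R fact k) sums (P ** mat_exp X ** Q)"
    using bounded_linear_mat_exp_sums[of "\<lambda>Y. P ** Y ** Q" X] by simp
  then show ?thesis using mat_exp_sums sums_unique2 by blast
qed

lemma mat_exp_commute:
  fixes X Y :: "'m::finite cmat"
  assumes "X ** Y = Y ** X"
  shows "mat_exp X ** Y = Y ** mat_exp X"
proof -
  have "(((**) X) ^^ k) (mat 1) ** Y = Y ** (((**) X) ^^ k) (mat 1)" for k
    by (induction k) (simp_all, metis assms matrix_mul_assoc)
  then show ?thesis
    using bounded_linear_mat_exp_sums[OF matrix_mult.bounded_linear_left, of X Y]
      bounded_linear_mat_exp_sums[OF matrix_mult.bounded_linear_right, of Y X]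
    by (simp add: sums_iff)
qed

lemma lie_algebra_Int: "lie_algebra (A \<inter> B) = lie_algebra A \<inter> lie_algebra B"
  by (auto simp: lie_algebra_def)

text \<open>By the product rule the derivative of
  \<open>s (mat_exp (t *\<^sub>R X)) ** M ** mat_exp (t *\<^sub>R X)\<close> contains
  \<open>s X ** M + M ** X\<close> as middle factor for every \<open>t\<close>. At the origin this
  gives necessity; if the factor vanishes, the curve is constant. The map \<open>s\<close> is
  abstract because both \<open>transpose\<close> and \<open>conj_transpose\<close> are
  needed.\<close>

lemma lie_algebra_form:
  fixes s :: "'m::finite cmat \<Rightarrow> 'm cmat"
  assumes "bounded_linear s" and mul: "\<And>A B. s (A ** B) = s B ** s A" and one: "s (mat 1) = mat 1"
  shows "lie_algebra {g. s g ** M ** g = M} = {X. s X ** M + M ** X = 0}"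
proof -
  interpret s: bounded_linear s by fact
  have D: "((\<lambda>t. s (mat_exp (t *\<^sub>R X)) ** M ** mat_exp (t *\<^sub>R X)) has_vector_derivative
      s (mat_exp (t *\<^sub>R X)) ** (s X ** M + M ** X) ** mat_exp (t *\<^sub>R X)) (at t)" for X t
  proof -
    have "((\<lambda>t. s (mat_exp (t *\<^sub>R X)) ** M) has_vector_derivative s (X ** mat_exp (t *\<^sub>R X)) ** M) (at t)"
      using bounded_linear.has_vector_derivative[OF matrix_mult.bounded_linear_left
          s.has_vector_derivative[OF mat_exp_has_vector_derivative]] .
    from matrix_mult.has_vector_derivative[OF this mat_exp_has_vector_derivative]
    show ?thesis
      by (simp add: mul matrix_add_ldistrib matrix_mult_add_rdistrib matrix_mul_assoc add.commute)
  qed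
  show ?thesis
  proof (intro Set.set_eqI iffI)
    fix X assume "X \<in> lie_algebra {g. s g ** M ** g = M}"
    then have "(\<lambda>t. s (mat_exp (t *\<^sub>R X)) ** M ** mat_exp (t *\<^sub>R X)) = (\<lambda>t. M)"
      by (auto simp: lie_algebra_def)
    with D[of X 0] have "((\<lambda>t::real. M) has_vector_derivative (s X ** M + M ** X)) (at 0)"
      by (simp add: one)
    then show "X \<in> {X. s X ** M + M ** X = 0}"
      by (simp add: vector_derivative_unique_at[OF _ has_vector_derivative_const])
  next
    fix X assume "X \<in> {X. s X ** M + M ** X = 0}"
    then have "((\<lambda>t. s (mat_exp (t *\<^sub>R X)) ** M ** mat_exp (t *\<^sub>R X)) has_vector_derivative 0) (at t within UNIV)" for t
      using D[of X t] by (simp add: matrix_mult.zero_left matrix_mult.zero_right)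
    then obtain c where c: "\<And>t. s (mat_exp (t *\<^sub>R X)) ** M ** mat_exp (t *\<^sub>R X) = c"
      using has_vector_derivative_zero_constant[of UNIV] by (metis (no_types, lifting) convex_UNIV UNIV_I)
    from this[of 0] c show "X \<in> lie_algebra {g. s g ** M ** g = M}"
      by (simp add: one lie_algebra_def)
  qed
qed

text \<open>Differentiating the commutation relation at the origin gives one inclusion, and
  \<open>mat_exp_commute\<close> the other. It serves both Cartan subgroups and K, each of which is
  an intersection with a centralizer.\<close>

lemma lie_algebra_centralizer:
  "lie_algebra {g. \<forall>Y\<in>H. g ** Y = Y ** g} = {X :: 'm::finite cmat. \<forall>Y\<in>H. X ** Y = Y ** X}"
proof (intro Set.set_eqI iffI)
  fix X :: "'m cmat" assume X: "X \<in> lie_algebra {g. \<forall>Y\<in>H. g ** Y = Y ** g}"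
  have "X ** Y = Y ** X" if "Y \<in> H" for Y
  proof -
    have "((\<lambda>t. mat_exp (t *\<^sub>R X) ** Y) has_vector_derivative X ** mat_exp (0 *\<^sub>R X) ** Y) (at 0)"
      "((\<lambda>t. Y ** mat_exp (t *\<^sub>R X)) has_vector_derivative Y ** (X ** mat_exp (0 *\<^sub>R X))) (at 0)"
      using bounded_linear.has_vector_derivative[OF matrix_mult.bounded_linear_left mat_exp_has_vector_derivative]
        bounded_linear.has_vector_derivative[OF matrix_mult.bounded_linear_right mat_exp_has_vector_derivative]
      by blast+
    moreover have "(\<lambda>t. mat_exp (t *\<^sub>R X) ** Y) = (\<lambda>t. Y ** mat_exp (t *\<^sub>R X))"
      using X that by (auto simp: lie_algebra_def)
    ultimately show ?thesis using vector_derivative_unique_at by fastforce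
  qed
  then show "X \<in> {X. \<forall>Y\<in>H. X ** Y = Y ** X}" by simp
next
  fix X :: "'m cmat" assume "X \<in> {X. \<forall>Y\<in>H. X ** Y = Y ** X}"
  then show "X \<in> lie_algebra {g. \<forall>Y\<in>H. g ** Y = Y ** g}"
    by (auto simp: lie_algebra_def matrix_mult.scaleR_left matrix_mult.scaleR_right intro!: mat_exp_commute)
qed

subsection \<open>Joint eigenvectors of commuting Hermitian and skew-Hermitian matrices\<close>

text \<open>Variational argument: the quadratic form of \<open>f\<close> attains its maximum on the
  compact unit sphere of \<open>W\<close>; a maximizer is an eigenvector and the maximum is its
  eigenvalue.\<close>

lemma selfadjoint_eigenvector:
  fixes f :: "'a::euclidean_space \<Rightarrow> 'a"
  assumes "linear f" and sym: "\<And>x y. f x \<bullet> y = x \<bullet> f y"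
    and W: "subspace W" "W \<noteq> {0}" "f ` W \<subseteq> W"
  shows "\<exists>v\<in>W. v \<noteq> 0 \<and> (\<exists>c. f v = c *\<^sub>R v)"
proof -
  interpret f: linear f by fact
  have "compact (sphere 0 1 \<inter> W)"
    using W(1) closed_subspace compact_Int_closed compact_sphere by blast
  moreover from W obtain w where w: "w \<in> W" "w \<noteq> 0"
    using subspace_0 by blast
  then have "w /\<^sub>R norm w \<in> sphere 0 1 \<inter> W" using W(1) by (simp add: subspace_scale)
  then have "sphere 0 1 \<inter> W \<noteq> {}" by blast
  moreover have "continuous_on (sphere 0 1 \<inter> W) (\<lambda>x. f x \<bullet> x)"
    by (intro continuous_intros linear_continuous_on) (simp add: assms(1) linear_linear linear_conv_bounded_linear[symmetric])
  ultimately obtain v where v: "v \<in> W" "norm v = 1"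
    and max: "\<And>x. x \<in> W \<Longrightarrow> norm x = 1 \<Longrightarrow> f x \<bullet> x \<le> f v \<bullet> v"
    using continuous_attains_sup[of "sphere 0 1 \<inter> W" "\<lambda>x. f x \<bullet> x"] by (metis Int_iff mem_sphere_0)
  define c where "c = f v \<bullet> v"
  have bound: "f x \<bullet> x \<le> c * (x \<bullet> x)" if "x \<in> W" for x
  proof (cases "x = 0")
    case False
    then have "f (x /\<^sub>R norm x) \<bullet> (x /\<^sub>R norm x) \<le> c"
      unfolding c_def using that W(1) by (intro max) (auto simp: subspace_scale)
    with False show ?thesis
      by (simp add: f.scaleR power2_norm_eq_inner[symmetric] field_simps power2_eq_square)
  qed (simp add: f.zero)
  \<comment> \<open>The deviation of \<open>v\<close> from being an eigenvector is used as direction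
    of variation: to first order in \<open>t\<close> the form minus \<open>c\<close> times the
    squared norm grows by \<open>2 * t * (w \<bullet> w)\<close>, which maximality forbids unless
    \<open>w\<close> vanishes.\<close>
  define w where "w = f v - c *\<^sub>R v"
  have "w \<in> W" using v W unfolding w_def by (intro subspace_diff subspace_scale) auto
  define q where "q = f w \<bullet> w - c * (w \<bullet> w)"
  have "2 * t * (w \<bullet> w) + t\<^sup>2 * q \<le> 0" for t
  proof -
    have "v + t *\<^sub>R w \<in> W" using v \<open>w \<in> W\<close> W(1) by (intro subspace_add subspace_scale) auto
    from bound[OF this] have "f (v + t *\<^sub>R w) \<bullet> (v + t *\<^sub>R w) - c * ((v + t *\<^sub>R w) \<bullet> (v + t *\<^sub>R w)) \<le> 0" by simp
    moreover have "f w \<bullet> v = f v \<bullet> w" by (metis sym inner_commute)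
    moreover have "f v \<bullet> w = w \<bullet> w + c * (v \<bullet> w)" by (simp add: w_def algebra_simps inner_commute)
    moreover have "v \<bullet> v = 1" using v by (simp add: norm_eq_1)
    ultimately show ?thesis
      by (simp add: f.add f.scaleR inner_add_left inner_add_right q_def c_def[symmetric] inner_commute[of w v]
          algebra_simps power2_eq_square)
  qed note quad = this
  have "w \<bullet> w = 0"
  proof (rule ccontr)
    assume "w \<bullet> w \<noteq> 0"
    then have pos: "w \<bullet> w > 0" using inner_ge_zero[of w] by linarith
    \<comment> \<open>Small enough for the quadratic term in \<open>t\<close> to stay below the
      linear one; the added 1 keeps the denominator positive.\<close>
    define t where "t = (w \<bullet> w) / (\<bar>q\<bar> + 1)"
    have t: "t > 0" using pos by (simp add: t_def)
    have "t * (\<bar>q\<bar> + 1) = w \<bullet> w" by (simp add: t_def)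
    then have "t * \<bar>q\<bar> < w \<bullet> w" using t by (simp add: algebra_simps)
    moreover have "- (t * \<bar>q\<bar>) \<le> t * q"
      using mult_left_mono[of "- \<bar>q\<bar>" q t] t by simp
    ultimately have "0 < t * (2 * (w \<bullet> w) + t * q)" using t pos by (intro mult_pos_pos) linarith+
    with quad[of t] show False by (simp add: algebra_simps power2_eq_square)
  qed
  then have "f v = c *\<^sub>R v" by (simp add: w_def)
  with v show ?thesis by (metis norm_zero zero_neq_one)
qed

text \<open>Induction on the dimension of \<open>W\<close>. Either the whole family acts on
  \<open>W\<close> by scalars and any nonzero vector will do, or an eigenspace of a non-scalar
  member is a smaller subspace, invariant since the members commute. The family may be
  infinite.\<close>

lemma joint_selfadjoint_eigenvector:
  fixes F :: "('a::euclidean_space \<Rightarrow> 'a) set"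
  assumes lin: "\<And>f. f \<in> F \<Longrightarrow> linear f" and sym: "\<And>f x y. f \<in> F \<Longrightarrow> f x \<bullet> y = x \<bullet> f y"
    and comm: "\<And>f g x. f \<in> F \<Longrightarrow> g \<in> F \<Longrightarrow> f (g x) = g (f x)"
    and "subspace W" "W \<noteq> {0}" "\<And>f. f \<in> F \<Longrightarrow> f ` W \<subseteq> W"
  shows "\<exists>v\<in>W. v \<noteq> 0 \<and> (\<forall>f\<in>F. \<exists>c. f v = c *\<^sub>R v)"
  using assms(4-6)
proof (induction "dim W" arbitrary: W rule: less_induct)
  case less
  show ?case
  proof (cases "\<forall>f\<in>F. \<exists>c. \<forall>v\<in>W. f v = c *\<^sub>R v")
    case True
    then show ?thesis using less.prems subspace_0 by blast
  next
    case False
    then obtain f where f: "f \<in> F" "\<And>c. \<exists>v\<in>W. f v \<noteq> c *\<^sub>R v" by blast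
    interpret f: linear f using f lin by blast
    from selfadjoint_eigenvector[of f W] f lin sym less.prems
    obtain v c where v: "v \<in> W" "v \<noteq> 0" "f v = c *\<^sub>R v" by metis
    define W' where "W' = {w \<in> W. f w = c *\<^sub>R w}"
    have sub: "subspace W'"
      using less.prems(1) by (auto simp: W'_def subspace_def f.zero f.add f.scaleR algebra_simps)
    have ne: "W' \<noteq> {0}" using v by (auto simp: W'_def)
    have inv: "g ` W' \<subseteq> W'" if g: "g \<in> F" for g
    proof -
      interpret g: linear g using g lin by blast
      show ?thesis using less.prems(3)[OF g] comm[OF f(1) g] by (auto simp: W'_def g.scaleR)
    qed
    have "W' \<subset> W" using f(2)[of c] by (auto simp: W'_def)
    then have less_dim: "dim W' < dim W" using sub less.prems(1)
      by (metis dim_psubset span_eq_iff)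
    from less.hyps[OF less_dim sub ne inv] obtain u
      where "u \<in> W'" "u \<noteq> 0" "\<forall>f\<in>F. \<exists>c. f u = c *\<^sub>R u" by blast
    then show ?thesis by (auto simp: W'_def)
  qed
qed

definition herm_inner :: "(complex, 'm::finite) vec \<Rightarrow> (complex, 'm) vec \<Rightarrow> complex" where
  "herm_inner x y = (\<Sum>a\<in>UNIV. cnj (x $ a) * y $ a)"

lemma inner_eq_Re_herm_inner: "x \<bullet> y = Re (herm_inner x y)"
  by (simp add: inner_vec_def herm_inner_def inner_complex_def)

lemma herm_inner_scale_right: "herm_inner x (c *s y) = c * herm_inner x y"
  by (simp add: herm_inner_def sum_distrib_left mult_ac)

lemma herm_inner_scale_left: "herm_inner (c *s x) y = cnj c * herm_inner x y"
  by (simp add: herm_inner_def sum_distrib_left mult_ac)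

lemma herm_inner_add_right: "herm_inner x (y + z) = herm_inner x y + herm_inner x z"
  by (simp add: herm_inner_def sum.distrib algebra_simps)

lemma herm_inner_commute: "herm_inner y x = cnj (herm_inner x y)"
  by (simp add: herm_inner_def mult_ac)

lemma herm_inner_self: "herm_inner x x = of_real ((norm x)\<^sup>2)"
proof -
  have "Im (herm_inner x x) = 0" by (simp add: herm_inner_def)
  then show ?thesis by (simp add: complex_eq_iff power2_norm_eq_inner inner_eq_Re_herm_inner)
qed

lemma herm_inner_adjoint: "herm_inner x (A *v y) = herm_inner (conj_transpose A *v x) (y :: (complex, 'm::finite) vec)"
proof -
  have "herm_inner x (A *v y) = (\<Sum>a\<in>UNIV. \<Sum>b\<in>UNIV. cnj (x $ a) * (A $ a $ b * y $ b))"
    by (simp add: herm_inner_def matrix_vector_mult_def sum_distrib_left)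
  also have "\<dots> = (\<Sum>b\<in>UNIV. \<Sum>a\<in>UNIV. cnj (x $ a) * (A $ a $ b * y $ b))"
    by (rule sum.swap)
  finally show ?thesis
    by (simp add: herm_inner_def matrix_vector_mult_def conj_transpose_def sum_distrib_right sum_distrib_left mult_ac)
qed

lemma matrix_mul_nth_herm_inner: "(conj_transpose A ** B) $ a $ b = herm_inner (column a A) (column b (B :: 'm::finite cmat))"
  by (simp add: herm_inner_def matrix_matrix_mult_def conj_transpose_def column_def)

lemma matrix_vector_mult_smult: "A *v (c *s x) = c *s (A *v (x :: (complex, 'm::finite) vec))"
  by (simp add: vec_eq_iff matrix_vector_mult_def sum_distrib_left mult_ac)

lemma mat_mul_vector_mult: "(mat c ** A) *v x = c *s (A *v (x :: (complex, 'm::finite) vec))"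
  by (simp add: vec_eq_iff matrix_vector_mult_def mat_mult_nth sum_distrib_left mult_ac)

text \<open>A skew-Hermitian matrix becomes Hermitian, hence self-adjoint for the real inner product,
  after multiplication by \<open>\<i>\<close>.\<close>

lemma joint_eigenvector:
  fixes \<Y> :: "'m::finite cmat set"
  assumes herm: "\<And>Y. Y \<in> \<Y> \<Longrightarrow> conj_transpose Y = Y \<or> conj_transpose Y = - Y"
    and comm: "\<And>Y Z. Y \<in> \<Y> \<Longrightarrow> Z \<in> \<Y> \<Longrightarrow> Y ** Z = Z ** Y"
    and W: "subspace W" "W \<noteq> {0}" "\<And>x. x \<in> W \<Longrightarrow> \<i> *s x \<in> W"
      "\<And>x Y. Y \<in> \<Y> \<Longrightarrow> x \<in> W \<Longrightarrow> Y *v x \<in> W"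
  shows "\<exists>v\<in>W. v \<noteq> 0 \<and> (\<forall>Y\<in>\<Y>. \<exists>c. Y *v v = c *s v)"
proof -
  define h where "h Y = (if conj_transpose Y = Y then Y else mat \<i> ** Y)" for Y :: "'m cmat"
  define F where "F = (\<lambda>Y. (*v) (h Y)) ` \<Y>"
  have h: "conj_transpose (h Y) = h Y" if "Y \<in> \<Y>" for Y
  proof (cases "conj_transpose Y = Y")
    case False
    then have "conj_transpose Y = - Y" using herm that by blast
    moreover have "- Y ** mat (- \<i>) = mat \<i> ** Y" by (simp add: vec_eq_iff mat_mult_nth mult_mat_nth)
    ultimately show ?thesis using False by (simp add: h_def conj_transpose_mul)
  qed (simp add: h_def)
  have hcomm: "h Y ** h Z = h Z ** h Y" if "Y \<in> \<Y>" "Z \<in> \<Y>" for Y Z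
    using comm[OF that] unfolding h_def by (auto, (metis mat_commute matrix_mul_assoc)+)
  have "\<exists>v\<in>W. v \<noteq> 0 \<and> (\<forall>f\<in>F. \<exists>c. f v = c *\<^sub>R v)"
  proof (rule joint_selfadjoint_eigenvector)
    fix f x y assume "f \<in> F"
    then show "f x \<bullet> y = x \<bullet> f y"
      using h by (auto simp: F_def inner_eq_Re_herm_inner herm_inner_adjoint)
  next
    fix f g x assume "f \<in> F" "g \<in> F"
    then show "f (g x) = g (f x)"
      using hcomm by (auto simp: F_def matrix_vector_mul_assoc)
  next
    fix f assume "f \<in> F"
    then obtain Y where Y: "Y \<in> \<Y>" "f = (*v) (h Y)" by (auto simp: F_def)
    show "linear f" unfolding Y(2) by (rule matrix_vector_mul_linear)
    show "f ` W \<subseteq> W" using Y(1) W(3,4) unfolding Y(2) by (auto simp: h_def mat_mul_vector_mult)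
  qed (use W in auto)
  then obtain v where v: "v \<in> W" "v \<noteq> 0" and ev: "\<And>Y. Y \<in> \<Y> \<Longrightarrow> \<exists>c. h Y *v v = c *\<^sub>R v"
    by (auto simp: F_def)
  have "\<exists>c. Y *v v = c *s v" if "Y \<in> \<Y>" for Y
  proof -
    from ev[OF that] obtain c where c: "h Y *v v = c *\<^sub>R v" by blast
    show ?thesis
    proof (cases "conj_transpose Y = Y")
      case True
      with c have "Y *v v = of_real c *s v" by (simp add: h_def vec_eq_iff) (simp add: scaleR_conv_of_real)
      then show ?thesis ..
    next
      case False
      then have "\<i> *s (Y *v v) = c *\<^sub>R v" using c by (simp add: h_def mat_mul_vector_mult)
      then have "(- \<i>) *s (\<i> *s (Y *v v)) = (- \<i>) *s (c *\<^sub>R v)" by (rule arg_cong)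
      moreover have "(- \<i>) *s (\<i> *s (Y *v v)) = Y *v v" by (simp add: vec_eq_iff)
      moreover have "(- \<i>) *s (c *\<^sub>R v) = (- \<i> * of_real c) *s v"
        by (simp add: vec_eq_iff) (simp add: scaleR_conv_of_real)
      ultimately show ?thesis by metis
    qed
  qed
  with v show ?thesis by blast
qed

subsection \<open>Quaternionic diagonalization\<close>

text \<open>The indices \<open>a\<close> and \<open>opp a\<close> belong to one quaternionic
  coordinate, and \<open>opp_sgn a\<close> is the only nonzero entry of \<open>sympl_J\<close> in
  row \<open>a\<close>. With these two functions the block computations become uniform
  formulas.\<close>

fun opp :: "'n + 'n \<Rightarrow> 'n + 'n" where
  "opp (Inl i) = Inr i"
| "opp (Inr i) = Inl i"

fun opp_sgn :: "'n + 'n \<Rightarrow> complex" where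
  "opp_sgn (Inl i) = 1"
| "opp_sgn (Inr i) = - 1"

lemma opp_opp [simp]: "opp (opp a) = a" by (cases a) auto
lemma opp_eq_iff [simp]: "opp a = opp b \<longleftrightarrow> a = b" by (metis opp_opp)
lemma opp_sgn_opp [simp]: "opp_sgn (opp a) = - opp_sgn a" by (cases a) auto
lemma opp_sgn_square [simp]: "opp_sgn a * opp_sgn a = 1" by (cases a) auto
lemma opp_sgn_neq_0 [simp]: "opp_sgn a \<noteq> 0" by (cases a) auto
lemma cnj_opp_sgn [simp]: "cnj (opp_sgn a) = opp_sgn a" by (cases a) auto
lemma bij_opp: "bij opp" by (metis bijI' opp_opp)

lemma sum_opp: "(\<Sum>a\<in>UNIV. f (opp a)) = (\<Sum>a\<in>UNIV. f (a :: 'n::finite + 'n))"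
  by (rule sum.reindex_bij_betw) (use bij_opp in simp)

lemma sympl_J_nth: "sympl_J $ a $ b = (if b = opp a then opp_sgn a else 0)"
  by (cases a; cases b) (auto simp: sympl_J_def)

lemma sympl_J_mult_nth: "(sympl_J ** A) $ a $ b = opp_sgn a * A $ opp a $ b"
  by (simp add: matrix_matrix_mult_def sympl_J_nth if_distrib if_distribR cong: if_cong)

lemma mult_sympl_J_nth: "(A ** sympl_J) $ a $ b = - (opp_sgn b * A $ a $ opp b)"
proof -
  have "(A ** sympl_J) $ a $ b = (\<Sum>c\<in>UNIV. if c = opp b then A $ a $ c * opp_sgn c else 0)"
    unfolding matrix_matrix_mult_def vec_lambda_beta by (intro sum.cong) (auto simp: sympl_J_nth)
  then show ?thesis by (simp add: mult.commute)
qed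

lemma sympl_J_square [simp]: "sympl_J ** sympl_J = - (mat 1 :: ('n::finite + 'n) cmat)"
  by (auto simp: vec_eq_iff sympl_J_mult_nth sympl_J_nth mat_def)

lemma transpose_sympl_J [simp]: "transpose sympl_J = - sympl_J"
  by (auto simp: vec_eq_iff transpose_def sympl_J_nth)

lemma conj_transpose_sympl_J [simp]: "conj_transpose sympl_J = - (sympl_J :: ('n::finite + 'n) cmat)"
  by (auto simp: vec_eq_iff conj_transpose_def sympl_J_nth)

section \<open>The complex symplectic group and its compact form\<close>

lemma Sp_complex_one: "mat 1 \<in> Sp_complex"
  by (simp add: Sp_complex_def transpose_mat)

lemma Sp_complex_mult: "g \<in> Sp_complex \<Longrightarrow> h \<in> Sp_complex \<Longrightarrow> g ** h \<in> Sp_complex"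
  by (simp add: Sp_complex_def matrix_transpose_mul) (metis matrix_mul_assoc)

lemma sympl_J_in_Sp_complex: "sympl_J \<in> Sp_complex"
  by (simp add: Sp_complex_def matrix_minus_left)

lemma Sp_complex_left_inverse:
  assumes "g \<in> Sp_complex"
  shows "(- (sympl_J ** transpose g ** sympl_J)) ** g = mat 1"
proof -
  have "sympl_J ** (transpose g ** sympl_J ** g) = - mat 1"
    using assms by (simp add: Sp_complex_def)
  then show ?thesis by (simp add: matrix_minus_left matrix_mul_assoc)
qed

text \<open>A one-sided inverse of a square matrix is two-sided, so the explicit left inverse may be
  moved to the right of \<open>g\<close>; cancelling J leaves the defining relation for the
  transpose.\<close>

lemma transpose_in_Sp_complex:
  assumes "g \<in> Sp_complex"
  shows "transpose g \<in> Sp_complex"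
proof -
  have "g ** (- (sympl_J ** transpose g ** sympl_J)) = mat 1"
    using Sp_complex_left_inverse[OF assms] by (simp add: matrix_left_right_inverse)
  then have "g ** (- (sympl_J ** transpose g ** sympl_J)) ** sympl_J = sympl_J" by simp
  then have "g ** sympl_J ** transpose g = sympl_J"
    by (simp add: matrix_minus_left matrix_minus_right matrix_mul_assoc[symmetric])
  then show ?thesis by (simp add: Sp_complex_def)
qed

lemma conj_transpose_in_Sp_complex:
  assumes "g \<in> Sp_complex"
  shows "conj_transpose g \<in> Sp_complex"
proof -
  have "(transpose (transpose g) ** sympl_J ** transpose g) = sympl_J"
    using transpose_in_Sp_complex[OF assms] by (simp add: Sp_complex_def)
  then have "conj_transpose (g ** sympl_J ** transpose g) = conj_transpose sympl_J" by simp
  then have "conj_transpose (transpose g) ** sympl_J ** conj_transpose g = sympl_J"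
    by (simp add: conj_transpose_mul matrix_minus_left matrix_minus_right matrix_mul_assoc)
  moreover have "conj_transpose (transpose g) = transpose (conj_transpose g)"
    by (simp add: conj_transpose_def transpose_def vec_eq_iff)
  ultimately show ?thesis by (simp add: Sp_complex_def)
qed

lemma Sp_complex_inverse:
  assumes "g \<in> Sp_complex"
  obtains h where "h \<in> Sp_complex" "g ** h = mat 1" "h ** g = mat 1"
proof
  show "(- (sympl_J ** transpose g ** sympl_J)) ** g = mat 1"
    by (rule Sp_complex_left_inverse[OF assms])
  then show "g ** (- (sympl_J ** transpose g ** sympl_J)) = mat 1"
    by (simp add: matrix_left_right_inverse)
  have "sympl_J ** transpose g ** (- sympl_J) \<in> Sp_complex"
    by (intro Sp_complex_mult sympl_J_in_Sp_complex transpose_in_Sp_complex assms)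
      (use transpose_in_Sp_complex[OF sympl_J_in_Sp_complex] in simp)
  then show "- (sympl_J ** transpose g ** sympl_J) \<in> Sp_complex" by (simp add: matrix_minus_right)
qed

definition Sp_compact :: "('n::finite + 'n) cmat set" where
  "Sp_compact = Sp_complex \<inter> unitary_group"

lemma Sp_compact_one: "mat 1 \<in> Sp_compact"
  by (simp add: Sp_compact_def Sp_complex_one unitary_group_def)

lemma Sp_compact_mult: "g \<in> Sp_compact \<Longrightarrow> h \<in> Sp_compact \<Longrightarrow> g ** h \<in> Sp_compact"
  by (simp add: Sp_compact_def Sp_complex_mult unitary_group_def conj_transpose_mul)
    (metis matrix_mul_assoc matrix_mul_rid)

lemma Sp_compact_inverse:
  assumes "g \<in> Sp_compact"
  shows "conj_transpose g \<in> Sp_compact" "g ** conj_transpose g = mat 1" "conj_transpose g ** g = mat 1"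
  using assms by (auto simp: Sp_compact_def conj_transpose_in_Sp_complex unitary_group_commute)
    (auto simp: unitary_group_def matrix_left_right_inverse)

text \<open>This is J applied to the complex conjugate of \<open>v\<close>: an antilinear map with
  square -1, the action of the quaternion unit j on complex 2n-space viewed as quaternionic
  n-space.\<close>

definition quat_conj :: "(complex, 'n::finite + 'n) vec \<Rightarrow> (complex, 'n + 'n) vec" where
  "quat_conj v = (\<chi> a. opp_sgn a * cnj (v $ opp a))"

text \<open>Entrywise form of the condition that \<open>A\<close> commutes with
  \<open>quat_conj\<close>, equivalently that \<open>A\<close> times J equals J times the complex
  conjugate of \<open>A\<close>: the matrices of quaternion-linear maps.\<close>

definition quaternionic :: "('n::finite + 'n) cmat \<Rightarrow> bool" where
  "quaternionic A \<longleftrightarrow> (\<forall>a b. A $ opp a $ opp b = opp_sgn a * opp_sgn b * cnj (A $ a $ b))"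

lemma quaternionic_quat_conj:
  assumes "quaternionic A"
  shows "A *v quat_conj v = quat_conj (A *v v)"
proof -
  have "(A *v quat_conj v) $ a = quat_conj (A *v v) $ a" for a
  proof -
    have "(A *v quat_conj v) $ a = (\<Sum>b\<in>UNIV. A $ a $ opp b * (opp_sgn (opp b) * cnj (v $ b)))"
      using sum_opp[of "\<lambda>b. A $ a $ b * (opp_sgn b * cnj (v $ opp b))"]
      by (simp add: matrix_vector_mult_def quat_conj_def)
    also have "\<dots> = (\<Sum>b\<in>UNIV. opp_sgn a * (cnj (A $ opp a $ b) * cnj (v $ b)))"
    proof (rule sum.cong)
      fix b
      from assms have "A $ a $ opp b = opp_sgn (opp a) * opp_sgn b * cnj (A $ opp a $ b)"
        unfolding quaternionic_def by (metis opp_opp)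
      then have "A $ a $ opp b * opp_sgn (opp b) = opp_sgn a * cnj (A $ opp a $ b) * (opp_sgn b * opp_sgn b)"
        by (simp del: opp_sgn_square)
      then show "A $ a $ opp b * (opp_sgn (opp b) * cnj (v $ b)) = opp_sgn a * (cnj (A $ opp a $ b) * cnj (v $ b))"
        by (simp only: mult.assoc[symmetric]) simp
    qed simp
    also have "\<dots> = quat_conj (A *v v) $ a"
      by (simp add: matrix_vector_mult_def quat_conj_def sum_distrib_left)
    finally show ?thesis .
  qed
  then show ?thesis by (simp add: vec_eq_iff)
qed

text \<open>For a unitary \<open>g\<close> the inverse of the transpose is the complex conjugate,
  written here as \<open>transpose (conj_transpose g)\<close>. The symplectic relation then says
  that J intertwines \<open>g\<close> with its complex conjugate.\<close>

lemma Sp_compact_quaternionic: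
  assumes "g \<in> Sp_compact"
  shows "quaternionic g"
proof -
  have "sympl_J ** g = transpose (conj_transpose g) ** sympl_J"
  proof -
    have "transpose g ** transpose (conj_transpose g) = mat 1"
      using assms by (simp add: Sp_compact_def unitary_group_def matrix_transpose_mul[symmetric] transpose_mat)
    then have "transpose (conj_transpose g) ** transpose g = mat 1" by (simp add: matrix_left_right_inverse)
    moreover have "transpose g ** (sympl_J ** g) = sympl_J"
      using assms by (simp add: Sp_compact_def Sp_complex_def matrix_mul_assoc)
    ultimately show ?thesis by (metis matrix_mul_assoc matrix_mul_lid)
  qed
  then have "opp_sgn a * g $ opp a $ opp b = - (opp_sgn (opp b) * cnj (g $ a $ opp (opp b)))" for a b
    by (metis (no_types, lifting) sympl_J_mult_nth mult_sympl_J_nth conj_transpose_def transpose_def vec_lambda_beta)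
  then have "opp_sgn a * (opp_sgn a * g $ opp a $ opp b) = opp_sgn a * (opp_sgn b * cnj (g $ a $ b))" for a b
    by simp
  then have "g $ opp a $ opp b = opp_sgn a * (opp_sgn b * cnj (g $ a $ b))" for a b
    by (metis mult.assoc opp_sgn_square mult_1)
  then show ?thesis by (simp add: quaternionic_def mult.assoc)
qed

lemma unitary_quaternionic_in_Sp_compact:
  assumes "g \<in> unitary_group" "quaternionic g"
  shows "g \<in> Sp_compact"
proof -
  have "sympl_J ** g = transpose (conj_transpose g) ** sympl_J"
  proof -
    have "opp_sgn a * g $ opp a $ b = - (opp_sgn b * cnj (g $ a $ opp b))" for a b
    proof -
      have "g $ opp a $ opp (opp b) = opp_sgn a * opp_sgn (opp b) * cnj (g $ a $ opp b)"
        using assms(2) unfolding quaternionic_def by blast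
      then show ?thesis by (simp add: mult.assoc[symmetric])
    qed
    then show ?thesis
      by (simp add: vec_eq_iff sympl_J_mult_nth mult_sympl_J_nth conj_transpose_def transpose_def)
  qed
  moreover have "transpose g ** transpose (conj_transpose g) = mat 1"
    using assms by (simp add: unitary_group_def matrix_transpose_mul[symmetric] transpose_mat)
  ultimately have "transpose g ** (sympl_J ** g) = sympl_J"
    by (simp only: matrix_mul_assoc) simp
  then have "transpose g ** sympl_J ** g = sympl_J" by (simp only: matrix_mul_assoc)
  then show ?thesis using assms by (simp add: Sp_compact_def Sp_complex_def)
qed

lemma herm_inner_quat_conj_quat_conj: "herm_inner (quat_conj x) (quat_conj y) = cnj (herm_inner x y)"
proof -
  have "herm_inner (quat_conj x) (quat_conj y) = (\<Sum>a\<in>UNIV. (\<lambda>a. x $ a * cnj (y $ a)) (opp a))"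
    unfolding herm_inner_def
  proof (rule sum.cong)
    fix a
    have "cnj (quat_conj x $ a) * quat_conj y $ a = (opp_sgn a * opp_sgn a) * (x $ opp a * cnj (y $ opp a))"
      by (simp add: quat_conj_def del: opp_sgn_square)
    then show "cnj (quat_conj x $ a) * quat_conj y $ a = (\<lambda>a. x $ a * cnj (y $ a)) (opp a)" by simp
  qed simp
  also have "\<dots> = cnj (herm_inner x y)" by (subst sum_opp) (simp add: herm_inner_def)
  finally show ?thesis .
qed

lemma quat_conj_quat_conj: "quat_conj (quat_conj x) = - x"
  by (simp add: quat_conj_def vec_eq_iff mult.assoc[symmetric])

text \<open>Up to complex conjugation \<open>herm_inner x (quat_conj y)\<close> is the symplectic
  form, which is alternating. Hence a vector is automatically orthogonal to its quaternionic
  partner.\<close>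

lemma herm_inner_quat_conj_swap: "herm_inner x (quat_conj y) = - herm_inner y (quat_conj x)"
proof -
  have "herm_inner (- x) (quat_conj y) = herm_inner (quat_conj (quat_conj x)) (quat_conj y)" by (simp add: quat_conj_quat_conj)
  also have "\<dots> = herm_inner y (quat_conj x)" by (metis herm_inner_quat_conj_quat_conj herm_inner_commute)
  finally have "- herm_inner x (quat_conj y) = herm_inner y (quat_conj x)" by (simp add: herm_inner_def sum_negf)
  then show ?thesis by (metis minus_minus)
qed

lemma herm_inner_quat_conj_self [simp]: "herm_inner x (quat_conj x) = 0"
  using herm_inner_quat_conj_swap[of x x] by simp

lemma quat_conj_smult: "quat_conj (c *s x) = cnj c *s quat_conj x"
  by (simp add: quat_conj_def vec_eq_iff)

definition diag :: "('m \<Rightarrow> complex) \<Rightarrow> ('m::finite) cmat" where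
  "diag d = (\<chi> a b. if a = b then d a else 0)"

text \<open>One eigenvector is added at a time. The complement of the vectors found so far and of
  their partners is invariant, because each matrix is Hermitian or skew-Hermitian and the removed
  vectors are eigenvectors. It is nonzero as long as fewer than n vectors have been chosen, so it
  contains a joint eigenvector.\<close>

lemma quaternionic_joint_eigenbasis:
  fixes \<Y> :: "('n::finite + 'n) cmat set" and I :: "'n set"
  assumes herm: "\<And>Y. Y \<in> \<Y> \<Longrightarrow> conj_transpose Y = Y \<or> conj_transpose Y = - Y"
    and comm: "\<And>Y Z. Y \<in> \<Y> \<Longrightarrow> Z \<in> \<Y> \<Longrightarrow> Y ** Z = Z ** Y"
    and quat: "\<And>Y. Y \<in> \<Y> \<Longrightarrow> quaternionic Y"
  shows "\<exists>b. (\<forall>i\<in>I. \<forall>k\<in>I. herm_inner (b i) (b k) = (if i = k then 1 else 0) \<and> herm_inner (b i) (quat_conj (b k)) = 0) \<and>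
    (\<forall>i\<in>I. \<forall>Y\<in>\<Y>. \<exists>c. Y *v b i = c *s b i)"
  using finite[of I]
proof (induction I)
  case (insert l I)
  then obtain b where
      orth: "\<And>i k. i \<in> I \<Longrightarrow> k \<in> I \<Longrightarrow> herm_inner (b i) (b k) = (if i = k then 1 else 0)"
        "\<And>i k. i \<in> I \<Longrightarrow> k \<in> I \<Longrightarrow> herm_inner (b i) (quat_conj (b k)) = 0"
    and ev: "\<And>i Y. i \<in> I \<Longrightarrow> Y \<in> \<Y> \<Longrightarrow> \<exists>c. Y *v b i = c *s b i" by blast
  define W where "W = {w. \<forall>i\<in>I. herm_inner (b i) w = 0 \<and> herm_inner (quat_conj (b i)) w = 0}"
  have "W \<noteq> {0}"
  proof -
    \<comment> \<open>Four real vectors span each quaternionic line already used, against the real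
      dimension 4n of the whole space.\<close>
    define B where "B = (\<Union>i\<in>I. {b i, \<i> *s b i, quat_conj (b i), \<i> *s quat_conj (b i)})"
    have "card B \<le> (\<Sum>i\<in>I. card {b i, \<i> *s b i, quat_conj (b i), \<i> *s quat_conj (b i)})"
      unfolding B_def using insert.hyps by (intro card_UN_le)
    also have "\<dots> \<le> (\<Sum>i\<in>I. 4)" by (rule sum_mono) (auto intro!: order_trans[OF card_insert_le_m1])
    also have "\<dots> = 4 * card I" by simp
    also have "\<dots> < 4 * CARD('n)"
      using insert.hyps psubset_card_mono[of UNIV I] by auto
    finally have "card B < DIM(complex^('n + 'n))" by (simp add: card_Plus)
    moreover have "finite B" using insert.hyps by (auto simp: B_def)
    ultimately have "dim B < DIM(complex^('n + 'n))" using dim_le_card' le_less_trans by blast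
    then obtain x where x: "x \<noteq> 0" "\<And>y. y \<in> span B \<Longrightarrow> orthogonal x y"
      using orthogonal_to_subspace_exists by blast
    have "herm_inner z x = 0" if "z \<in> B" "\<i> *s z \<in> B" for z
    proof -
      have "Re (herm_inner z x) = 0" "Re (herm_inner (\<i> *s z) x) = 0"
        using x(2)[of z] x(2)[of "\<i> *s z"] that
        by (simp_all add: span_base orthogonal_def inner_eq_Re_herm_inner[symmetric] inner_commute)
      then show ?thesis by (simp add: herm_inner_scale_left complex_eq_iff)
    qed
    then have "x \<in> W" by (auto simp: W_def B_def)
    with x show ?thesis by blast
  qed
  moreover have "subspace W"
    by (auto simp: W_def subspace_def herm_inner_add_right) (auto simp: herm_inner_def scaleR_sum_right[symmetric])
  moreover have "\<i> *s x \<in> W" if "x \<in> W" for x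
    using that by (auto simp: W_def herm_inner_scale_right)
  moreover have "Y *v x \<in> W" if "Y \<in> \<Y>" "x \<in> W" for x Y
  proof -
    \<comment> \<open>The adjoint moves \<open>Y\<close> onto the eigenvector \<open>v\<close>, so
      \<open>Y *v x\<close> inherits the orthogonality of \<open>x\<close> to
      \<open>v\<close>.\<close>
    have *: "herm_inner v (Y *v x) = 0" if "herm_inner v x = 0" "Y *v v = c *s v" for v c
    proof (cases "conj_transpose Y = Y")
      case False
      then have "conj_transpose Y = - Y" using herm[OF \<open>Y \<in> \<Y>\<close>] by blast
      then have "herm_inner v (Y *v x) = herm_inner (- (c *s v)) x"
        using that(2) by (simp add: herm_inner_adjoint) (simp add: matrix_vector_mult_def herm_inner_def sum_negf vec_eq_iff)
      moreover have "- (c *s v) = (- c) *s v" by (simp add: vec_eq_iff)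
      ultimately have "herm_inner v (Y *v x) = herm_inner ((- c) *s v) x" by metis
      then show ?thesis using that by (simp only: herm_inner_scale_left) simp
    qed (use that in \<open>simp add: herm_inner_adjoint herm_inner_scale_left\<close>)
    show ?thesis unfolding W_def
    proof (clarify, intro conjI)
      fix i assume i: "i \<in> I"
      from ev[OF i \<open>Y \<in> \<Y>\<close>] obtain c where c: "Y *v b i = c *s b i" by blast
      show "herm_inner (b i) (Y *v x) = 0" using *[OF _ c] i \<open>x \<in> W\<close> by (simp add: W_def)
      \<comment> \<open>\<open>Y\<close> commutes with the antilinear map \<open>quat_conj\<close>,
        so the partner is an eigenvector for the conjugate eigenvalue.\<close>
      have "Y *v quat_conj (b i) = cnj c *s quat_conj (b i)"
        using quat[OF \<open>Y \<in> \<Y>\<close>] c by (simp add: quaternionic_quat_conj quat_conj_smult)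
      from *[OF _ this] show "herm_inner (quat_conj (b i)) (Y *v x) = 0" using i \<open>x \<in> W\<close> by (simp add: W_def)
    qed
  qed
  ultimately obtain v where v: "v \<in> W" "v \<noteq> 0" "\<And>Y. Y \<in> \<Y> \<Longrightarrow> \<exists>c. Y *v v = c *s v"
    using joint_eigenvector[OF herm comm, of \<Y> W] by blast
  define e where "e = of_real (1 / norm v) *s v"
  have e1: "herm_inner e e = 1"
    unfolding e_def herm_inner_scale_left herm_inner_scale_right herm_inner_self[of v]
    using v(2) by (simp add: power2_eq_square)
  have eW: "herm_inner (b i) e = 0" "herm_inner (quat_conj (b i)) e = 0" if "i \<in> I" for i
    using v(1) that by (auto simp: e_def W_def herm_inner_scale_right)
  have eW': "herm_inner e (b i) = 0" "herm_inner e (quat_conj (b i)) = 0" "herm_inner (b i) (quat_conj e) = 0" if "i \<in> I" for i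
  proof -
    show "herm_inner e (b i) = 0" using eW(1)[OF that] by (metis complex_cnj_zero herm_inner_commute)
    show *: "herm_inner e (quat_conj (b i)) = 0" using eW(2)[OF that] by (metis complex_cnj_zero herm_inner_commute)
    show "herm_inner (b i) (quat_conj e) = 0" using * herm_inner_quat_conj_swap[of "b i" e] by simp
  qed
  have ee: "\<exists>c. Y *v e = c *s e" if "Y \<in> \<Y>" for Y
  proof -
    from v(3)[OF that] obtain c where "Y *v v = c *s v" ..
    then have "Y *v e = c *s e" by (simp add: e_def matrix_vector_mult_smult vector_smult_assoc mult.commute)
    then show ?thesis ..
  qed
  have "l \<notin> I" by fact
  show ?case
  proof (intro exI[of _ "b(l := e)"] conjI ballI)
    fix i k assume ik: "i \<in> insert l I" "k \<in> insert l I"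
    show "herm_inner ((b(l := e)) i) ((b(l := e)) k) = (if i = k then 1 else 0)"
      "herm_inner ((b(l := e)) i) (quat_conj ((b(l := e)) k)) = 0"
      using ik \<open>l \<notin> I\<close>
      by (cases "i = l"; cases "k = l"; simp add: orth e1 eW eW')+
  next
    fix i Y assume "i \<in> insert l I" "Y \<in> \<Y>"
    then show "\<exists>c. Y *v (b(l := e)) i = c *s (b(l := e)) i"
      using ev[of i Y] ee[of Y] \<open>l \<notin> I\<close> by (cases "i = l") simp_all
  qed
qed auto

theorem quaternionic_diagonalization:
  fixes \<Y> :: "('n::finite + 'n) cmat set"
  assumes herm: "\<And>Y. Y \<in> \<Y> \<Longrightarrow> conj_transpose Y = Y \<or> conj_transpose Y = - Y"
    and comm: "\<And>Y Z. Y \<in> \<Y> \<Longrightarrow> Z \<in> \<Y> \<Longrightarrow> Y ** Z = Z ** Y"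
    and quat: "\<And>Y. Y \<in> \<Y> \<Longrightarrow> quaternionic Y"
  shows "\<exists>g\<in>Sp_compact. \<forall>Y\<in>\<Y>. \<exists>d. conj_transpose g ** Y ** g = diag d"
proof -
  have "\<exists>b. (\<forall>i\<in>(UNIV :: 'n set). \<forall>k\<in>UNIV. herm_inner (b i) (b k) = (if i = k then 1 else 0) \<and> herm_inner (b i) (quat_conj (b k)) = 0) \<and>
    (\<forall>i\<in>UNIV. \<forall>Y\<in>\<Y>. \<exists>c. Y *v b i = c *s b i)"
    by (intro quaternionic_joint_eigenbasis assms)
  then obtain b :: "'n \<Rightarrow> (complex, 'n + 'n) vec" where
      b: "\<forall>i\<in>UNIV. \<forall>k\<in>UNIV. herm_inner (b i) (b k) = (if i = k then 1 else 0) \<and> herm_inner (b i) (quat_conj (b k)) = 0"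
        "\<forall>i\<in>UNIV. \<forall>Y\<in>\<Y>. \<exists>c. Y *v b i = c *s b i"
    by blast
  have orth: "herm_inner (b i) (b k) = (if i = k then 1 else 0)" "herm_inner (b i) (quat_conj (b k)) = 0"
    and ev: "Y \<in> \<Y> \<Longrightarrow> \<exists>c. Y *v b i = c *s b i" for i k Y
    using b by blast+
  \<comment> \<open>Both vectors of each quaternionic pair become columns; the minus sign is the one
    that makes the resulting matrix quaternionic.\<close>
  define col where "col c = (case c of Inl i \<Rightarrow> b i | Inr i \<Rightarrow> - quat_conj (b i))" for c
  define g where "g = (\<chi> a c. col c $ a)"
  have col: "column c g = col c" for c by (simp add: g_def column_def vec_eq_iff)
  have neg: "herm_inner (- x) y = - herm_inner x y" "herm_inner x (- y) = - herm_inner x y" for x y :: "(complex, 'n + 'n) vec"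
    by (simp_all add: herm_inner_def sum_negf)
  have orth': "herm_inner (quat_conj (b i)) (b k) = 0" for i k
    using orth(2)[of k i] by (metis complex_cnj_zero herm_inner_commute)
  have orthcol: "herm_inner (col c) (col c') = (if c = c' then 1 else 0)" for c c'
    by (cases c; cases c') (simp_all add: col_def neg orth orth' herm_inner_quat_conj_quat_conj)
  then have "g \<in> unitary_group"
    by (simp add: unitary_group_def vec_eq_iff matrix_mul_nth_herm_inner col mat_def)
  moreover have "quaternionic g"
    unfolding quaternionic_def
  proof (intro allI)
    fix a c
    show "g $ opp a $ opp c = opp_sgn a * opp_sgn c * cnj (g $ a $ c)"
    proof (cases c)
      case (Inl i)
      then show ?thesis by (simp add: g_def col_def quat_conj_def)
    next
      case (Inr i)
      then have "opp_sgn a * opp_sgn c * cnj (g $ a $ c) = (opp_sgn a * opp_sgn a) * (b i $ opp a)"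
        by (simp add: g_def col_def quat_conj_def del: opp_sgn_square)
      then show ?thesis using Inr by (simp add: g_def col_def)
    qed
  qed
  ultimately have "g \<in> Sp_compact" by (rule unitary_quaternionic_in_Sp_compact)
  moreover have "\<exists>d. conj_transpose g ** Y ** g = diag d" if Y: "Y \<in> \<Y>" for Y
  proof -
    have "\<exists>d. Y *v col c = d *s col c" for c
    proof (cases c)
      case (Inl i)
      then show ?thesis using ev[OF Y, of i] by (simp add: col_def)
    next
      case (Inr i)
      from ev[OF Y, of i] obtain d where "Y *v b i = d *s b i" by blast
      then have "Y *v quat_conj (b i) = cnj d *s quat_conj (b i)"
        using quat[OF Y] by (simp add: quaternionic_quat_conj quat_conj_smult)
      moreover have "Y *v (- x) = - (Y *v x)" for x
        by (simp add: vec_eq_iff matrix_vector_mult_def sum_negf)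
      ultimately have "Y *v col c = cnj d *s col c" using Inr by (simp add: col_def vec_eq_iff)
      then show ?thesis ..
    qed
    then obtain d where d: "\<And>c. Y *v col c = d c *s col c" by metis
    have "column c (Y ** g) = Y *v column c g" for c
      by (simp add: vec_eq_iff column_def matrix_matrix_mult_def matrix_vector_mult_def)
    then have "column c (Y ** g) = d c *s col c" for c
      by (simp only: col d)
    then have "(conj_transpose g ** (Y ** g)) $ c $ c' = diag d $ c $ c'" for c c'
      by (simp add: matrix_mul_nth_herm_inner col herm_inner_scale_right orthcol diag_def)
    then have "conj_transpose g ** Y ** g = diag d"
      by (simp add: vec_eq_iff matrix_mul_assoc[symmetric])
    then show ?thesis by (rule exI[of _ d])
  qed
  ultimately show ?thesis by blast
qed

subsection \<open>Conjugacy of compact Cartan subgroups\<close>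

lemma diag_mult_nth: "(diag d ** A) $ a $ b = d a * A $ a $ b"
  by (simp add: matrix_matrix_mult_def diag_def if_distrib if_distribR cong: if_cong)

lemma mult_diag_nth: "(A ** diag d) $ a $ b = A $ a $ b * d b"
  by (simp add: matrix_matrix_mult_def diag_def if_distrib if_distribR cong: if_cong)

lemma diag_nth: "diag d $ a $ b = (if a = b then d a else 0)"
  by (simp add: diag_def)

lemma diag_mult: "diag d ** diag e = diag (\<lambda>a. d a * e a)"
  by (simp add: vec_eq_iff diag_mult_nth) (simp add: diag_nth)

lemma diag_commute: "diag d ** diag e = diag e ** diag d"
  by (simp add: diag_mult mult.commute)

lemma diag_eq_iff [simp]: "diag d = diag e \<longleftrightarrow> d = e"
  by (auto simp: vec_eq_iff diag_nth fun_eq_iff)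

lemma mat_eq_diag: "mat c = diag (\<lambda>_. c)"
  by (simp add: vec_eq_iff diag_nth mat_def)

lemma conj_transpose_diag: "conj_transpose (diag d) = diag (\<lambda>a. cnj (d a))"
  by (auto simp: vec_eq_iff diag_nth conj_transpose_def)

lemma transpose_diag: "transpose (diag d) = diag d"
  by (auto simp: vec_eq_iff diag_nth transpose_def)

lemma diag_in_Sp_complex: "diag d \<in> Sp_complex \<longleftrightarrow> (\<forall>a. d a * d (opp a) = 1)"
proof -
  have "(transpose (diag d) ** sympl_J ** diag d) $ a $ b = (if b = opp a then d a * opp_sgn a * d (opp a) else 0)" for a b
    by (simp add: transpose_diag mult_diag_nth diag_mult_nth sympl_J_nth)
  then show ?thesis
    by (auto simp: Sp_complex_def vec_eq_iff sympl_J_nth)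
qed

lemma diag_in_unitary_group: "diag d \<in> unitary_group \<longleftrightarrow> (\<forall>a. cnj (d a) * d a = 1)"
  by (simp add: unitary_group_def conj_transpose_diag diag_mult mat_eq_diag fun_eq_iff)

lemma quaternionic_diag: "quaternionic (diag d) \<longleftrightarrow> (\<forall>a. d (opp a) = cnj (d a))"
  by (auto simp: quaternionic_def diag_nth)

lemma mat_exp_diag: "mat_exp (diag d) = diag (\<lambda>a. exp (d a))"
proof -
  have "(((**) (diag d)) ^^ k) (mat 1) = diag (\<lambda>a. d a ^ k)" for k
    by (induction k) (simp_all add: diag_mult mat_eq_diag)
  then have sums: "(\<lambda>k. (if a = b then d a ^ k else 0) / fact k) sums (mat_exp (diag d) $ a $ b)" for a b
    using mat_exp_nth_sums[of "diag d" a b] by (simp add: diag_nth)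
  have "mat_exp (diag d) $ a $ b = diag (\<lambda>a. exp (d a)) $ a $ b" for a b
  proof (cases "a = b")
    case True
    have "(\<lambda>k. d a ^ k /\<^sub>R fact k) sums exp (d a)" by (rule exp_converges)
    with sums[of a b] True show ?thesis
      by (simp add: diag_nth scaleR_conv_of_real divide_inverse mult.commute sums_unique2)
  next
    case False
    with sums[of a b] show ?thesis by (simp add: diag_nth sums_iff)
  qed
  then show ?thesis by (simp add: vec_eq_iff)
qed

lemma commute_regular_diag:
  assumes "A ** diag d = diag d ** A" "inj d"
  obtains e where "A = diag e"
proof -
  have "A $ a $ b * d b = d a * A $ a $ b" for a b
    using assms(1) by (metis mult_diag_nth diag_mult_nth)
  then have "A $ a $ b = 0" if "a \<noteq> b" for a b
    using that assms(2) by (metis injD mult.commute mult_cancel_left)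
  then have "A = diag (\<lambda>a. A $ a $ a)" by (simp add: vec_eq_iff diag_nth)
  then show ?thesis by (rule that)
qed

definition C_torus :: "('n::finite + 'n) cmat set" where
  "C_torus = {diag d | d. \<forall>a. d a * d (opp a) = 1}"

definition U_torus :: "('n::finite + 'n) cmat set" where
  "U_torus = C_torus \<inter> unitary_group"

definition U_torus_algebra :: "('n::finite + 'n) cmat set" where
  "U_torus_algebra = {diag d | d. \<forall>a. d (opp a) = - d a \<and> cnj (d a) = - d a}"

lemma C_torus_subset: "C_torus \<subseteq> Sp_complex"
  by (auto simp: C_torus_def diag_in_Sp_complex)

lemma C_torus_iff: "diag d \<in> C_torus \<longleftrightarrow> diag d \<in> Sp_complex"
  by (auto simp: C_torus_def diag_in_Sp_complex)

lemma regular_U_torus_algebra: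
  obtains r where "diag r \<in> U_torus_algebra" "inj (r :: 'n::finite + 'n \<Rightarrow> complex)"
proof -
  obtain f :: "'n \<Rightarrow> nat" where f: "inj f"
    using finite_imp_inj_to_nat_seg[of "UNIV :: 'n set"] by auto
  \<comment> \<open>The shift by \<open>Suc\<close> keeps all entries away from 0, so that the two
    entries of a pair are different.\<close>
  define r :: "'n + 'n \<Rightarrow> complex" where
    "r a = (case a of Inl i \<Rightarrow> \<i> * of_nat (Suc (f i)) | Inr i \<Rightarrow> - \<i> * of_nat (Suc (f i)))" for a
  have "r (opp a) = - r a \<and> cnj (r a) = - r a" for a
    by (cases a) (simp_all add: r_def)
  then have "diag r \<in> U_torus_algebra" by (auto simp: U_torus_algebra_def)
  moreover have "inj r"
  proof (rule injI)
    fix a b assume "r a = r b"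
    then have "Im (r a) = Im (r b)" by simp
    then show "a = b"
      using f by (cases a; cases b) (auto simp: r_def inj_def)
  qed
  ultimately show ?thesis by (rule that)
qed

text \<open>The Cayley transform turns a regular element of the Lie algebra into one of the torus.\<close>

lemma regular_U_torus:
  obtains u where "diag u \<in> U_torus" "inj (u :: 'n::finite + 'n \<Rightarrow> complex)"
proof -
  obtain r where r: "diag r \<in> U_torus_algebra" "inj (r :: 'n + 'n \<Rightarrow> complex)"
    by (rule regular_U_torus_algebra)
  then have r': "r (opp a) = - r a" "cnj (r a) = - r a" for a by (auto simp: U_torus_algebra_def)
  have "Re (r a) = 0" for a using r'(2)[of a] by (simp add: complex_eq_iff)
  then have nz: "1 + r a \<noteq> 0" "1 - r a \<noteq> 0" for a by (auto simp: complex_eq_iff)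
  define u where "u a = (1 + r a) / (1 - r a)" for a
  have "u a * u (opp a) = 1" "cnj (u a) * u a = 1" for a
    using nz[of a] by (simp_all add: u_def r')
  then have "diag u \<in> U_torus"
    by (auto simp: U_torus_def C_torus_def diag_in_unitary_group)
  moreover have "inj u"
  proof (rule injI)
    fix a b assume "u a = u b"
    then have "(1 + r a) * (1 - r b) = (1 + r b) * (1 - r a)"
      using nz by (simp add: u_def frac_eq_eq)
    then have "2 * r a = 2 * r b" by (simp add: algebra_simps)
    then show "a = b" using r(2) by (auto simp: inj_def)
  qed
  ultimately show ?thesis by (rule that)
qed

text \<open>A regular element of \<open>U_torus\<close> forces whatever commutes with it to be
  diagonal. This recovers the complex torus from the compact one, so that what normalizes the latter
  also normalizes the former.\<close>

lemma centralizer_U_torus: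
  "{x \<in> Sp_complex. \<forall>t\<in>U_torus. x ** t = t ** x} = (C_torus :: ('n::finite + 'n) cmat set)"
proof (intro equalityI subsetI)
  fix x :: "('n + 'n) cmat" assume x: "x \<in> {x \<in> Sp_complex. \<forall>t\<in>U_torus. x ** t = t ** x}"
  obtain u :: "'n + 'n \<Rightarrow> complex" where u: "diag u \<in> U_torus" "inj u" by (rule regular_U_torus)
  with x have "x ** diag u = diag u ** x" by blast
  from commute_regular_diag[OF this u(2)] x show "x \<in> C_torus" using C_torus_iff by blast
next
  fix x :: "('n + 'n) cmat" assume "x \<in> C_torus"
  then show "x \<in> {x \<in> Sp_complex. \<forall>t\<in>U_torus. x ** t = t ** x}"
    using C_torus_subset by (auto simp: C_torus_def U_torus_def diag_commute)
qed

text \<open>The conjugate transpose stands for the inverse, as all conjugating matrices are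
  unitary.\<close>

definition conjugate :: "('m::finite) cmat \<Rightarrow> 'm cmat \<Rightarrow> 'm cmat" where
  "conjugate g x = g ** x ** conj_transpose g"

lemma conjugate_mult:
  assumes "g \<in> unitary_group"
  shows "conjugate g (x ** y) = conjugate g x ** conjugate g y"
proof -
  have "conj_transpose g ** g = mat 1" using assms by (simp add: unitary_group_def)
  then have "g ** x ** (conj_transpose g ** g) ** y ** conj_transpose g = g ** x ** y ** conj_transpose g"
    by simp
  then show ?thesis unfolding conjugate_def by (simp only: matrix_mul_assoc)
qed

lemma conjugate_conjugate: "conjugate g (conjugate h x) = conjugate (g ** h) x"
  unfolding conjugate_def conj_transpose_mul by (simp only: matrix_mul_assoc)

lemma conjugate_one [simp]: "conjugate (mat 1) x = x"
  by (simp add: conjugate_def)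

lemma conjugate_cancel:
  assumes "g \<in> unitary_group"
  shows "conjugate g (conjugate (conj_transpose g) x) = x" "conjugate (conj_transpose g) (conjugate g x) = x"
  using assms by (simp_all add: conjugate_conjugate unitary_group_commute) (simp add: unitary_group_def)

lemma inj_conjugate: "g \<in> unitary_group \<Longrightarrow> inj (conjugate g)"
  by (metis conjugate_cancel(2) injI)

lemma conjugate_mat [simp]: "g \<in> unitary_group \<Longrightarrow> conjugate g (mat c) = mat c"
proof -
  assume g: "g \<in> unitary_group"
  have "conjugate g (mat c) = mat c ** (g ** conj_transpose g)"
    unfolding conjugate_def by (simp only: mat_commute[symmetric] matrix_mul_assoc)
  then show ?thesis by (simp add: unitary_group_commute[OF g])
qed

lemma conj_transpose_conjugate: "conj_transpose (conjugate g x) = conjugate g (conj_transpose x)"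
  by (simp add: conjugate_def conj_transpose_mul matrix_mul_assoc)

lemma conjugate_add: "conjugate g (x + y) = conjugate g x + conjugate g y"
  by (simp add: conjugate_def matrix_mult.add_left matrix_mult.add_right)

lemma conjugate_minus: "conjugate g (- x) = - conjugate g x"
  by (simp add: conjugate_def matrix_mult.minus_left matrix_mult.minus_right)

lemma Sp_compact_unitary: "g \<in> Sp_compact \<Longrightarrow> g \<in> unitary_group"
  by (simp add: Sp_compact_def)

lemma Sp_compact_conjugate_Sp_complex: "g \<in> Sp_compact \<Longrightarrow> x \<in> Sp_complex \<Longrightarrow> conjugate g x \<in> Sp_complex"
  by (simp add: conjugate_def Sp_complex_mult Sp_compact_def conj_transpose_in_Sp_complex)

lemma Sp_compact_conjugate: "g \<in> Sp_compact \<Longrightarrow> x \<in> Sp_compact \<Longrightarrow> conjugate g x \<in> Sp_compact"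
  by (simp add: conjugate_def Sp_compact_mult Sp_compact_inverse)

lemma conjugate_commute_iff:
  assumes "g \<in> unitary_group"
  shows "conjugate g x ** conjugate g y = conjugate g y ** conjugate g x \<longleftrightarrow> x ** y = y ** x"
  using inj_conjugate[OF assms] by (simp add: conjugate_mult[OF assms, symmetric] inj_eq)

lemma quaternionic_mult:
  assumes "quaternionic A" "quaternionic B"
  shows "quaternionic (A ** B)"
proof -
  have "(A ** B) $ opp a $ opp b = opp_sgn a * opp_sgn b * cnj ((A ** B) $ a $ b)" for a b
  proof -
    have "(A ** B) $ opp a $ opp b = (\<Sum>c\<in>UNIV. A $ opp a $ opp c * B $ opp c $ opp b)"
      using sum_opp[of "\<lambda>c. A $ opp a $ c * B $ c $ opp b"] by (simp add: matrix_matrix_mult_def)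
    also have "\<dots> = (\<Sum>c\<in>UNIV. opp_sgn a * opp_sgn b * (cnj (A $ a $ c) * cnj (B $ c $ b)))"
    proof (rule sum.cong)
      fix c
      have "A $ opp a $ opp c * B $ opp c $ opp b
          = (opp_sgn c * opp_sgn c) * (opp_sgn a * opp_sgn b * (cnj (A $ a $ c) * cnj (B $ c $ b)))"
        using assms by (simp add: quaternionic_def del: opp_sgn_square)
      then show "A $ opp a $ opp c * B $ opp c $ opp b
          = opp_sgn a * opp_sgn b * (cnj (A $ a $ c) * cnj (B $ c $ b))" by simp
    qed simp
    finally show ?thesis by (simp add: matrix_matrix_mult_def sum_distrib_left)
  qed
  then show ?thesis by (simp add: quaternionic_def)
qed

lemma quaternionic_conjugate: "g \<in> Sp_compact \<Longrightarrow> quaternionic x \<Longrightarrow> quaternionic (conjugate g x)"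
  by (simp add: conjugate_def quaternionic_mult Sp_compact_quaternionic Sp_compact_inverse)

lemma all_opp: "(\<forall>b. P b) \<longleftrightarrow> (\<forall>b. P (opp b))"
  by (metis opp_opp)

text \<open>The transpose of a skew-Hermitian matrix is the negative of its complex conjugate, so
  the linearized symplectic relation turns into the intertwining relation with J.\<close>

lemma skew_sympl_iff_quaternionic:
  assumes "conj_transpose X = - X"
  shows "transpose X ** sympl_J + sympl_J ** X = 0 \<longleftrightarrow> quaternionic X"
proof -
  have skew: "X $ b $ a = - cnj (X $ a $ b)" for a b
  proof -
    have "conj_transpose X $ b $ a = (- X) $ b $ a" using assms by simp
    then have "cnj (X $ a $ b) = - X $ b $ a" by (simp add: conj_transpose_def)
    then show ?thesis by simp
  qed
  have "(transpose X ** sympl_J + sympl_J ** X) $ a $ opp b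
      = opp_sgn a * X $ opp a $ opp b - opp_sgn b * cnj (X $ a $ b)" for a b
    using skew[of b a] by (simp add: sympl_J_mult_nth mult_sympl_J_nth transpose_def)
  then have "transpose X ** sympl_J + sympl_J ** X = 0 \<longleftrightarrow>
      (\<forall>a b. opp_sgn a * X $ opp a $ opp b = opp_sgn b * cnj (X $ a $ b))"
    unfolding vec_eq_iff zero_index by (subst (2) all_opp) (simp only: right_minus_eq)
  also have "\<dots> \<longleftrightarrow> quaternionic X"
  proof -
    have "opp_sgn a * x = opp_sgn b * y \<longleftrightarrow> x = opp_sgn a * opp_sgn b * y" for a b :: "'a + 'a" and x y
      by (cases a; cases b) (auto simp: equation_minus_iff)
    then show ?thesis unfolding quaternionic_def by blast
  qed
  finally show ?thesis .
qed

section \<open>Groups cut out by the form \<sigma>, their Lie algebras and compact parts\<close>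

definition real_form :: "('n::finite + 'n) cmat \<Rightarrow> ('n + 'n) cmat set" where
  "real_form \<sigma> = {g \<in> Sp_complex. conj_transpose g ** \<sigma> ** g = \<sigma>}"

definition max_compact :: "('n::finite + 'n) cmat \<Rightarrow> ('n + 'n) cmat set" where
  "max_compact \<sigma> = {g \<in> Sp_compact. g ** \<sigma> = \<sigma> ** g}"

lemma lie_algebra_Sp_complex: "lie_algebra Sp_complex = {X. transpose X ** sympl_J + sympl_J ** X = 0}"
  unfolding Sp_complex_def
  by (rule lie_algebra_form) (simp_all add: bounded_linear_transpose matrix_transpose_mul)

lemma lie_algebra_real_form:
  "lie_algebra (real_form \<sigma>) =
    {X. transpose X ** sympl_J + sympl_J ** X = 0 \<and> conj_transpose X ** \<sigma> + \<sigma> ** X = 0}"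
proof -
  have "real_form \<sigma> = Sp_complex \<inter> {g. conj_transpose g ** \<sigma> ** g = \<sigma>}" by (auto simp: real_form_def)
  moreover have "lie_algebra {g. conj_transpose g ** \<sigma> ** g = \<sigma>} = {X. conj_transpose X ** \<sigma> + \<sigma> ** X = 0}"
    by (rule lie_algebra_form) (simp_all add: bounded_linear_conj_transpose conj_transpose_mul)
  ultimately show ?thesis by (auto simp: lie_algebra_Int lie_algebra_Sp_complex)
qed

lemma lie_algebra_max_compact:
  fixes \<sigma> :: "('n::finite + 'n) cmat"
  shows "lie_algebra (max_compact \<sigma>) = {X. conj_transpose X = - X \<and> quaternionic X \<and> X ** \<sigma> = \<sigma> ** X}"
proof -
  have "max_compact \<sigma> = Sp_complex \<inter> {g. conj_transpose g ** mat 1 ** g = mat 1} \<inter> {g. \<forall>Y\<in>{\<sigma>}. g ** Y = Y ** g}"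
    by (auto simp: max_compact_def Sp_compact_def unitary_group_def)
  moreover have "lie_algebra {g :: ('n + 'n) cmat. conj_transpose g ** mat 1 ** g = mat 1}
      = {X. conj_transpose X ** mat 1 + mat 1 ** X = 0}"
    by (rule lie_algebra_form) (simp_all add: bounded_linear_conj_transpose conj_transpose_mul)
  moreover have "lie_algebra {g. \<forall>Y\<in>{\<sigma>}. g ** Y = Y ** g} = {X. \<forall>Y\<in>{\<sigma>}. X ** Y = Y ** X}"
    by (rule lie_algebra_centralizer)
  ultimately have "lie_algebra (max_compact \<sigma>) = {X. transpose X ** sympl_J + sympl_J ** X = 0 \<and>
      conj_transpose X = - X \<and> X ** \<sigma> = \<sigma> ** X}"
    by (auto simp: lie_algebra_Int lie_algebra_Sp_complex eq_neg_iff_add_eq_0)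
  then show ?thesis using skew_sympl_iff_quaternionic by blast
qed

lemma lie_algebra_mono: "A \<subseteq> B \<Longrightarrow> lie_algebra A \<subseteq> lie_algebra B"
  by (auto simp: lie_algebra_def)

text \<open>Maximality of \<hh> makes it the full Lie algebra of its centralizer \<open>T\<close>.
  Then \<open>T \<subseteq> K\<close> puts \<hh> into the Lie algebra of \<open>K\<close>, which
  later makes its elements skew-Hermitian.\<close>

lemma cartan_in_maximal_compact:
  assumes "compact_cartan_subgroup G T" "T \<subseteq> K"
  obtains \<hh> where "lie_algebra T = \<hh>" "\<hh> \<subseteq> lie_algebra G" "\<hh> \<subseteq> lie_algebra K"
    "\<And>X Y. X \<in> \<hh> \<Longrightarrow> Y \<in> \<hh> \<Longrightarrow> X ** Y = Y ** X"
    "\<And>Y. Y \<in> lie_algebra G \<Longrightarrow> (\<And>X. X \<in> \<hh> \<Longrightarrow> X ** Y = Y ** X) \<Longrightarrow> Y \<in> \<hh>"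
    "T = {g \<in> G. \<forall>X\<in>\<hh>. g ** X = X ** g}"
proof -
  from assms(1) obtain \<hh> where \<hh>: "cartan_subalgebra (lie_algebra G) \<hh>"
    and T: "T = {g \<in> G. \<forall>X\<in>\<hh>. g ** X = X ** g}"
    by (auto simp: compact_cartan_subgroup_def)
  from \<hh> have sub: "\<hh> \<subseteq> lie_algebra G" and ab: "\<And>X Y. X \<in> \<hh> \<Longrightarrow> Y \<in> \<hh> \<Longrightarrow> X ** Y = Y ** X"
    and max: "\<And>Y. Y \<in> lie_algebra G \<Longrightarrow> (\<And>X. X \<in> \<hh> \<Longrightarrow> X ** Y = Y ** X) \<Longrightarrow> Y \<in> \<hh>"
    by (auto simp: cartan_subalgebra_def lie_bracket_def)
  have "T = G \<inter> {g. \<forall>X\<in>\<hh>. g ** X = X ** g}" using T by blast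
  then have lie: "lie_algebra T = lie_algebra G \<inter> {X. \<forall>Y\<in>\<hh>. X ** Y = Y ** X}"
    by (simp add: lie_algebra_Int lie_algebra_centralizer)
  have lie': "lie_algebra T = \<hh>"
  proof (intro equalityI subsetI)
    fix X assume "X \<in> lie_algebra T"
    with lie show "X \<in> \<hh>" by (intro max) auto
  next
    fix X assume "X \<in> \<hh>"
    with lie sub ab show "X \<in> lie_algebra T" by blast
  qed
  have "\<hh> \<subseteq> lie_algebra K" using lie_algebra_mono[OF assms(2)] lie' by simp
  from that[OF lie' sub this ab max T] show ?thesis by blast
qed

lemma real_form_commuting_skew:
  assumes "conj_transpose X = - X" "quaternionic X" "X ** \<sigma> = \<sigma> ** X"
  shows "X \<in> lie_algebra (real_form \<sigma>)"
  using assms skew_sympl_iff_quaternionic[of X]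
  by (simp add: lie_algebra_real_form matrix_minus_left)

lemma max_compact_subset_real_form: "max_compact \<sigma> \<subseteq> real_form \<sigma>"
proof
  fix k assume k: "k \<in> max_compact \<sigma>"
  then have "conj_transpose k ** (\<sigma> ** k) = conj_transpose k ** k ** \<sigma>"
    by (simp add: max_compact_def matrix_mul_assoc[symmetric])
  with k show "k \<in> real_form \<sigma>"
    by (simp add: max_compact_def real_form_def Sp_compact_def unitary_group_def matrix_mul_assoc)
qed

lemma conjugate_image_max_compact:
  assumes "g \<in> Sp_compact"
  shows "conjugate g ` max_compact \<sigma> = max_compact (conjugate g \<sigma>)"
proof (intro equalityI subsetI)
  have u: "g \<in> unitary_group" and g': "conj_transpose g \<in> Sp_compact"
    using assms by (simp_all add: Sp_compact_unitary Sp_compact_inverse)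
  {
    fix x assume "x \<in> conjugate g ` max_compact \<sigma>"
    then show "x \<in> max_compact (conjugate g \<sigma>)"
      using assms u by (auto simp: max_compact_def Sp_compact_conjugate conjugate_commute_iff)
  next
    fix x assume x: "x \<in> max_compact (conjugate g \<sigma>)"
    define y where "y = conjugate (conj_transpose g) x"
    have xy: "x = conjugate g y" using u by (simp add: y_def conjugate_cancel)
    moreover have "y \<in> max_compact \<sigma>"
    proof -
      have "y \<in> Sp_compact" using x g' by (simp add: y_def max_compact_def Sp_compact_conjugate)
      moreover have "conjugate g y ** conjugate g \<sigma> = conjugate g \<sigma> ** conjugate g y"
        using x by (simp add: max_compact_def xy[symmetric])
      ultimately show ?thesis using u by (simp add: max_compact_def conjugate_commute_iff)
    qed
    ultimately show "x \<in> conjugate g ` max_compact \<sigma>" by blast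
  }
qed

lemma U_torus_subset_max_compact: "U_torus \<subseteq> max_compact (diag s)"
  using C_torus_subset
  by (auto simp: U_torus_def C_torus_def max_compact_def Sp_compact_def diag_commute)

lemma complexify_conjugate:
  "complexify (conjugate g ` \<hh>) = conjugate g ` complexify \<hh>"
proof -
  have "mat \<i> ** conjugate g Y = conjugate g (mat \<i> ** Y)" for Y
    unfolding conjugate_def by (metis mat_commute matrix_mul_assoc)
  then have "conjugate g (X + mat \<i> ** Y) = conjugate g X + mat \<i> ** conjugate g Y" for X Y
    by (simp add: conjugate_add)
  moreover have "complexify \<kk> = (\<lambda>(X, Y). X + mat \<i> ** Y) ` (\<kk> \<times> \<kk>)" for \<kk> :: "'a cmat set"
    by (auto simp: complexify_def)
  ultimately show ?thesis
    by (simp add: image_image split_beta) (auto simp: image_iff; blast)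
qed

lemma exp_complexify_U_torus_algebra:
  "mat_exp ` complexify U_torus_algebra = (C_torus :: ('n::finite + 'n) cmat set)"
proof (intro equalityI subsetI)
  fix z :: "('n + 'n) cmat" assume "z \<in> mat_exp ` complexify U_torus_algebra"
  then obtain d e where de: "\<And>a. d (opp a) = - d a" "\<And>a. e (opp a) = - e a"
    and z: "z = mat_exp (diag d + mat \<i> ** diag e)"
    by (auto simp: complexify_def U_torus_algebra_def)
  have "diag d + mat \<i> ** diag e = diag (\<lambda>a. d a + \<i> * e a)"
    by (simp add: vec_eq_iff mat_mult_nth diag_nth)
  then have "z = diag (\<lambda>a. exp (d a + \<i> * e a))" by (simp add: z mat_exp_diag)
  moreover have "exp (d a + \<i> * e a) * exp (d (opp a) + \<i> * e (opp a)) = 1" for a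
    by (simp add: de exp_add[symmetric])
  ultimately show "z \<in> C_torus" by (auto simp: C_torus_def)
next
  fix z :: "('n + 'n) cmat" assume "z \<in> C_torus"
  then obtain w where w: "\<And>a. w a * w (opp a) = 1" and z: "z = diag w" by (auto simp: C_torus_def)
  have nz: "w a \<noteq> 0" for a using w[of a] by auto
  \<comment> \<open>Logarithms are taken on the first half and negated on the second, which keeps
    \<open>l (opp a) = - l a\<close> exact even on the branch cut of \<open>Ln\<close>.\<close>
  define l where "l a = (case a of Inl i \<Rightarrow> Ln (w a) | Inr i \<Rightarrow> - Ln (w (opp a)))" for a
  have expl: "exp (l a) = w a" for a
  proof (cases a)
    case (Inr i)
    then have "exp (l a) = inverse (w (opp a))" using nz by (simp add: l_def exp_minus)
    also have "\<dots> = w a" using w[of "opp a"] by (simp add: inverse_unique)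
    finally show ?thesis .
  qed (simp add: l_def nz)
  have opp: "l (opp a) = - l a" for a by (cases a) (simp_all add: l_def)
  \<comment> \<open>Both parts of the decomposition \<open>x + mat \<i> ** y\<close> must be purely
    imaginary, so the real part of \<open>l\<close> enters \<open>y\<close> with the factor
    \<open>- \<i>\<close>.\<close>
  define x y where "x = diag (\<lambda>a. \<i> * of_real (Im (l a)))" and "y = diag (\<lambda>a. - \<i> * of_real (Re (l a)))"
  have "x \<in> U_torus_algebra" "y \<in> U_torus_algebra"
    unfolding x_def y_def U_torus_algebra_def by (auto simp: opp)
  then have "x + mat \<i> ** y \<in> complexify U_torus_algebra"
    unfolding complexify_def by blast
  moreover have "x + mat \<i> ** y = diag l"
    by (simp add: x_def y_def vec_eq_iff mat_mult_nth diag_nth complex_eq_iff)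
  moreover have "z = mat_exp (diag l)" by (simp add: mat_exp_diag expl z)
  ultimately show "z \<in> mat_exp ` complexify U_torus_algebra" by (metis imageI)
qed

text \<open>Diagonalizing \<sigma> together with \<hh> puts \<hh> inside the conjugated diagonal
  algebra. Equality follows from maximality: diagonal matrices commute, so the whole conjugated
  algebra centralizes \<sigma> and \<hh>, hence lies in the Lie algebra of the real form and then in
  \<hh>.\<close>

theorem compact_cartan_subgroup_conjugate:
  fixes \<sigma> :: "('n::finite + 'n) cmat"
  assumes T: "compact_cartan_subgroup (real_form \<sigma>) T" "T \<subseteq> max_compact \<sigma>"
    and \<sigma>: "quaternionic \<sigma>" "conj_transpose \<sigma> = \<sigma> \<or> conj_transpose \<sigma> = - \<sigma>"
  obtains g s where "g \<in> Sp_compact" "\<sigma> = conjugate g (diag s)"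
    "T = conjugate g ` U_torus" "complex_torus T = conjugate g ` C_torus"
proof (rule cartan_in_maximal_compact[OF T])
  fix \<hh>
  assume lieT: "lie_algebra T = \<hh>" and "\<hh> \<subseteq> lie_algebra (real_form \<sigma>)" and sub: "\<hh> \<subseteq> lie_algebra (max_compact \<sigma>)"
    and ab: "\<And>X Y. X \<in> \<hh> \<Longrightarrow> Y \<in> \<hh> \<Longrightarrow> X ** Y = Y ** X"
    and max: "\<And>Y. Y \<in> lie_algebra (real_form \<sigma>) \<Longrightarrow> (\<And>X. X \<in> \<hh> \<Longrightarrow> X ** Y = Y ** X) \<Longrightarrow> Y \<in> \<hh>"
    and Teq: "T = {g \<in> real_form \<sigma>. \<forall>X\<in>\<hh>. g ** X = X ** g}"
  have \<hh>: "conj_transpose X = - X" "quaternionic X" "X ** \<sigma> = \<sigma> ** X" if "X \<in> \<hh>" for X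
    using that sub unfolding lie_algebra_max_compact by blast+
  have hherm: "conj_transpose Y = Y \<or> conj_transpose Y = - Y" if "Y \<in> insert \<sigma> \<hh>" for Y
    using that \<sigma>(2) \<hh>(1) by blast
  have hcomm: "Y ** Z = Z ** Y" if "Y \<in> insert \<sigma> \<hh>" "Z \<in> insert \<sigma> \<hh>" for Y Z
    using that ab \<hh>(3) by (elim insertE) simp_all
  have hquat: "quaternionic Y" if "Y \<in> insert \<sigma> \<hh>" for Y
    using that \<sigma>(1) \<hh>(2) by blast
  have "\<exists>g\<in>Sp_compact. \<forall>Y\<in>insert \<sigma> \<hh>. \<exists>d. conj_transpose g ** Y ** g = diag d"
    by (rule quaternionic_diagonalization[OF hherm hcomm hquat])
  then obtain g where g: "g \<in> Sp_compact"
    and dg: "\<And>Y. Y \<in> insert \<sigma> \<hh> \<Longrightarrow> \<exists>d. conj_transpose g ** Y ** g = diag d" by blast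
  have u: "g \<in> unitary_group" and g': "conj_transpose g \<in> Sp_compact"
    using g by (simp_all add: Sp_compact_unitary Sp_compact_inverse)
  have dg': "\<exists>d. Y = conjugate g (diag d)" if Y: "Y \<in> insert \<sigma> \<hh>" for Y
  proof -
    from dg[OF Y] obtain d where "conjugate (conj_transpose g) Y = diag d" by (auto simp: conjugate_def)
    then have "Y = conjugate g (diag d)" using conjugate_cancel(1)[OF u, of Y] by simp
    then show ?thesis by (rule exI[of _ d])
  qed
  from dg'[of \<sigma>] obtain s where s: "\<sigma> = conjugate g (diag s)" by auto
  have \<hh>_eq: "\<hh> = conjugate g ` U_torus_algebra"
  proof (intro equalityI subsetI)
    fix X assume X: "X \<in> \<hh>"
    from dg'[of X] X obtain d where d: "X = conjugate g (diag d)" by auto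
    then have d': "diag d = conjugate (conj_transpose g) X" using u by (simp add: conjugate_cancel)
    have "quaternionic (diag d)" unfolding d' using g' \<hh>(2)[OF X] by (rule quaternionic_conjugate)
    moreover have "conj_transpose (diag d) = - diag d"
      unfolding d' using \<hh>(1)[OF X] by (simp add: conj_transpose_conjugate conjugate_minus)
    then have "conj_transpose (diag d) $ a $ a = (- diag d) $ a $ a" for a by simp
    then have "cnj (d a) = - d a" for a
      by (simp add: conj_transpose_diag diag_nth)
    ultimately have "diag d \<in> U_torus_algebra"
      by (auto simp: U_torus_algebra_def quaternionic_diag)
    then show "X \<in> conjugate g ` U_torus_algebra" using d by blast
  next
    fix X assume "X \<in> conjugate g ` U_torus_algebra"
    then obtain d where X: "X = conjugate g (diag d)" and d: "\<And>a. d (opp a) = - d a" "\<And>a. cnj (d a) = - d a"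
      by (auto simp: U_torus_algebra_def)
    have "conj_transpose (diag d) = - diag d"
      by (simp add: conj_transpose_diag d) (simp add: vec_eq_iff diag_nth)
    then have "conj_transpose X = - X" by (simp add: X conj_transpose_conjugate conjugate_minus)
    moreover have "quaternionic X"
      unfolding X by (rule quaternionic_conjugate[OF g]) (simp add: quaternionic_diag d)
    moreover have comm: "Y ** X = X ** Y" if "Y \<in> insert \<sigma> \<hh>" for Y
      using dg'[OF that] u by (auto simp: X conjugate_commute_iff diag_commute)
    ultimately have "X \<in> lie_algebra (real_form \<sigma>)" by (intro real_form_commuting_skew) auto
    then show "X \<in> \<hh>" using max comm by blast
  qed
  have "T = conjugate g ` U_torus"
  proof (intro equalityI subsetI)
    fix x assume x: "x \<in> T"
    define y where "y = conjugate (conj_transpose g) x"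
    have xy: "x = conjugate g y" using u by (simp add: y_def conjugate_cancel)
    \<comment> \<open>Commuting with one regular element of \<hh> already makes an element of
      \<open>T\<close> diagonal in the new coordinates.\<close>
    obtain r :: "'n + 'n \<Rightarrow> complex" where r: "diag r \<in> U_torus_algebra" "inj r" by (rule regular_U_torus_algebra)
    then have "conjugate g (diag r) \<in> \<hh>" by (simp add: \<hh>_eq)
    with x have "x ** conjugate g (diag r) = conjugate g (diag r) ** x" by (simp add: Teq)
    then have "y ** diag r = diag r ** y" using u by (simp add: xy conjugate_commute_iff)
    then obtain d where "y = diag d" using r(2) commute_regular_diag by blast
    moreover have "y \<in> Sp_compact"
      using x T(2) g' by (auto simp: y_def max_compact_def intro: Sp_compact_conjugate)
    ultimately have "y \<in> U_torus" by (simp add: U_torus_def Sp_compact_def C_torus_iff)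
    then show "x \<in> conjugate g ` U_torus" using xy by blast
  next
    fix x assume "x \<in> conjugate g ` U_torus"
    then obtain y where y: "y \<in> U_torus" "x = conjugate g y" by blast
    then have "x \<in> max_compact \<sigma>"
      using U_torus_subset_max_compact[of s] conjugate_image_max_compact[OF g, of "diag s"] s by blast
    moreover have "\<forall>X\<in>\<hh>. x ** X = X ** x"
      using y u by (auto simp: \<hh>_eq U_torus_def C_torus_def U_torus_algebra_def conjugate_commute_iff diag_commute)
    ultimately show "x \<in> T" using max_compact_subset_real_form by (auto simp: Teq)
  qed
  moreover have "complex_torus T = conjugate g ` C_torus"
  proof -
    have "mat_exp (conjugate g X) = conjugate g (mat_exp X)" for X
      unfolding conjugate_def by (rule mat_exp_conjugate) (use g in \<open>auto simp: Sp_compact_inverse\<close>)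
    then have "complex_torus T = conjugate g ` mat_exp ` complexify U_torus_algebra"
      by (simp add: complex_torus_def lieT \<hh>_eq complexify_conjugate image_image)
    then show ?thesis by (simp add: exp_complexify_U_torus_algebra)
  qed
  ultimately show ?thesis using that g s by blast
qed

subsection \<open>Weyl groups and orbits\<close>

definition matrix_group :: "('m::finite) cmat set \<Rightarrow> bool" where
  "matrix_group A \<longleftrightarrow> mat 1 \<in> A \<and> (\<forall>x\<in>A. \<forall>y\<in>A. x ** y \<in> A) \<and>
    (\<forall>x\<in>A. \<exists>y\<in>A. x ** y = mat 1 \<and> y ** x = mat 1)"

text \<open>Equality of the left and right translates of \<open>H\<close> expresses normalization
  without an inverse of \<open>g\<close>.\<close>

definition mat_normalizer :: "('m::finite) cmat set \<Rightarrow> 'm cmat set \<Rightarrow> 'm cmat set" where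
  "mat_normalizer A H = {g \<in> A. (\<lambda>h. g ** h) ` H = (\<lambda>h. h ** g) ` H}"

lemma matrix_group_one: "matrix_group A \<Longrightarrow> mat 1 \<in> A"
  and matrix_group_mult: "matrix_group A \<Longrightarrow> x \<in> A \<Longrightarrow> y \<in> A \<Longrightarrow> x ** y \<in> A"
  by (simp_all add: matrix_group_def)

lemma matrix_group_inverse:
  assumes "matrix_group A" "x \<in> A"
  obtains y where "y \<in> A" "x ** y = mat 1" "y ** x = mat 1"
  using assms unfolding matrix_group_def by blast

lemma mat_normalizerI:
  assumes "g \<in> A" "\<And>h. h \<in> H \<Longrightarrow> \<exists>h'\<in>H. g ** h = h' ** g" "\<And>h. h \<in> H \<Longrightarrow> \<exists>h'\<in>H. h ** g = g ** h'"
  shows "g \<in> mat_normalizer A H"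
proof -
  have "(\<lambda>h. g ** h) ` H = (\<lambda>h. h ** g) ` H"
  proof (intro equalityI image_subsetI)
    fix h assume "h \<in> H"
    show "g ** h \<in> (\<lambda>h. h ** g) ` H" using assms(2)[OF \<open>h \<in> H\<close>] by (elim bexE) (rule image_eqI)
    show "h ** g \<in> (\<lambda>h. g ** h) ` H" using assms(3)[OF \<open>h \<in> H\<close>] by (elim bexE) (rule image_eqI)
  qed
  with assms(1) show ?thesis by (simp add: mat_normalizer_def)
qed

lemma mat_normalizer_left:
  assumes "g \<in> mat_normalizer A H" "h \<in> H"
  shows "\<exists>h'\<in>H. g ** h = h' ** g"
proof -
  have "g ** h \<in> (\<lambda>h. g ** h) ` H" using assms(2) by (rule imageI)
  then have "g ** h \<in> (\<lambda>h. h ** g) ` H" using assms(1) by (simp only: mat_normalizer_def mem_Collect_eq)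
  then show ?thesis by (simp only: image_iff)
qed

lemma mat_normalizer_right:
  assumes "g \<in> mat_normalizer A H" "h \<in> H"
  shows "\<exists>h'\<in>H. h ** g = g ** h'"
proof -
  have "h ** g \<in> (\<lambda>h. h ** g) ` H" using assms(2) by (rule imageI)
  then have "h ** g \<in> (\<lambda>h. g ** h) ` H" using assms(1) by (simp only: mat_normalizer_def mem_Collect_eq)
  then show ?thesis by (simp only: image_iff)
qed

lemma mat_normalizer_subset: "mat_normalizer A H \<subseteq> A"
  by (auto simp: mat_normalizer_def)

lemma matrix_group_imp_group:
  assumes "matrix_group A"
  shows "group (mat_group A)"
proof (rule groupI)
  fix x assume "x \<in> carrier (mat_group A)"
  then have "x \<in> A" by (simp add: mat_group_def)
  from assms this obtain y where "y \<in> A" "x ** y = mat 1" "y ** x = mat 1" by (rule matrix_group_inverse)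
  then show "\<exists>y\<in>carrier (mat_group A). y \<otimes>\<^bsub>mat_group A\<^esub> x = \<one>\<^bsub>mat_group A\<^esub>"
    by (intro bexI[of _ y]) (simp_all add: mat_group_def)
qed (simp_all add: mat_group_def matrix_group_one[OF assms] matrix_group_mult[OF assms] matrix_mul_assoc)

text \<open>The library normalizer is the stabilizer of \<open>H\<close> under conjugation of
  subsets; translating by \<open>g\<close> on the right removes the inverse from that
  condition.\<close>

lemma normalizer_mat_group:
  assumes A: "matrix_group A" and "H \<subseteq> A"
  shows "normalizer (mat_group A) H = mat_normalizer A H"
proof -
  interpret group "mat_group A" using A by (rule matrix_group_imp_group)
  have iff: "(g <#\<^bsub>mat_group A\<^esub> H #>\<^bsub>mat_group A\<^esub> (inv\<^bsub>mat_group A\<^esub> g) = H) \<longleftrightarrow>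
      (\<lambda>h. g ** h) ` H = (\<lambda>h. h ** g) ` H" if g: "g \<in> A" for g
  proof -
    obtain k where k: "k \<in> A" "g ** k = mat 1" "k ** g = mat 1" using A g by (rule matrix_group_inverse)
    then have inv: "inv\<^bsub>mat_group A\<^esub> g = k" using g by (intro inv_equality) (auto simp: mat_group_def)
    have eq: "g <#\<^bsub>mat_group A\<^esub> H #>\<^bsub>mat_group A\<^esub> (inv\<^bsub>mat_group A\<^esub> g) = (\<lambda>x. x ** k) ` (\<lambda>h. g ** h) ` H"
      unfolding inv l_coset_def r_coset_def by (auto simp: mat_group_def)
    have 1: "(\<lambda>x. x ** g) ` (\<lambda>x. x ** k) ` X = X" "(\<lambda>x. x ** k) ` (\<lambda>x. x ** g) ` X = X" for X
      using k by (simp_all add: image_image matrix_mul_assoc[symmetric])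
    show ?thesis
    proof
      assume "g <#\<^bsub>mat_group A\<^esub> H #>\<^bsub>mat_group A\<^esub> (inv\<^bsub>mat_group A\<^esub> g) = H"
      then have "(\<lambda>x. x ** g) ` (\<lambda>x. x ** k) ` (\<lambda>h. g ** h) ` H = (\<lambda>h. h ** g) ` H"
        by (simp only: eq)
      then show "(\<lambda>h. g ** h) ` H = (\<lambda>h. h ** g) ` H" by (simp only: 1)
    next
      assume "(\<lambda>h. g ** h) ` H = (\<lambda>h. h ** g) ` H"
      then show "g <#\<^bsub>mat_group A\<^esub> H #>\<^bsub>mat_group A\<^esub> (inv\<^bsub>mat_group A\<^esub> g) = H"
        by (simp only: eq 1)
    qed
  qed
  have "H \<in> {H. H \<subseteq> carrier (mat_group A)}" using assms(2) by (simp add: mat_group_def)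
  then have "normalizer (mat_group A) H =
      {g \<in> carrier (mat_group A). g <#\<^bsub>mat_group A\<^esub> H #>\<^bsub>mat_group A\<^esub> (inv\<^bsub>mat_group A\<^esub> g) = H}"
    unfolding normalizer_def stabilizer_def by (simp only: restrict_apply' refl)
  also have "carrier (mat_group A) = A" by (simp add: mat_group_def)
  also have "{g \<in> A. g <#\<^bsub>mat_group A\<^esub> H #>\<^bsub>mat_group A\<^esub> (inv\<^bsub>mat_group A\<^esub> g) = H} = mat_normalizer A H"
    unfolding mat_normalizer_def using iff by blast
  finally show ?thesis .
qed

lemma carrier_weyl_group:
  assumes "matrix_group A" "H \<subseteq> A"
  shows "carrier (weyl_group A H) = (\<lambda>n. (\<lambda>h. h ** n) ` H) ` mat_normalizer A H"
proof -
  have "H #>\<^bsub>mat_group (mat_normalizer A H)\<^esub> n = (\<lambda>h. h ** n) ` H" for n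
    unfolding r_coset_def mat_group_def by (simp add: UNION_singleton_eq_range)
  then show ?thesis
    unfolding weyl_group_def normalizer_mat_group[OF assms] carrier_FactGroup
    by (simp add: mat_group_def)
qed

lemma mat_normalizer_mult:
  assumes "matrix_group A" "g \<in> mat_normalizer A H" "k \<in> mat_normalizer A H"
  shows "g ** k \<in> mat_normalizer A H"
proof (rule mat_normalizerI)
  show "g ** k \<in> A" using assms mat_normalizer_subset matrix_group_mult by blast
  fix h assume "h \<in> H"
  obtain h1 where h1: "h1 \<in> H" "k ** h = h1 ** k" using mat_normalizer_left[OF assms(3) \<open>h \<in> H\<close>] by blast
  obtain h2 where h2: "h2 \<in> H" "g ** h1 = h2 ** g" using mat_normalizer_left[OF assms(2) h1(1)] by blast
  have "g ** k ** h = g ** h1 ** k" by (simp only: matrix_mul_assoc[symmetric] h1(2))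
  also have "\<dots> = h2 ** (g ** k)" by (simp only: h2(2) matrix_mul_assoc)
  finally show "\<exists>h'\<in>H. g ** k ** h = h' ** (g ** k)" using h2(1) by blast
  obtain h3 where h3: "h3 \<in> H" "h ** g = g ** h3" using mat_normalizer_right[OF assms(2) \<open>h \<in> H\<close>] by blast
  obtain h4 where h4: "h4 \<in> H" "h3 ** k = k ** h4" using mat_normalizer_right[OF assms(3) h3(1)] by blast
  have "h ** (g ** k) = g ** (h3 ** k)" by (simp only: matrix_mul_assoc h3(2))
  also have "\<dots> = g ** k ** h4" by (simp only: h4(2) matrix_mul_assoc)
  finally show "\<exists>h'\<in>H. h ** (g ** k) = g ** k ** h'" using h4(1) by blast
qed

lemma mat_normalizer_inverse:
  assumes "matrix_group A" "g \<in> mat_normalizer A H" "g ** k = mat 1" "k ** g = mat 1"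
  shows "k \<in> mat_normalizer A H"
proof (rule mat_normalizerI)
  obtain k' where k': "k' \<in> A" "g ** k' = mat 1" "k' ** g = mat 1"
    using assms(1) subsetD[OF mat_normalizer_subset assms(2)] by (rule matrix_group_inverse)
  then show "k \<in> A" using matrix_left_inverse_unique[OF assms(4) k'(2)] by simp
  fix h assume "h \<in> H"
  obtain h' where h': "h' \<in> H" "h ** g = g ** h'" using mat_normalizer_right[OF assms(2) \<open>h \<in> H\<close>] by blast
  have "k ** h = k ** (h ** g) ** k" by (simp add: matrix_mul_assoc[symmetric] assms)
  also have "\<dots> = k ** g ** h' ** k" by (simp only: \<open>h ** g = g ** h'\<close> matrix_mul_assoc)
  finally have "k ** h = h' ** k" by (simp add: assms)
  then show "\<exists>h'\<in>H. k ** h = h' ** k" using \<open>h' \<in> H\<close> by blast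
  obtain h' where "h' \<in> H" "g ** h = h' ** g" using mat_normalizer_left[OF assms(2) \<open>h \<in> H\<close>] by blast
  have "h ** k = k ** (g ** h) ** k" by (simp add: matrix_mul_assoc assms)
  also have "\<dots> = k ** h' ** (g ** k)" by (simp only: \<open>g ** h = h' ** g\<close> matrix_mul_assoc)
  finally have "h ** k = k ** h'" by (simp add: assms)
  then show "\<exists>h'\<in>H. h ** k = k ** h'" using \<open>h' \<in> H\<close> by blast
qed

text \<open>Sending the value of \<open>F\<close> at a point to the value of \<open>f\<close> there
  is well defined and injective, because both maps have the same fibres on \<open>N\<close>.\<close>

lemma card_image_eq_card_image:
  assumes "\<And>x y. x \<in> N \<Longrightarrow> y \<in> N \<Longrightarrow> F x = F y \<longleftrightarrow> f x = f y"
  shows "card (F ` N) = card (f ` N)"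
proof -
  define g where "g Z = f (SOME x. x \<in> N \<and> F x = Z)" for Z
  have g: "g (F x) = f x" if "x \<in> N" for x
  proof -
    have "(SOME y. y \<in> N \<and> F y = F x) \<in> N \<and> F (SOME y. y \<in> N \<and> F y = F x) = F x"
      by (rule someI[of _ x]) (simp add: that)
    then show ?thesis unfolding g_def using assms that by blast
  qed
  have "inj_on g (F ` N)" by (auto intro!: inj_onI simp: g assms)
  then have "card (g ` F ` N) = card (F ` N)" by (rule card_image)
  moreover have "g ` F ` N = f ` N" by (auto simp: g image_iff)
  ultimately show ?thesis by simp
qed

lemma matrix_inv_eqI: "A ** B = mat 1 \<Longrightarrow> B ** A = mat 1 \<Longrightarrow> matrix_inv A = (B :: 'm::finite cmat)"
  unfolding matrix_inv_def by (rule some_equality) (auto intro: matrix_left_inverse_unique)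

text \<open>Orbit-stabilizer: the image of \<open>W\<^sub>K\<close> in \<open>W\<^sub>G\<close> is the stabilizer of \<open>\<sigma>\<close>, so its cosets correspond
  to the conjugates of \<open>\<sigma>\<close>.\<close>

lemma weyl_index_eq_card_orbit:
  fixes A K T :: "('m::finite) cmat set"
  defines "TC \<equiv> complex_torus T"
  assumes A: "matrix_group A" and K: "matrix_group K" and TC: "matrix_group TC" "TC \<subseteq> A"
    and T: "mat 1 \<in> T" "T \<subseteq> K" "T \<subseteq> TC"
    and NK: "\<And>k. k \<in> mat_normalizer K T \<Longrightarrow> k \<in> mat_normalizer A TC \<and> k ** \<sigma> = \<sigma> ** k"
    and TC_comm: "\<And>c. c \<in> TC \<Longrightarrow> c ** \<sigma> = \<sigma> ** c"
    and decomp: "\<And>m. m \<in> mat_normalizer A TC \<Longrightarrow> m ** \<sigma> = \<sigma> ** m \<Longrightarrow> \<exists>c\<in>TC. \<exists>k\<in>mat_normalizer K T. m = c ** k"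
  shows "weyl_index A K T = card ((\<lambda>m. matrix_inv m ** \<sigma> ** m) ` mat_normalizer A TC)"
proof -
  \<comment> \<open>\<open>X n\<close> is the coset of \<open>TC\<close> through \<open>n\<close>,
    an element of the absolute Weyl group, and \<open>F n\<close> is the coset of the image of the
    small Weyl group through \<open>X n\<close>. The index is the number of values of
    \<open>F\<close>.\<close>
  define X where "X (n :: 'm cmat) = (\<lambda>c. c ** n) ` TC" for n
  define F where "F n = (\<lambda>k. X (k ** n)) ` mat_normalizer K T" for n
  define \<phi> where "\<phi> (n :: 'm cmat) = matrix_inv n ** \<sigma> ** n" for n
  have one: "mat 1 \<in> TC" and TCm: "\<And>x y. x \<in> TC \<Longrightarrow> y \<in> TC \<Longrightarrow> x ** y \<in> TC"
    using TC(1) matrix_group_one matrix_group_mult by blast+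
  \<comment> \<open>The natural map of Weyl groups on representatives: as \<open>k\<close>
    normalizes \<open>TC\<close>, the product set collapses to a single coset of
    \<open>TC\<close>.\<close>
  have setmult: "(\<lambda>t. t ** k) ` T <#>\<^bsub>mat_group A\<^esub> TC = X k" if k: "k \<in> mat_normalizer K T" for k
  proof -
    have kN: "k \<in> mat_normalizer A TC" using NK k by blast
    have "(\<lambda>t. t ** k) ` T <#>\<^bsub>mat_group A\<^esub> TC = {t ** k ** c | t c. t \<in> T \<and> c \<in> TC}"
      by (auto simp: set_mult_def mat_group_def)
    also have "\<dots> = X k"
    proof (intro equalityI subsetI)
      fix x assume "x \<in> {t ** k ** c | t c. t \<in> T \<and> c \<in> TC}"
      then obtain t c where tc: "t \<in> T" "c \<in> TC" "x = t ** k ** c" by blast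
      obtain c' where "c' \<in> TC" "k ** c = c' ** k" using mat_normalizer_left[OF kN tc(2)] by blast
      then have "x = (t ** c') ** k" "t ** c' \<in> TC"
        using tc T(3) TCm by (auto simp: matrix_mul_assoc[symmetric])
      then show "x \<in> X k" by (auto simp: X_def)
    next
      fix x assume "x \<in> X k"
      then obtain c where c: "c \<in> TC" "x = c ** k" by (auto simp: X_def)
      obtain c' where "c' \<in> TC" "c ** k = k ** c'" using mat_normalizer_right[OF kN c(1)] by blast
      then have "x = mat 1 ** k ** c'" using c by simp
      then show "x \<in> {t ** k ** c | t c. t \<in> T \<and> c \<in> TC}" using T(1) \<open>c' \<in> TC\<close> by blast
    qed
    finally show ?thesis .
  qed
  have XX: "X k <#>\<^bsub>mat_group (mat_normalizer A TC)\<^esub> X n = X (k ** n)" if k: "k \<in> mat_normalizer A TC" for k n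
  proof -
    have "X k <#>\<^bsub>mat_group (mat_normalizer A TC)\<^esub> X n = {c ** k ** (c' ** n) | c c'. c \<in> TC \<and> c' \<in> TC}"
      by (auto simp: set_mult_def mat_group_def X_def)
    also have "\<dots> = X (k ** n)"
    proof (intro equalityI subsetI)
      fix x assume "x \<in> {c ** k ** (c' ** n) | c c'. c \<in> TC \<and> c' \<in> TC}"
      then obtain c c' where c: "c \<in> TC" "c' \<in> TC" "x = c ** (k ** c') ** n" by (auto simp: matrix_mul_assoc)
      obtain c'' where "c'' \<in> TC" "k ** c' = c'' ** k" using mat_normalizer_left[OF k c(2)] by blast
      then have "x = (c ** c'') ** (k ** n)" "c ** c'' \<in> TC"
        using c TCm by (auto simp: matrix_mul_assoc)
      then show "x \<in> X (k ** n)" by (auto simp: X_def)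
    next
      fix x assume "x \<in> X (k ** n)"
      then obtain c where "c \<in> TC" "x = c ** k ** (mat 1 ** n)" by (auto simp: X_def matrix_mul_assoc)
      then show "x \<in> {c ** k ** (c' ** n) | c c'. c \<in> TC \<and> c' \<in> TC}" using one by blast
    qed
    finally show ?thesis .
  qed
  have "T \<subseteq> K" "TC \<subseteq> A" by fact+
  have sub: "(\<lambda>w. w <#>\<^bsub>mat_group A\<^esub> TC) ` carrier (weyl_group K T) = X ` mat_normalizer K T"
    unfolding carrier_weyl_group[OF K \<open>T \<subseteq> K\<close>] image_image by (intro image_cong refl setmult)
  have mult: "monoid.mult (weyl_group A TC) = set_mult (mat_group (mat_normalizer A TC))"
    unfolding weyl_group_def normalizer_mat_group[OF A \<open>TC \<subseteq> A\<close>] by simp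
  have carr: "carrier (weyl_group A TC) = X ` mat_normalizer A TC"
    unfolding carrier_weyl_group[OF A \<open>TC \<subseteq> A\<close>] X_def ..
  have "rcosets\<^bsub>weyl_group A TC\<^esub> (X ` mat_normalizer K T) = F ` mat_normalizer A TC"
  proof -
    have "(X ` mat_normalizer K T) #>\<^bsub>weyl_group A TC\<^esub> X n = (\<lambda>k. X k <#>\<^bsub>mat_group (mat_normalizer A TC)\<^esub> X n) ` mat_normalizer K T" for n
      unfolding r_coset_def mult by blast
    moreover have "(\<lambda>k. X k <#>\<^bsub>mat_group (mat_normalizer A TC)\<^esub> X n) ` mat_normalizer K T = F n" for n
      unfolding F_def by (intro image_cong refl XX) (use NK in blast)
    ultimately show ?thesis unfolding RCOSETS_def carr by (simp add: UNION_singleton_eq_range image_image)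
  qed
  moreover have "weyl_index A K T = card (rcosets\<^bsub>weyl_group A TC\<^esub>
      ((\<lambda>w. w <#>\<^bsub>mat_group A\<^esub> TC) ` carrier (weyl_group K T)))"
    by (simp only: weyl_index_def TC_def)
  ultimately have index: "weyl_index A K T = card (F ` mat_normalizer A TC)"
    by (simp only: sub)
  have X_absorb: "X (c ** n) = X n" if c: "c \<in> TC" for c n
  proof -
    obtain d where d: "d \<in> TC" "c ** d = mat 1" "d ** c = mat 1" using TC(1) c by (rule matrix_group_inverse)
    have "(\<lambda>x. x ** c) ` TC = TC"
    proof (intro equalityI subsetI)
      fix x assume "x \<in> TC"
      then have "x = (x ** d) ** c" "x ** d \<in> TC" using d TCm by (auto simp: matrix_mul_assoc[symmetric])
      then show "x \<in> (\<lambda>x. x ** c) ` TC" by blast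
    qed (use c TCm in auto)
    then have "(\<lambda>x. x ** n) ` (\<lambda>x. x ** c) ` TC = X n" by (simp add: X_def)
    then show ?thesis by (simp add: X_def image_image matrix_mul_assoc)
  qed
  have F_sub: "F (c ** k ** n) \<subseteq> F n" if c: "c \<in> TC" and k: "k \<in> mat_normalizer K T" for c k n
  proof
    fix Z assume "Z \<in> F (c ** k ** n)"
    then obtain l where l: "l \<in> mat_normalizer K T" "Z = X (l ** (c ** k ** n))" by (auto simp: F_def)
    obtain c' where c': "c' \<in> TC" "l ** c = c' ** l" using mat_normalizer_left[of l A TC c] NK l(1) c by blast
    have "l ** (c ** k ** n) = (l ** c) ** (k ** n)" by (simp only: matrix_mul_assoc)
    also have "\<dots> = c' ** ((l ** k) ** n)" unfolding c'(2) by (simp only: matrix_mul_assoc)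
    finally have "Z = X ((l ** k) ** n)" using l(2) X_absorb[OF c'(1)] by simp
    moreover have "l ** k \<in> mat_normalizer K T" by (rule mat_normalizer_mult[OF K l(1) k])
    ultimately show "Z \<in> F n" unfolding F_def by blast
  qed
  have inv: "\<exists>n'\<in>mat_normalizer A TC. n ** n' = mat 1 \<and> n' ** n = mat 1 \<and> matrix_inv n = n'" if n: "n \<in> mat_normalizer A TC" for n
  proof -
    obtain n' where n': "n' \<in> A" "n ** n' = mat 1" "n' ** n = mat 1"
      using A subsetD[OF mat_normalizer_subset n] by (rule matrix_group_inverse)
    show ?thesis
      by (intro bexI[of _ n'] conjI n' matrix_inv_eqI[OF n'(2,3)] mat_normalizer_inverse[OF A n n'(2,3)])
  qed
  \<comment> \<open>Equal conjugates mean that \<open>n' ** i\<close> commutes with \<sigma>. By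
    \<open>decomp\<close> it is an element of \<open>TC\<close> times one of the normalizer in
    \<open>K\<close>, and \<open>F\<close> absorbs both factors.\<close>
  have \<phi>_imp: "F n' \<subseteq> F n" if n: "n \<in> mat_normalizer A TC" "n' \<in> mat_normalizer A TC" and eq: "\<phi> n = \<phi> n'" for n n'
  proof -
    obtain i where i: "i \<in> mat_normalizer A TC" "n ** i = mat 1" "i ** n = mat 1" "matrix_inv n = i" using inv[OF n(1)] by blast
    obtain i' where i': "n' ** i' = mat 1" "i' ** n' = mat 1" "matrix_inv n' = i'" using inv[OF n(2)] by blast
    have eq': "i ** \<sigma> ** n = i' ** \<sigma> ** n'" using eq by (simp add: \<phi>_def i i')
    have "n' ** i ** \<sigma> = n' ** (i ** \<sigma> ** n) ** i"
      using i(2) by (simp add: matrix_mul_assoc[symmetric])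
    also have "\<dots> = n' ** i' ** \<sigma> ** (n' ** i)" unfolding eq' by (simp only: matrix_mul_assoc)
    also have "\<dots> = \<sigma> ** (n' ** i)" by (simp add: i')
    finally have comm: "n' ** i ** \<sigma> = \<sigma> ** (n' ** i)" .
    have "n' ** i \<in> mat_normalizer A TC" using mat_normalizer_mult[OF A n(2) i(1)] .
    from decomp[OF this comm] obtain c k where ck: "c \<in> TC" "k \<in> mat_normalizer K T" "n' ** i = c ** k" by blast
    have "n' = n' ** i ** n" using i by (simp add: matrix_mul_assoc[symmetric])
    then show ?thesis using F_sub[OF ck(1,2), of n] ck(3) by simp
  qed
  \<comment> \<open>Conversely, points with the same value of \<open>F\<close> differ on the left by
    some \<open>c ** k\<close>, and both factors commute with \<sigma>.\<close>
  have F_imp: "\<phi> n' = \<phi> n" if n: "n \<in> mat_normalizer A TC" "n' \<in> mat_normalizer A TC" and eq: "F n = F n'" for n n'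
  proof -
    have "mat 1 \<in> mat_normalizer K T" using matrix_group_one[OF K] by (auto intro: mat_normalizerI)
    then have "X (mat 1 ** n') \<in> F n'" unfolding F_def by (rule imageI)
    then have "X n' \<in> F n" using eq by simp
    then obtain k where k: "k \<in> mat_normalizer K T" "X n' = X (k ** n)" unfolding F_def by blast
    have "n' \<in> X n'" unfolding X_def by (rule image_eqI[OF _ one]) simp
    then obtain c where c: "c \<in> TC" "n' = c ** (k ** n)" unfolding k(2) unfolding X_def matrix_mul_lid by blast
    define x where "x = c ** k"
    have x: "x ** \<sigma> = \<sigma> ** x"
    proof -
      have "x ** \<sigma> = c ** (k ** \<sigma>)" by (simp only: x_def matrix_mul_assoc)
      also have "\<dots> = c ** \<sigma> ** k" using NK[OF k(1)] by (simp only: matrix_mul_assoc)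
      also have "\<dots> = \<sigma> ** x" by (simp only: TC_comm[OF c(1)] x_def matrix_mul_assoc)
      finally show ?thesis .
    qed
    have n': "n' = x ** n" using c(2) by (simp add: x_def matrix_mul_assoc)
    obtain i where i: "n ** i = mat 1" "i ** n = mat 1" "matrix_inv n = i" using inv[OF n(1)] by blast
    obtain i' where i': "n' ** i' = mat 1" "i' ** n' = mat 1" "matrix_inv n' = i'" using inv[OF n(2)] by blast
    have "i' ** x = i' ** (x ** n) ** i" using i(1) by (simp add: matrix_mul_assoc[symmetric])
    also have "\<dots> = i" using i'(2) by (simp add: n'[symmetric])
    finally have ix: "i' ** x = i" .
    have "i' ** \<sigma> ** n' = i' ** (\<sigma> ** x) ** n" by (simp only: n' matrix_mul_assoc)
    also have "\<dots> = i' ** x ** \<sigma> ** n" by (simp only: x[symmetric] matrix_mul_assoc)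
    also have "\<dots> = i ** \<sigma> ** n" by (simp only: ix)
    finally show ?thesis by (simp add: \<phi>_def i i')
  qed
  have "card (F ` mat_normalizer A TC) = card (\<phi> ` mat_normalizer A TC)"
  proof (rule card_image_eq_card_image)
    fix n n' assume n: "n \<in> mat_normalizer A TC" "n' \<in> mat_normalizer A TC"
    show "F n = F n' \<longleftrightarrow> \<phi> n = \<phi> n'"
    proof
      assume "F n = F n'" from F_imp[OF n this] show "\<phi> n = \<phi> n'" by simp
    next
      assume "\<phi> n = \<phi> n'"
      then show "F n = F n'" using \<phi>_imp[OF n] \<phi>_imp[OF n(2,1)] by simp
    qed
  qed
  then show ?thesis using index unfolding \<phi>_def by simp
qed

section \<open>The torus normalizer inside the symplectic group\<close>

lemma matrix_group_Sp_complex: "matrix_group (Sp_complex :: ('n::finite + 'n) cmat set)"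
  unfolding matrix_group_def
proof (intro conjI ballI Sp_complex_one Sp_complex_mult)
  fix x :: "('n + 'n) cmat" assume "x \<in> Sp_complex"
  then obtain y where "y \<in> Sp_complex" "x ** y = mat 1" "y ** x = mat 1" by (rule Sp_complex_inverse)
  then show "\<exists>y\<in>Sp_complex. x ** y = mat 1 \<and> y ** x = mat 1" by blast
qed

lemma matrix_group_max_compact: "matrix_group (max_compact \<sigma>)"
  unfolding matrix_group_def
proof (intro conjI ballI)
  show "mat 1 \<in> max_compact \<sigma>" by (simp add: max_compact_def Sp_compact_one)
next
  fix x y assume xy: "x \<in> max_compact \<sigma>" "y \<in> max_compact \<sigma>"
  then have "x ** \<sigma> = \<sigma> ** x" "y ** \<sigma> = \<sigma> ** y" by (simp_all add: max_compact_def)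
  then have "x ** y ** \<sigma> = \<sigma> ** (x ** y)" by (metis matrix_mul_assoc)
  then show "x ** y \<in> max_compact \<sigma>" using xy by (simp add: max_compact_def Sp_compact_mult)
next
  fix x assume x: "x \<in> max_compact \<sigma>"
  let ?y = "conj_transpose x"
  have xs: "x \<in> Sp_compact" "x ** \<sigma> = \<sigma> ** x" using x by (simp_all add: max_compact_def)
  note inv = Sp_compact_inverse[OF xs(1)]
  have "?y ** \<sigma> = ?y ** (\<sigma> ** x) ** ?y" by (simp add: matrix_mul_assoc[symmetric] inv)
  also have "\<dots> = ?y ** x ** \<sigma> ** ?y" by (simp only: xs(2)[symmetric] matrix_mul_assoc)
  finally have "?y ** \<sigma> = \<sigma> ** ?y" by (simp add: inv)
  then show "\<exists>y\<in>max_compact \<sigma>. x ** y = mat 1 \<and> y ** x = mat 1"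
    using inv by (intro bexI[of _ ?y]) (simp_all add: max_compact_def)
qed

lemma matrix_group_C_torus: "matrix_group (C_torus :: ('n::finite + 'n) cmat set)"
  unfolding matrix_group_def
proof (intro conjI ballI)
  show "mat 1 \<in> C_torus" by (simp add: mat_eq_diag C_torus_def)
next
  fix x y :: "('n + 'n) cmat" assume "x \<in> C_torus" "y \<in> C_torus"
  then obtain d e where d: "x = diag d" "y = diag e" "\<And>a. d a * d (opp a) = 1" "\<And>a. e a * e (opp a) = 1"
    by (auto simp: C_torus_def)
  have "d a * e a * (d (opp a) * e (opp a)) = (d a * d (opp a)) * (e a * e (opp a))" for a
    by (simp only: mult_ac)
  then show "x ** y \<in> C_torus" by (auto simp: C_torus_def diag_mult d)
next
  fix x :: "('n + 'n) cmat" assume "x \<in> C_torus"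
  then obtain d where d: "x = diag d" "\<And>a. d a * d (opp a) = 1" by (auto simp: C_torus_def)
  then have "diag (\<lambda>a. d (opp a)) \<in> C_torus" by (auto simp: C_torus_def mult.commute)
  moreover have "x ** diag (\<lambda>a. d (opp a)) = mat 1" "diag (\<lambda>a. d (opp a)) ** x = mat 1"
    by (simp_all add: d diag_mult mat_eq_diag mult.commute[of "d (opp _)"])
  ultimately show "\<exists>y\<in>C_torus. x ** y = mat 1 \<and> y ** x = mat 1" by blast
qed

lemma matrix_group_conjugate:
  assumes "matrix_group A" "g \<in> unitary_group"
  shows "matrix_group (conjugate g ` A)"
  unfolding matrix_group_def
proof (intro conjI ballI)
  show "mat 1 \<in> conjugate g ` A"
    by (rule image_eqI[of _ _ "mat 1"]) (simp_all add: assms matrix_group_one)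
next
  fix x y assume "x \<in> conjugate g ` A" "y \<in> conjugate g ` A"
  then show "x ** y \<in> conjugate g ` A"
    using matrix_group_mult[OF assms(1)] by (auto simp: conjugate_mult[OF assms(2), symmetric])
next
  fix x assume "x \<in> conjugate g ` A"
  then obtain a where a: "a \<in> A" "x = conjugate g a" by blast
  from assms(1) a(1) obtain b where "b \<in> A" "a ** b = mat 1" "b ** a = mat 1" by (rule matrix_group_inverse)
  then show "\<exists>y\<in>conjugate g ` A. x ** y = mat 1 \<and> y ** x = mat 1"
    using a assms(2) by (intro bexI[of _ "conjugate g b"]) (simp_all add: conjugate_mult[symmetric])
qed

lemma mat_normalizer_conjugate:
  assumes "g \<in> unitary_group"
  shows "mat_normalizer (conjugate g ` A) (conjugate g ` H) = conjugate g ` mat_normalizer A H"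
proof -
  have "(\<lambda>h. conjugate g x ** h) ` conjugate g ` H = conjugate g ` (\<lambda>h. x ** h) ` H"
    "(\<lambda>h. h ** conjugate g x) ` conjugate g ` H = conjugate g ` (\<lambda>h. h ** x) ` H" for x
    by (simp_all add: image_image conjugate_mult[OF assms])
  then have "conjugate g x \<in> mat_normalizer (conjugate g ` A) (conjugate g ` H) \<longleftrightarrow> x \<in> mat_normalizer A H" for x
    using inj_conjugate[OF assms] by (simp add: mat_normalizer_def inj_image_mem_iff inj_image_eq_iff)
  moreover have "mat_normalizer (conjugate g ` A) (conjugate g ` H) \<subseteq> conjugate g ` A" by (rule mat_normalizer_subset)
  ultimately show ?thesis by auto
qed

lemma conjugate_image_Sp_complex:
  fixes g :: "('a::finite + 'a) cmat"
  assumes "g \<in> Sp_compact"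
  shows "conjugate g ` Sp_complex = Sp_complex"
proof (intro equalityI subsetI)
  fix x :: "('a + 'a) cmat" assume "x \<in> Sp_complex"
  then have "conjugate (conj_transpose g) x \<in> Sp_complex"
    using assms by (intro Sp_compact_conjugate_Sp_complex Sp_compact_inverse)
  moreover have "x = conjugate g (conjugate (conj_transpose g) x)"
    using assms by (simp add: conjugate_cancel Sp_compact_unitary)
  ultimately show "x \<in> conjugate g ` Sp_complex" by blast
qed (use assms Sp_compact_conjugate_Sp_complex in blast)

text \<open>Conjugation by an element that permutes \<open>T\<close> also permutes the matrices
  commuting with all of \<open>T\<close>. For the diagonal tori this provides the natural map from
  W_K to W_G.\<close>

lemma mat_normalizer_subset_centralizer:
  assumes A: "matrix_group A" and "K \<subseteq> A" and C: "C = {x \<in> A. \<forall>t\<in>T. x ** t = t ** x}"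
  shows "mat_normalizer K T \<subseteq> mat_normalizer A C"
proof
  fix k assume k: "k \<in> mat_normalizer K T"
  then have "k \<in> A" using mat_normalizer_subset assms(2) by blast
  with A obtain i where i: "i \<in> A" "k ** i = mat 1" "i ** k = mat 1" by (rule matrix_group_inverse)
  show "k \<in> mat_normalizer A C"
  proof (rule mat_normalizerI)
    show "k \<in> A" by fact
  next
    fix c assume c: "c \<in> C"
    have "k ** c ** i \<in> C" unfolding C
    proof (intro CollectI conjI ballI)
      show "k ** c ** i \<in> A" using A \<open>k \<in> A\<close> i c C by (intro matrix_group_mult) auto
      fix t assume "t \<in> T"
      then obtain t' where t': "t' \<in> T" "t ** k = k ** t'" using mat_normalizer_right[OF k] by blast
      then have ct: "c ** t' = t' ** c" using c C by blast
      have "t' ** i = i ** (k ** t') ** i" by (simp add: matrix_mul_assoc i)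
      also have "\<dots> = i ** t" unfolding t'(2)[symmetric] by (simp add: matrix_mul_assoc[symmetric] i)
      finally have it: "i ** t = t' ** i" by simp
      have "k ** c ** i ** t = k ** c ** (i ** t)" by (simp only: matrix_mul_assoc)
      also have "\<dots> = k ** (c ** t') ** i" unfolding it by (simp only: matrix_mul_assoc)
      also have "\<dots> = (k ** t') ** c ** i" unfolding ct by (simp only: matrix_mul_assoc)
      also have "\<dots> = t ** (k ** c ** i)" unfolding t'(2)[symmetric] by (simp only: matrix_mul_assoc)
      finally show "k ** c ** i ** t = t ** (k ** c ** i)" .
    qed
    moreover have "k ** c = (k ** c ** i) ** k" by (simp add: matrix_mul_assoc[symmetric] i)
    ultimately show "\<exists>c'\<in>C. k ** c = c' ** k" by (rule bexI[rotated])
  next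
    fix c assume c: "c \<in> C"
    have "i ** c ** k \<in> C" unfolding C
    proof (intro CollectI conjI ballI)
      show "i ** c ** k \<in> A" using A \<open>k \<in> A\<close> i c C by (intro matrix_group_mult) auto
      fix t assume "t \<in> T"
      then obtain t' where t': "t' \<in> T" "k ** t = t' ** k" using mat_normalizer_left[OF k] by blast
      then have ct: "c ** t' = t' ** c" using c C by blast
      have "i ** t' = i ** (t' ** k) ** i" by (simp add: matrix_mul_assoc[symmetric] i)
      also have "\<dots> = t ** i" unfolding t'(2)[symmetric] by (simp add: matrix_mul_assoc i)
      finally have it: "t ** i = i ** t'" by simp
      have "i ** c ** k ** t = i ** c ** (k ** t)" by (simp only: matrix_mul_assoc)
      also have "\<dots> = i ** (c ** t') ** k" unfolding t'(2) by (simp only: matrix_mul_assoc)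
      also have "\<dots> = (i ** t') ** c ** k" unfolding ct by (simp only: matrix_mul_assoc)
      also have "\<dots> = t ** (i ** c ** k)" unfolding it[symmetric] by (simp only: matrix_mul_assoc)
      finally show "i ** c ** k ** t = t ** (i ** c ** k)" .
    qed
    moreover have "c ** k = k ** (i ** c ** k)" by (simp add: matrix_mul_assoc i)
    ultimately show "\<exists>c'\<in>C. c ** k = k ** c'" by (rule bexI[rotated])
  qed
qed

lemma max_compact_subset: "max_compact \<sigma> \<subseteq> Sp_complex"
  by (auto simp: max_compact_def Sp_compact_def)

lemma regular_C_torus:
  obtains u where "diag u \<in> C_torus" "inj (u :: 'n::finite + 'n \<Rightarrow> complex)"
proof -
  obtain u where "diag u \<in> U_torus" "inj (u :: 'n + 'n \<Rightarrow> complex)" by (rule regular_U_torus)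
  then show ?thesis by (intro that[of u]) (simp_all add: U_torus_def)
qed

text \<open>Elements of the normalizer of the torus are monomial matrices, so their columns are orthogonal.\<close>

lemma mat_normalizer_C_torus_gram:
  assumes "m \<in> mat_normalizer Sp_complex C_torus"
  obtains d where "conj_transpose m ** m = diag d"
proof -
  obtain u :: "'a + 'a \<Rightarrow> complex" where u: "diag u \<in> C_torus" "inj u" by (rule regular_C_torus)
  obtain c where "c \<in> C_torus" "m ** diag u = c ** m" using mat_normalizer_left[OF assms u(1)] by blast
  then obtain e where e: "m ** diag u = diag e ** m" by (auto simp: C_torus_def)
  have "m $ a $ b * u b = e a * m $ a $ b" for a b
    using e by (metis mult_diag_nth diag_mult_nth)
  \<comment> \<open>Since the values of \<open>u\<close> are distinct, this leaves at most one
    nonzero entry in each row of \<open>m\<close>.\<close>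
  then have col: "e a = u b" if "m $ a $ b \<noteq> 0" for a b
    using that by (metis mult.commute mult_cancel_left)
  have "cnj (m $ a $ b) * m $ a $ c = 0" if "b \<noteq> c" for a b c
  proof (rule ccontr)
    assume "\<not> ?thesis"
    then have "u b = u c" using col[of a b] col[of a c] by simp
    then show False using u(2) that by (simp add: inj_eq)
  qed
  then have "(conj_transpose m ** m) $ b $ c = 0" if "b \<noteq> c" for b c
    unfolding matrix_mul_nth_herm_inner herm_inner_def column_def vec_lambda_beta
    using that by (intro sum.neutral ballI)
  then have "conj_transpose m ** m = diag (\<lambda>b. (conj_transpose m ** m) $ b $ b)"
    by (simp add: vec_eq_iff diag_nth)
  then show ?thesis by (rule that)
qed

text \<open>Polar decomposition with an explicit positive factor: the Gram matrix
  \<open>diag d\<close> of the columns is symplectic, so its positive square root \<open>t\<close>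
  lies in \<open>C_torus\<close>. Dividing by \<open>t\<close> leaves a unitary matrix that still
  normalizes the torus and commutes with \<open>diag s\<close>.\<close>

lemma mat_normalizer_C_torus_decomp:
  assumes m: "m \<in> mat_normalizer Sp_complex C_torus" and comm: "m ** diag s = diag s ** m"
  shows "\<exists>c\<in>C_torus. \<exists>k\<in>mat_normalizer (max_compact (diag s)) U_torus. m = c ** k"
proof -
  have mS: "m \<in> Sp_complex" using m mat_normalizer_subset by blast
  obtain d where d: "conj_transpose m ** m = diag d" using m by (rule mat_normalizer_C_torus_gram)
  have d_norm: "d a = of_real ((norm (column a m))\<^sup>2)" for a
    using arg_cong[OF d, of "\<lambda>M. M $ a $ a"] by (simp add: matrix_mul_nth_herm_inner herm_inner_self diag_nth)
  have "diag d \<in> Sp_complex" unfolding d[symmetric]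
    using mS by (intro Sp_complex_mult conj_transpose_in_Sp_complex)
  then have dd: "d a * d (opp a) = 1" for a by (simp add: diag_in_Sp_complex)
  define r where "r a = norm (column a m)" for a
  have "(r a * r (opp a))\<^sup>2 = 1" for a
  proof -
    have "complex_of_real ((r a * r (opp a))\<^sup>2) = 1"
      using dd[of a] by (simp add: d_norm r_def power_mult_distrib)
    then show ?thesis using of_real_eq_1_iff by blast
  qed
  then have rr: "r a * r (opp a) = 1" for a
    using power2_eq_1_iff[of "r a * r (opp a)"]
    by (metis mult_nonneg_nonneg norm_ge_zero r_def zero_le_one neg_0_le_iff_le not_one_le_zero)
  define t t' where "t = diag (\<lambda>a. complex_of_real (r a))" and "t' = diag (\<lambda>a. complex_of_real (r (opp a)))"
  have rr': "complex_of_real (r a) * complex_of_real (r (opp a)) = 1" for a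
    using rr[of a] by (metis of_real_1 of_real_mult)
  have rr'': "complex_of_real (r (opp a)) * complex_of_real (r a) = 1" for a
    using rr'[of a] by (simp add: mult.commute)
  have tC: "t \<in> C_torus" "t' \<in> C_torus" by (auto simp: t_def t'_def C_torus_def rr' rr'')
  have tt: "t ** t' = mat 1" "t' ** t = mat 1"
    by (simp_all add: t_def t'_def diag_mult mat_eq_diag rr' rr'')
  define k where "k = m ** t'"
  have mk: "m = k ** t" by (simp add: k_def matrix_mul_assoc[symmetric] tt)
  have t'N: "t' \<in> mat_normalizer Sp_complex C_torus"
  proof (rule mat_normalizerI)
    show "t' \<in> Sp_complex" using tC C_torus_subset by blast
    fix h :: "('a + 'a) cmat" assume h: "h \<in> C_torus"
    then have "t' ** h = h ** t'" by (auto simp: C_torus_def t'_def diag_commute)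
    with h show "\<exists>h'\<in>C_torus. t' ** h = h' ** t'" "\<exists>h'\<in>C_torus. h ** t' = t' ** h'" by (metis, metis)
  qed
  have kN: "k \<in> mat_normalizer Sp_complex C_torus"
    unfolding k_def by (rule mat_normalizer_mult[OF matrix_group_Sp_complex m t'N])
  have "conj_transpose k ** k = t' ** diag d ** t'"
  proof -
    have "conj_transpose t' = t'" by (simp add: t'_def conj_transpose_diag)
    then have "conj_transpose k ** k = t' ** (conj_transpose m ** m) ** t'"
      by (simp add: k_def conj_transpose_mul matrix_mul_assoc)
    then show ?thesis by (simp add: d)
  qed
  also have "diag d = t ** t" by (simp add: t_def diag_mult d_norm r_def power2_eq_square fun_eq_iff)
  finally have kk: "conj_transpose k ** k = mat 1"
    by (simp add: matrix_mul_assoc tt)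
  then have kU: "k \<in> Sp_compact"
    using kN mat_normalizer_subset by (auto simp: Sp_compact_def unitary_group_def)
  have "k ** diag s = m ** diag s ** t'"
    by (simp add: k_def t'_def matrix_mul_assoc[symmetric] diag_commute[of s])
  also have "\<dots> = diag s ** k" by (simp only: comm k_def matrix_mul_assoc)
  finally have kK: "k \<in> max_compact (diag s)" using kU by (simp add: max_compact_def)
  have "k \<in> mat_normalizer (max_compact (diag s)) U_torus"
  proof (rule mat_normalizerI[OF kK])
    fix h :: "('a + 'a) cmat" assume "h \<in> U_torus"
    then have h: "h \<in> C_torus" "h \<in> unitary_group" by (auto simp: U_torus_def)
    note inv = Sp_compact_inverse[OF kU]
    have mult: "x ** y ** z \<in> unitary_group" if "x \<in> unitary_group" "y \<in> unitary_group" "z \<in> unitary_group"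
      for x y z :: "('a + 'a) cmat"
    proof -
      have "conj_transpose z ** (conj_transpose y ** (conj_transpose x ** x) ** y) ** z = mat 1"
        using that by (simp add: unitary_group_def)
      then show ?thesis by (simp add: unitary_group_def conj_transpose_mul matrix_mul_assoc)
    qed
    obtain h' where h': "h' \<in> C_torus" "k ** h = h' ** k" using mat_normalizer_left[OF kN h(1)] by blast
    have "h' = (h' ** k) ** conj_transpose k" by (simp add: matrix_mul_assoc[symmetric] inv)
    also have "\<dots> = k ** h ** conj_transpose k" by (simp only: h'(2))
    finally have "h' \<in> unitary_group"
      using mult kU inv(1) h(2) by (simp add: Sp_compact_unitary)
    then show "\<exists>h'\<in>U_torus. k ** h = h' ** k" using h' by (auto simp: U_torus_def)
    obtain h' where h': "h' \<in> C_torus" "h ** k = k ** h'" using mat_normalizer_right[OF kN h(1)] by blast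
    have "h' = conj_transpose k ** (k ** h')" by (simp add: matrix_mul_assoc inv)
    also have "\<dots> = conj_transpose k ** h ** k" by (simp only: h'(2)[symmetric] matrix_mul_assoc)
    finally have "h' \<in> unitary_group"
      using mult kU inv(1) h(2) by (simp add: Sp_compact_unitary)
    then show "\<exists>h'\<in>U_torus. h ** k = k ** h'" using h' by (auto simp: U_torus_def)
  qed
  \<comment> \<open>The positive factor stands to the right of \<open>k\<close>; as \<open>k\<close>
    normalizes the torus, some element of the torus can replace it on the left.\<close>
  moreover obtain c where "c \<in> C_torus" "k ** t = c ** k" using mat_normalizer_left[OF kN tC(1)] by blast
  ultimately show ?thesis using mk by blast
qed

text \<open>Conjugation by \<open>g\<close> fixes Sp(2n, C) and brings both tori and \<sigma> to
  diagonal form at once, so the orbit may be counted for \<open>diag s\<close> under the normalizer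
  of the diagonal torus.\<close>

theorem weyl_index_Sp_complex:
  assumes g: "g \<in> Sp_compact" and \<sigma>: "\<sigma> = conjugate g (diag s)"
    and T: "T = conjugate g ` U_torus" and TC: "complex_torus T = conjugate g ` C_torus"
  shows "weyl_index Sp_complex (max_compact \<sigma>) T =
    card ((\<lambda>m. matrix_inv m ** diag s ** m) ` mat_normalizer Sp_complex C_torus)"
proof -
  have u: "g \<in> unitary_group" using g by (rule Sp_compact_unitary)
  note K = conjugate_image_max_compact[OF g, of "diag s", folded \<sigma>]
  note A = conjugate_image_Sp_complex[OF g]
  have NA: "mat_normalizer Sp_complex (complex_torus T) = conjugate g ` mat_normalizer Sp_complex C_torus"
    unfolding TC using mat_normalizer_conjugate[OF u, of Sp_complex C_torus] by (simp only: A)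
  have NK: "mat_normalizer (max_compact \<sigma>) T = conjugate g ` mat_normalizer (max_compact (diag s)) U_torus"
    unfolding T using mat_normalizer_conjugate[OF u, of "max_compact (diag s)" U_torus] by (simp only: K)
  have "weyl_index Sp_complex (max_compact \<sigma>) T =
      card ((\<lambda>m. matrix_inv m ** \<sigma> ** m) ` mat_normalizer Sp_complex (complex_torus T))"
  proof (rule weyl_index_eq_card_orbit)
    show "matrix_group (complex_torus T)"
      unfolding TC by (rule matrix_group_conjugate[OF matrix_group_C_torus u])
    show "complex_torus T \<subseteq> Sp_complex"
      unfolding TC using A C_torus_subset by blast
    have "mat 1 \<in> U_torus"
      using matrix_group_one[OF matrix_group_C_torus] by (simp add: U_torus_def unitary_group_def)
    then show "mat 1 \<in> T" unfolding T using u by (intro image_eqI[of _ _ "mat 1"]) simp_all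
    show "T \<subseteq> max_compact \<sigma>" unfolding T K[symmetric] using U_torus_subset_max_compact by (rule image_mono)
    show "T \<subseteq> complex_torus T" unfolding T TC[unfolded T] by (rule image_mono) (simp add: U_torus_def)
  next
    fix k assume "k \<in> mat_normalizer (max_compact \<sigma>) T"
    then obtain k' where k': "k' \<in> mat_normalizer (max_compact (diag s)) U_torus" "k = conjugate g k'" unfolding NK by blast
    then have "k' \<in> mat_normalizer Sp_complex C_torus"
      using mat_normalizer_subset_centralizer[OF matrix_group_Sp_complex max_compact_subset centralizer_U_torus[symmetric]]
      by blast
    moreover have "k ** \<sigma> = \<sigma> ** k"
      using k' mat_normalizer_subset[of "max_compact (diag s)"] u
      by (auto simp: \<sigma> conjugate_commute_iff max_compact_def)
    ultimately show "k \<in> mat_normalizer Sp_complex (complex_torus T) \<and> k ** \<sigma> = \<sigma> ** k"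
      unfolding NA using k'(2) by blast
  next
    fix c assume "c \<in> complex_torus T"
    then show "c ** \<sigma> = \<sigma> ** c"
      using u by (auto simp: TC \<sigma> C_torus_def conjugate_commute_iff diag_commute)
  next
    fix m assume "m \<in> mat_normalizer Sp_complex (complex_torus T)" and comm: "m ** \<sigma> = \<sigma> ** m"
    then obtain m' where m': "m' \<in> mat_normalizer Sp_complex C_torus" "m = conjugate g m'" unfolding NA by blast
    with comm have "m' ** diag s = diag s ** m'" using u by (simp add: \<sigma> conjugate_commute_iff)
    from mat_normalizer_C_torus_decomp[OF m'(1) this] obtain c k
      where ck: "c \<in> C_torus" "k \<in> mat_normalizer (max_compact (diag s)) U_torus" "m' = c ** k" by blast
    then have "m = conjugate g c ** conjugate g k" using u by (simp add: m'(2) conjugate_mult)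
    then show "\<exists>c\<in>complex_torus T. \<exists>k\<in>mat_normalizer (max_compact \<sigma>) T. m = c ** k"
      unfolding TC NK using ck(1,2) by blast
  qed (rule matrix_group_Sp_complex matrix_group_max_compact)+
  also have "(\<lambda>m. matrix_inv m ** \<sigma> ** m) ` mat_normalizer Sp_complex (complex_torus T) =
      conjugate g ` (\<lambda>m. matrix_inv m ** diag s ** m) ` mat_normalizer Sp_complex C_torus"
  proof -
    have "matrix_inv (conjugate g m) ** \<sigma> ** conjugate g m = conjugate g (matrix_inv m ** diag s ** m)"
      if "m \<in> mat_normalizer Sp_complex C_torus" for m
    proof -
      obtain i where i: "i \<in> Sp_complex" "m ** i = mat 1" "i ** m = mat 1"
        using matrix_group_Sp_complex subsetD[OF mat_normalizer_subset \<open>m \<in> mat_normalizer Sp_complex C_torus\<close>] by (rule matrix_group_inverse)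
      have "matrix_inv m = i" using i by (intro matrix_inv_eqI)
      moreover have "matrix_inv (conjugate g m) = conjugate g i"
        using i u by (intro matrix_inv_eqI) (simp_all add: conjugate_mult[symmetric])
      ultimately show ?thesis using u by (simp add: \<sigma> conjugate_mult)
    qed
    then show ?thesis unfolding NA image_image by (rule image_cong[OF refl])
  qed
  also have "card \<dots> = card ((\<lambda>m. matrix_inv m ** diag s ** m) ` mat_normalizer Sp_complex C_torus)"
    using inj_conjugate[OF u] by (intro card_image) (auto intro: inj_on_subset)
  finally show ?thesis .
qed

subsection \<open>Counting the orbits\<close>

lemma trace_diag: "trace (diag d) = (\<Sum>a\<in>UNIV. d a)"
  by (simp add: trace_def diag_nth)

text \<open>The conjugate commutes with a regular diagonal matrix, because \<open>m\<close>
  normalizes the torus, and is therefore diagonal. Trace, a scalar square and membership in Sp(2n,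
  C) survive conjugation by \<open>m\<close>; these invariants bound the orbits from above.\<close>

lemma orbit_element:
  assumes m: "m \<in> mat_normalizer Sp_complex C_torus"
  obtains t where "matrix_inv m ** diag s ** m = diag t" "(\<Sum>a\<in>UNIV. t a) = (\<Sum>a\<in>UNIV. s a)"
    "\<forall>c. (\<forall>a. s a * s a = c) \<longrightarrow> (\<forall>a. t a * t a = c)"
    "(\<forall>a. s a * s (opp a) = 1) \<longrightarrow> (\<forall>a. t a * t (opp a) = 1)"
proof -
  obtain i where i: "i \<in> Sp_complex" "m ** i = mat 1" "i ** m = mat 1"
    using matrix_group_Sp_complex subsetD[OF mat_normalizer_subset m] by (rule matrix_group_inverse)
  have inv: "matrix_inv m = i" using i by (intro matrix_inv_eqI)
  define Y where "Y = i ** diag s ** m"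
  obtain u :: "'a + 'a \<Rightarrow> complex" where u: "diag u \<in> C_torus" "inj u" by (rule regular_C_torus)
  obtain c where "c \<in> C_torus" and c: "m ** diag u = c ** m" using mat_normalizer_left[OF m u(1)] by blast
  then obtain e where e: "c = diag e" by (auto simp: C_torus_def)
  have "diag u ** i = i ** (m ** diag u) ** i" by (simp add: matrix_mul_assoc i)
  also have "\<dots> = i ** c" unfolding c by (simp add: matrix_mul_assoc[symmetric] i)
  finally have ui: "diag u ** i = i ** c" .
  have "Y ** diag u = i ** diag s ** (m ** diag u)" by (simp only: Y_def matrix_mul_assoc)
  also have "\<dots> = i ** (diag s ** c) ** m" unfolding c by (simp only: matrix_mul_assoc)
  also have "diag s ** c = c ** diag s" unfolding e by (rule diag_commute)
  also have "i ** (c ** diag s) ** m = diag u ** Y" by (simp only: ui Y_def matrix_mul_assoc)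
  finally obtain t where t: "Y = diag t" using u(2) by (rule commute_regular_diag)
  show ?thesis
  proof (rule that[of t])
    show "matrix_inv m ** diag s ** m = diag t" using t by (simp add: Y_def inv)
    have "trace Y = trace (m ** (i ** diag s))" unfolding Y_def by (rule trace_mul_sym)
    then have "trace Y = trace (diag s)" by (simp add: matrix_mul_assoc i)
    then show "(\<Sum>a\<in>UNIV. t a) = (\<Sum>a\<in>UNIV. s a)" by (simp add: t trace_diag)
    show "\<forall>c. (\<forall>a. s a * s a = c) \<longrightarrow> (\<forall>a. t a * t a = c)"
    proof (intro allI impI)
      fix c a assume "\<forall>a. s a * s a = c"
      then have ss: "diag s ** diag s = mat c" by (simp add: diag_mult mat_eq_diag)
      have "Y ** Y = i ** diag s ** (m ** i) ** diag s ** m" by (simp only: Y_def matrix_mul_assoc)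
      also have "\<dots> = i ** (diag s ** diag s) ** m" by (simp only: i matrix_mul_rid matrix_mul_assoc)
      also have "\<dots> = mat c ** (i ** m)" by (simp only: ss mat_commute[symmetric] matrix_mul_assoc)
      finally have "diag (\<lambda>a. t a * t a) = (mat c :: ('a + 'a) cmat)" by (simp add: t diag_mult i)
      then show "t a * t a = c" by (simp add: mat_eq_diag fun_eq_iff)
    qed
    show "(\<forall>a. s a * s (opp a) = 1) \<longrightarrow> (\<forall>a. t a * t (opp a) = 1)"
    proof (intro allI impI)
      fix a assume "\<forall>a. s a * s (opp a) = 1"
      then have "diag s \<in> Sp_complex" by (simp add: diag_in_Sp_complex)
      then have "Y \<in> Sp_complex" unfolding Y_def using i m mat_normalizer_subset by (intro Sp_complex_mult) auto
      then show "t a * t (opp a) = 1" by (simp add: t diag_in_Sp_complex)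
    qed
  qed
qed

text \<open>Compatibility with \<open>opp\<close> makes \<pi> a signed permutation of the n pairs.
  Its permutation matrix becomes symplectic after an adjustment of signs, and the resulting monomial
  matrix normalizes the torus. This bounds the orbits from below.\<close>

lemma orbit_permute:
  fixes \<pi> :: "'n::finite + 'n \<Rightarrow> 'n + 'n"
  assumes \<pi>: "bij \<pi>" "\<And>a. \<pi> (opp a) = opp (\<pi> a)"
  shows "diag (\<lambda>a. s (\<pi> a)) \<in> (\<lambda>m. matrix_inv m ** diag s ** m) ` mat_normalizer Sp_complex C_torus"
proof -
  \<comment> \<open>Exchanging the two halves of a pair reverses the sign of J on it; entries of
    opposite sign at \<open>b\<close> and \<open>opp b\<close> compensate for this.\<close>
  define \<epsilon> where "\<epsilon> b = (if opp_sgn (\<pi> b) = opp_sgn b then 1 else opp_sgn b)" for b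
  define m :: "('n + 'n) cmat" where "m = (\<chi> a b. if a = \<pi> b then \<epsilon> b else 0)"
  have inj: "\<pi> a = \<pi> b \<longleftrightarrow> a = b" for a b using \<pi>(1) by (simp add: bij_is_inj inj_eq)
  have \<epsilon>: "\<epsilon> a * opp_sgn (\<pi> a) * \<epsilon> (opp a) = opp_sgn a" for a
    unfolding \<epsilon>_def \<pi>(2) by (cases "\<pi> a"; cases a) simp_all
  have "(transpose m ** sympl_J ** m) $ a $ b = sympl_J $ a $ b" for a b
  proof -
    have "(transpose m ** (sympl_J ** m)) $ a $ b = (\<Sum>c\<in>UNIV. m $ c $ a * (opp_sgn c * m $ opp c $ b))"
      unfolding matrix_matrix_mult_def[of "transpose m"] by (simp add: transpose_def sympl_J_mult_nth)
    also have "\<dots> = (\<Sum>c\<in>UNIV. if c = \<pi> a then \<epsilon> a * (opp_sgn (\<pi> a) * m $ opp (\<pi> a) $ b) else 0)"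
      by (intro sum.cong refl) (simp add: m_def)
    also have "\<dots> = \<epsilon> a * (opp_sgn (\<pi> a) * m $ \<pi> (opp a) $ b)" by (simp add: \<pi>(2))
    also have "\<dots> = sympl_J $ a $ b"
      using \<epsilon>[of a] by (simp add: m_def inj sympl_J_nth mult.assoc)
    finally show ?thesis by (simp add: matrix_mul_assoc)
  qed
  then have mS: "m \<in> Sp_complex" by (simp add: Sp_complex_def vec_eq_iff)
  have mdiag: "m ** diag (\<lambda>a. d (\<pi> a)) = diag d ** m" for d
    by (simp add: vec_eq_iff mult_diag_nth diag_mult_nth) (simp add: m_def)
  have mN: "m \<in> mat_normalizer Sp_complex C_torus"
  proof (rule mat_normalizerI[OF mS])
    fix h :: "('n + 'n) cmat" assume "h \<in> C_torus"
    then obtain d where d: "h = diag d" "\<And>a. d a * d (opp a) = 1" by (auto simp: C_torus_def)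
    have "diag (\<lambda>a. d (\<pi> a)) \<in> C_torus" using d(2) by (auto simp: C_torus_def \<pi>(2))
    then show "\<exists>h'\<in>C_torus. h ** m = m ** h'" unfolding d(1) mdiag[symmetric] by (intro bexI) (rule refl)
    define d' where "d' a = d (inv_into UNIV \<pi> a)" for a
    have d'\<pi>: "d' (\<pi> a) = d a" for a using \<pi>(1) by (simp add: d'_def bij_is_inj)
    have "d' a * d' (opp a) = 1" for a
    proof -
      obtain b where b: "a = \<pi> b" using \<pi>(1) by (metis bij_pointE)
      show ?thesis unfolding b \<pi>(2)[symmetric] d'\<pi> by (rule d(2))
    qed
    then have "diag d' \<in> C_torus" by (auto simp: C_torus_def)
    moreover have "m ** h = diag d' ** m" using mdiag[of d'] by (simp add: d(1) d'\<pi>)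
    ultimately show "\<exists>h'\<in>C_torus. m ** h = h' ** m" by (rule bexI[rotated])
  qed
  obtain i where i: "i \<in> Sp_complex" "m ** i = mat 1" "i ** m = mat 1"
    using matrix_group_Sp_complex mS by (rule matrix_group_inverse)
  have "matrix_inv m = i" using i by (intro matrix_inv_eqI)
  then have "matrix_inv m ** diag s ** m = i ** (m ** diag (\<lambda>a. s (\<pi> a)))"
    unfolding mdiag by (simp only: matrix_mul_assoc)
  then have "matrix_inv m ** diag s ** m = diag (\<lambda>a. s (\<pi> a))" by (simp add: matrix_mul_assoc i)
  then show ?thesis using mN by (intro image_eqI[of _ _ m]) simp_all
qed

lemma square_eq_minus_one: "(z :: complex) * z = - 1 \<longleftrightarrow> z = \<i> \<or> z = - \<i>"
  using square_eq_iff[of z \<i>] by simp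

text \<open>The orbit consists of all distributions of the two square roots of -1 over the n pairs.
  Where two distributions disagree, exchanging the coordinates of the pair turns one into the other,
  so all of them are reached.\<close>

lemma card_orbit_skew:
  fixes s :: "'n::finite + 'n \<Rightarrow> complex"
  assumes s: "\<And>a. s a * s a = - 1" "\<And>a. s (opp a) = - s a"
  shows "card ((\<lambda>m. matrix_inv m ** diag s ** m) ` mat_normalizer Sp_complex C_torus) = 2 ^ CARD('n)"
proof -
  define R where "R = {t :: 'n + 'n \<Rightarrow> complex. \<forall>a. t a * t a = - 1 \<and> t (opp a) = - t a}"
  have "(\<lambda>m. matrix_inv m ** diag s ** m) ` mat_normalizer Sp_complex C_torus = diag ` R"
  proof (intro equalityI subsetI)
    fix x assume "x \<in> (\<lambda>m. matrix_inv m ** diag s ** m) ` mat_normalizer Sp_complex C_torus"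
    then obtain m where m: "m \<in> mat_normalizer Sp_complex C_torus" "x = matrix_inv m ** diag s ** m" by blast
    obtain t where t1: "matrix_inv m ** diag s ** m = diag t" and "(\<Sum>a\<in>UNIV. t a) = (\<Sum>a\<in>UNIV. s a)"
      and t: "\<forall>c. (\<forall>a. s a * s a = c) \<longrightarrow> (\<forall>a. t a * t a = c)"
      "(\<forall>a. s a * s (opp a) = 1) \<longrightarrow> (\<forall>a. t a * t (opp a) = 1)"
      by (rule orbit_element[OF m(1), of s])
    have tt: "t a * t a = - 1" for a using t(1) s(1) by simp
    \<comment> \<open>Membership in Sp(2n, C) makes the entries of a pair inverse to each other, and
      the inverse of a square root of -1 is its negative.\<close>
    have "t a * t (opp a) = 1" for a using t(2) s by simp
    then have "t a * (t a * t (opp a)) = t a" for a by simp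
    then have "t (opp a) = - t a" for a
      by (metis mult.assoc mult_minus1 tt minus_minus)
    then show "x \<in> diag ` R" using tt m(2) t1 by (auto simp: R_def)
  next
    fix x assume "x \<in> diag ` R"
    then obtain t where t: "x = diag t" "\<And>a. t a * t a = - 1" "\<And>a. t (opp a) = - t a" by (auto simp: R_def)
    define \<pi> where "\<pi> a = (if t a = s a then a else opp a)" for a
    have \<pi>_opp: "\<pi> (opp a) = opp (\<pi> a)" for a by (simp add: \<pi>_def t(3) s(2))
    have "\<pi> (\<pi> a) = a" for a
      by (cases "t a = s a") (simp_all add: \<pi>_def t(3) s(2))
    then have "bij \<pi>" by (metis bijI')
    moreover have "s (\<pi> a) = t a" for a
    proof -
      have "t a = s a \<or> t a = - s a" using square_eq_iff[of "t a" "s a"] t(2) s(1) by simp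
      then show ?thesis by (auto simp: \<pi>_def s(2))
    qed
    ultimately show "x \<in> (\<lambda>m. matrix_inv m ** diag s ** m) ` mat_normalizer Sp_complex C_torus"
      using orbit_permute[of \<pi> s] \<pi>_opp by (simp add: t(1))
  qed
  also have "card (diag ` R) = card R" by (intro card_image inj_onI) simp
  also have "\<dots> = card (UNIV :: 'n set set)"
  proof (rule sym, rule bij_betw_same_card)
    define f where "f F a = (case a of Inl i \<Rightarrow> if i \<in> F then \<i> else - \<i> | Inr i \<Rightarrow> if i \<in> F then - \<i> else \<i>)"
      for F :: "'n set" and a
    show "bij_betw f UNIV R"
    proof (intro bij_betw_byWitness[where f' = "\<lambda>t. {i. t (Inl i) = \<i>}"] ballI)
      fix F :: "'n set"
      have "\<i> \<noteq> - \<i>" by (simp add: complex_eq_iff)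
      then show "{i. f F (Inl i) = \<i>} = F" by (auto simp: f_def split: if_splits)
    next
      fix t assume "t \<in> R"
      then have t: "t a = \<i> \<or> t a = - \<i>" "t (opp a) = - t a" for a
        by (simp_all add: R_def square_eq_minus_one)
      have "f {i. t (Inl i) = \<i>} a = t a" for a
      proof (cases a)
        case (Inl i)
        then show ?thesis using t(1)[of a] by (auto simp: f_def)
      next
        case (Inr i)
        then show ?thesis using t(1)[of "Inl i"] t(2)[of "Inl i"] by (auto simp: f_def)
      qed
      then show "f {i. t (Inl i) = \<i>} = t" by (simp add: fun_eq_iff)
    next
      have "f F a * f F a = - 1 \<and> f F (opp a) = - f F a" for F a
        by (cases a) (simp_all add: f_def)
      then show "f ` UNIV \<subseteq> R" by (auto simp: R_def)
    qed simp
  qed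
  also have "\<dots> = 2 ^ CARD('n)" by (simp add: card_UNIV_set)
  finally show ?thesis .
qed

lemma sum_UNIV_sum:
  "(\<Sum>a\<in>UNIV. f (a :: 'n::finite + 'm::finite)) = (\<Sum>i\<in>UNIV. f (Inl i)) + (\<Sum>i\<in>UNIV. f (Inr i))"
  by (subst UNIV_Plus_UNIV[symmetric], subst sum.Plus) simp_all

definition sig_fun :: "'n set \<Rightarrow> 'n + 'n \<Rightarrow> complex" where
  "sig_fun F a = (if lies_over a F then 1 else - 1)"

lemma lies_over_opp [simp]: "lies_over (opp a) F = lies_over a F"
  by (cases a) (simp_all add: lies_over_def)

lemma lies_over_simps [simp]: "lies_over (Inl i) F \<longleftrightarrow> i \<in> F" "lies_over (Inr i) F \<longleftrightarrow> i \<in> F"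
  by (simp_all add: lies_over_def)

text \<open>The sum is the trace of the sign matrix, a conjugation invariant from which the
  cardinality of \<open>F\<close> can be read off.\<close>

lemma sum_sig_fun:
  fixes F :: "'n::finite set"
  shows "(\<Sum>a\<in>UNIV. sig_fun F a) = 4 * of_nat (card F) - 2 * of_nat CARD('n)"
proof -
  have "(\<Sum>i\<in>UNIV. if i \<in> F then 1 else - 1 :: complex) = (\<Sum>i\<in>UNIV. 2 * (if i \<in> F then 1 else 0) - 1)"
    by (intro sum.cong) auto
  also have "\<dots> = 2 * of_nat (card F) - of_nat CARD('n)"
    by (simp add: sum_subtractf sum_distrib_left[symmetric] sum.If_cases)
  finally show ?thesis by (simp add: sum_UNIV_sum sig_fun_def)
qed

lemma sig_fun_cases:
  fixes t :: "'n::finite + 'n \<Rightarrow> complex"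
  assumes "\<And>a. t a * t a = 1" "\<And>a. t (opp a) = t a"
  shows "t = sig_fun {i. t (Inl i) = 1}"
proof
  fix a
  have "t b = 1 \<or> t b = - 1" for b using square_eq_iff[of "t b" 1] assms(1) by simp
  then show "t a = sig_fun {i. t (Inl i) = 1} a"
    using assms(2)[of a] assms(2)[of "opp a"] by (cases a) (auto simp: sig_fun_def)
qed

text \<open>The trace keeps the number of positive signs constant along the orbit. Conversely,
  subsets of equal size are related by a permutation of the n coordinates acting on both halves
  simultaneously.\<close>

lemma card_orbit_sig:
  fixes F :: "'n::finite set"
  shows "card ((\<lambda>m. matrix_inv m ** diag (sig_fun F) ** m) ` mat_normalizer Sp_complex C_torus) = CARD('n) choose card F"
proof -
  define R where "R = {E :: 'n set. E \<subseteq> UNIV \<and> card E = card F}"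
  have sq: "sig_fun E a * sig_fun E a = 1" "sig_fun E (opp a) = sig_fun E a" for E :: "'n set" and a
    by (simp_all add: sig_fun_def)
  have "(\<lambda>m. matrix_inv m ** diag (sig_fun F) ** m) ` mat_normalizer Sp_complex C_torus = (\<lambda>E. diag (sig_fun E)) ` R"
  proof (intro equalityI subsetI)
    fix x assume "x \<in> (\<lambda>m. matrix_inv m ** diag (sig_fun F) ** m) ` mat_normalizer Sp_complex C_torus"
    then obtain m where m: "m \<in> mat_normalizer Sp_complex C_torus" "x = matrix_inv m ** diag (sig_fun F) ** m" by blast
    obtain t where t: "matrix_inv m ** diag (sig_fun F) ** m = diag t"
      "(\<Sum>a\<in>UNIV. t a) = (\<Sum>a\<in>UNIV. sig_fun F a)"
      "\<forall>c. (\<forall>a. sig_fun F a * sig_fun F a = c) \<longrightarrow> (\<forall>a. t a * t a = c)"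
      "(\<forall>a. sig_fun F a * sig_fun F (opp a) = 1) \<longrightarrow> (\<forall>a. t a * t (opp a) = 1)"
      by (rule orbit_element[OF m(1), of "sig_fun F"])
    have tt: "t a * t a = 1" for a using t(3) sq by simp
    have "t a * t (opp a) = 1" for a using t(4) sq by simp
    then have "t a * (t a * t (opp a)) = t a" for a by simp
    then have "t (opp a) = t a" for a by (metis mult.assoc mult_1 tt)
    with tt have E: "t = sig_fun {i. t (Inl i) = 1}" by (intro sig_fun_cases)
    define E where "E = {i. t (Inl i) = 1}"
    have "(\<Sum>a\<in>UNIV. sig_fun E a) = (\<Sum>a\<in>UNIV. sig_fun F a)"
      using t(2) unfolding E_def E[symmetric] .
    then have "of_nat (card E) = (of_nat (card F) :: complex)" by (simp add: sum_sig_fun)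
    then have "E \<in> R" by (simp add: R_def)
    moreover have "diag t = diag (sig_fun E)" unfolding E_def by (rule arg_cong[OF E])
    ultimately show "x \<in> (\<lambda>E. diag (sig_fun E)) ` R"
      using m(2) t(1) by (intro image_eqI[of _ _ E]) simp_all
  next
    fix x assume "x \<in> (\<lambda>E. diag (sig_fun E)) ` R"
    then obtain E where E: "x = diag (sig_fun E)" "card E = card F" by (auto simp: R_def)
    obtain f where f: "bij_betw f E F" using E(2) finite_same_card_bij[of E F] by auto
    \<comment> \<open>A bijection of the complements completes \<open>f\<close> to a permutation of
      all coordinates.\<close>
    have "card (- E) = card (- F)" using E(2) by (simp add: Compl_eq_Diff_UNIV card_Diff_subset)
    then obtain h where h: "bij_betw h (- E) (- F)" using finite_same_card_bij[of "- E" "- F"] by auto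
    define \<rho> where "\<rho> i = (if i \<in> E then f i else h i)" for i
    have "bij_betw \<rho> E F" "bij_betw \<rho> (- E) (- F)"
      using f h bij_betw_cong[of E \<rho> f F] bij_betw_cong[of "- E" \<rho> h "- F"] by (auto simp: \<rho>_def)
    then have \<rho>: "\<rho> ` E = F" "\<rho> ` (- E) = - F" and "bij_betw \<rho> (E \<union> - E) (F \<union> - F)"
      using bij_betw_combine[of \<rho> E F "- E" "- F"] by (simp_all add: bij_betw_imp_surj_on)
    then have "bij \<rho>" by simp
    have \<rho>_iff: "\<rho> i \<in> F \<longleftrightarrow> i \<in> E" for i using \<rho> by blast
    define \<pi> where "\<pi> = map_sum \<rho> \<rho>"
    have "inv_into UNIV \<rho> \<circ> \<rho> = id" "\<rho> \<circ> inv_into UNIV \<rho> = id"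
      using \<open>bij \<rho>\<close> by (simp_all add: fun_eq_iff bij_is_inj bij_is_surj surj_f_inv_f)
    then have "bij \<pi>"
      by (intro o_bij[of "map_sum (inv_into UNIV \<rho>) (inv_into UNIV \<rho>)"])
        (simp_all add: \<pi>_def map_sum.comp sum.map_id0)
    moreover have "\<pi> (opp a) = opp (\<pi> a)" for a by (cases a) (simp_all add: \<pi>_def)
    moreover have "sig_fun F (\<pi> a) = sig_fun E a" for a
      by (cases a) (simp_all add: \<pi>_def sig_fun_def \<rho>_iff)
    ultimately show "x \<in> (\<lambda>m. matrix_inv m ** diag (sig_fun F) ** m) ` mat_normalizer Sp_complex C_torus"
      using orbit_permute[of \<pi> "sig_fun F"] by (simp add: E(1))
  qed
  also have "card \<dots> = card R"
  proof (intro card_image inj_onI)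
    fix E E' :: "'n set" assume "diag (sig_fun E) = diag (sig_fun E')"
    then have "sig_fun E (Inl i) = sig_fun E' (Inl i)" for i by simp
    then have "i \<in> E \<longleftrightarrow> i \<in> E'" for i
      unfolding sig_fun_def lies_over_simps by (metis one_neq_neg_one)
    then show "E = E'" by blast
  qed
  also have "\<dots> = CARD('n) choose card F" unfolding R_def by (rule n_subsets) simp
  finally show ?thesis .
qed

lemma sig_matrix_eq: "sig_matrix F = diag (sig_fun F)"
  by (simp add: sig_matrix_def diag_def sig_fun_def vec_eq_iff)

theorem weyl_index_Sp_real_form:
  assumes T: "compact_cartan_subgroup (real_form sympl_J) T" "T \<subseteq> max_compact (sympl_J :: ('n::finite + 'n) cmat)"
  shows "weyl_index Sp_complex (max_compact sympl_J) T = 2 ^ CARD('n)"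
proof -
  have "quaternionic (sympl_J :: ('n + 'n) cmat)"
    by (auto simp: quaternionic_def sympl_J_nth mult.assoc[symmetric])
  then obtain g s where g: "g \<in> Sp_compact" and s: "sympl_J = conjugate g (diag s)"
    and TT: "T = conjugate g ` U_torus" "complex_torus T = conjugate g ` C_torus"
    by (rule compact_cartan_subgroup_conjugate[OF T]) simp_all
  have u: "g \<in> unitary_group" using g by (rule Sp_compact_unitary)
  have ds: "diag s = conjugate (conj_transpose g) sympl_J" using u by (simp add: s conjugate_cancel)
  have "quaternionic (diag s)"
    unfolding ds using g Sp_compact_inverse(1) \<open>quaternionic sympl_J\<close> by (intro quaternionic_conjugate)
  then have q: "s (opp a) = cnj (s a)" for a by (simp add: quaternionic_diag)
  have "conjugate g (diag s ** diag s) = - mat 1"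
    using u by (simp add: conjugate_mult s[symmetric])
  also have "\<dots> = conjugate g (- mat 1)" using u by (simp add: conjugate_minus)
  finally have "diag s ** diag s = - mat 1" using inj_conjugate[OF u] by (simp add: inj_eq)
  then have "(diag s ** diag s) $ a $ a = (- mat 1) $ a $ a" for a by simp
  then have sq: "s a * s a = - 1" for a by (simp add: diag_mult diag_nth mat_def)
  \<comment> \<open>A quaternionic diagonal matrix has conjugate entries on a pair, and for these
    two values conjugation is negation.\<close>
  have "s a = \<i> \<or> s a = - \<i>" for a using sq by (simp add: square_eq_minus_one)
  then have "s (opp a) = - s a" for a unfolding q by (metis complex_cnj_i complex_cnj_minus)
  with sq show ?thesis using weyl_index_Sp_complex[OF g s TT] card_orbit_skew[of s] by simp
qed

theorem weyl_index_Sp_pq_form: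
  assumes T: "compact_cartan_subgroup (real_form (sig_matrix S)) T" "T \<subseteq> max_compact (sig_matrix S :: ('n::finite + 'n) cmat)"
  shows "weyl_index Sp_complex (max_compact (sig_matrix S)) T = CARD('n) choose card S"
proof -
  have quat: "quaternionic (sig_matrix S)"
    by (simp add: sig_matrix_eq quaternionic_diag sig_fun_def)
  have herm: "conj_transpose (sig_matrix S) = sig_matrix S"
    by (simp add: sig_matrix_eq conj_transpose_diag fun_eq_iff sig_fun_def)
  obtain g s where g: "g \<in> Sp_compact" and s: "sig_matrix S = conjugate g (diag s)"
    and TT: "T = conjugate g ` U_torus" "complex_torus T = conjugate g ` C_torus"
    using quat herm by (rule compact_cartan_subgroup_conjugate[OF T _ disjI1])
  have u: "g \<in> unitary_group" using g by (rule Sp_compact_unitary)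
  have ds: "diag s = conjugate (conj_transpose g) (sig_matrix S)" using u by (simp add: s conjugate_cancel)
  have "quaternionic (diag s)"
    unfolding ds using g Sp_compact_inverse(1) quat by (intro quaternionic_conjugate)
  then have q: "s (opp a) = cnj (s a)" for a by (simp add: quaternionic_diag)
  have "conjugate g (diag s ** diag s) = sig_matrix S ** sig_matrix S"
    using u by (simp add: conjugate_mult s[symmetric])
  also have "\<dots> = mat 1"
    by (simp add: sig_matrix_eq diag_mult mat_eq_diag fun_eq_iff sig_fun_def)
  also have "\<dots> = conjugate g (mat 1)" using u by simp
  finally have "diag s ** diag s = mat 1" using inj_conjugate[OF u] by (simp add: inj_eq)
  then have sq: "s a * s a = 1" for a by (simp add: diag_mult mat_eq_diag fun_eq_iff)
  have "s a = 1 \<or> s a = - 1" for a using sq square_eq_iff[of "s a" 1] by simp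
  then have "s (opp a) = s a" for a unfolding q by (metis complex_cnj_one complex_cnj_minus)
  with sq have sF: "s = sig_fun {i. s (Inl i) = 1}" by (intro sig_fun_cases)
  define F where "F = {i. s (Inl i) = 1}"
  \<comment> \<open>The diagonal form could a priori belong to another signature; comparing traces
    shows that it has as many plus signs as \<open>S\<close> prescribes.\<close>
  have "trace (sig_matrix S) = trace (conj_transpose g ** (g ** diag s))"
    unfolding s conjugate_def by (rule trace_mul_sym)
  also have "\<dots> = trace (diag s)" using g by (simp add: matrix_mul_assoc Sp_compact_inverse)
  finally have "(\<Sum>a\<in>UNIV. sig_fun S a) = (\<Sum>a\<in>UNIV. sig_fun F a)"
    using sF by (simp add: sig_matrix_eq trace_diag F_def)
  then have "of_nat (card S) = (of_nat (card F) :: complex)" by (simp add: sum_sig_fun)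
  then have "card S = card F" by simp
  then show ?thesis
    using weyl_index_Sp_complex[OF g s TT] card_orbit_sig[of F] sF by (simp add: F_def)
qed

subsection \<open>The real forms and their maximal compact subgroups\<close>

text \<open>For a symplectic \<open>g\<close> the relation of the real form says that its conjugate
  transpose and its transpose have the same product with \<open>sympl_J ** g\<close>. That factor is
  invertible, so the two agree and the entries are real.\<close>

lemma Sp_real_eq: "Sp_real = (real_form sympl_J :: ('n::finite + 'n) cmat set)"
proof (intro equalityI subsetI)
  fix g :: "('n + 'n) cmat" assume g: "g \<in> Sp_real"
  then have "conj_transpose g = transpose g"
    by (simp add: Sp_real_def vec_eq_iff conj_transpose_def transpose_def Reals_cnj_iff)
  with g show "g \<in> real_form sympl_J" by (simp add: Sp_real_def real_form_def Sp_complex_def)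
next
  fix g :: "('n + 'n) cmat" assume g: "g \<in> real_form sympl_J"
  then have "g \<in> Sp_complex" and eq: "conj_transpose g ** sympl_J ** g = transpose g ** sympl_J ** g"
    by (simp_all add: real_form_def Sp_complex_def)
  then obtain h where "g ** h = mat 1" by (auto elim: Sp_complex_inverse)
  with eq have "conj_transpose g ** sympl_J = transpose g ** sympl_J"
    by (simp add: matrix_right_cancel)
  moreover have "sympl_J ** (- sympl_J :: ('n + 'n) cmat) = mat 1" by (simp add: matrix_minus_right)
  ultimately have "conj_transpose g = transpose g" by (simp add: matrix_right_cancel)
  then have "conj_transpose g $ b $ a = transpose g $ b $ a" for a b by simp
  with g show "g \<in> Sp_real"
    by (simp add: Sp_real_def real_form_def conj_transpose_def transpose_def Reals_cnj_iff)
qed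

lemma realify_nth [simp]:
  "realify u $ Inl i $ Inl k = of_real (Re (u $ i $ k))" "realify u $ Inl i $ Inr k = of_real (Im (u $ i $ k))"
  "realify u $ Inr i $ Inl k = - of_real (Im (u $ i $ k))" "realify u $ Inr i $ Inr k = of_real (Re (u $ i $ k))"
  by (simp_all add: realify_def)

lemma sum_type_vec_eq_iff:
  "(A :: ('a, 'n::finite + 'n) vec) = B \<longleftrightarrow> (\<forall>i. A $ Inl i = B $ Inl i) \<and> (\<forall>i. A $ Inr i = B $ Inr i)"
  unfolding vec_eq_iff by (metis sum.exhaust)

lemma realify_mult: "realify u ** realify v = realify (u ** v)"
  by (simp add: sum_type_vec_eq_iff matrix_matrix_mult_def sum_UNIV_sum sum.distrib sum_subtractf sum_negf
      algebra_simps)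

lemma conj_transpose_realify: "conj_transpose (realify u) = realify (conj_transpose u)"
  by (simp add: sum_type_vec_eq_iff conj_transpose_def)

lemma realify_one: "realify (mat 1) = mat 1"
  by (simp add: sum_type_vec_eq_iff mat_def)

lemma realify_eq_iff: "realify u = realify v \<longleftrightarrow> u = v"
  by (auto simp: sum_type_vec_eq_iff) (simp add: vec_eq_iff complex_eq_iff)

lemma realify_unitary_iff: "realify u \<in> unitary_group \<longleftrightarrow> u \<in> unitary_group"
  by (simp add: unitary_group_def conj_transpose_realify realify_mult flip: realify_one) (simp add: realify_eq_iff)

lemma commute_sympl_J_iff:
  fixes A :: "('n::finite + 'n) cmat"
  shows "A ** sympl_J = sympl_J ** A \<longleftrightarrow> (\<forall>a b. A $ opp a $ opp b = opp_sgn a * opp_sgn b * A $ a $ b)"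
proof -
  have "A ** sympl_J = sympl_J ** A \<longleftrightarrow> (\<forall>a b. - (opp_sgn b * A $ a $ opp b) = opp_sgn a * A $ opp a $ b)"
    by (simp add: vec_eq_iff sympl_J_mult_nth mult_sympl_J_nth)
  also have "\<dots> \<longleftrightarrow> (\<forall>a b. opp_sgn b * A $ a $ b = opp_sgn a * A $ opp a $ opp b)"
    by (subst (2) all_opp) simp
  also have "\<dots> \<longleftrightarrow> (\<forall>a b. A $ opp a $ opp b = opp_sgn a * opp_sgn b * A $ a $ b)"
  proof -
    have *: "opp_sgn b * y = opp_sgn a * x \<longleftrightarrow> x = opp_sgn a * opp_sgn b * y" for a b :: "'n + 'n" and x y
      by (cases a; cases b) (auto simp: equation_minus_iff)
    show ?thesis by (intro iff_allI) (rule *)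
  qed
  finally show ?thesis .
qed

lemma realify_props: "realify u ** sympl_J = sympl_J ** realify u" "quaternionic (realify u)"
proof -
  have "realify u $ opp a $ opp b = opp_sgn a * opp_sgn b * realify u $ a $ b"
    "cnj (realify u $ a $ b) = realify u $ a $ b" for a b
    by (cases a; cases b; simp)+
  then show "realify u ** sympl_J = sympl_J ** realify u" "quaternionic (realify u)"
    by (simp_all add: commute_sympl_J_iff quaternionic_def)
qed

text \<open>The quaternionic condition and commutation with J differ only by a complex conjugation,
  so together they make the entries real. Commutation then leaves exactly the block form of
  \<open>realify\<close>.\<close>

lemma U_in_Sp_eq: "U_in_Sp = (max_compact sympl_J :: ('n::finite + 'n) cmat set)"
proof (intro equalityI subsetI)
  fix k :: "('n + 'n) cmat" assume "k \<in> U_in_Sp"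
  then obtain u where u: "k = realify u" "u \<in> unitary_group" by (auto simp: U_in_Sp_def)
  then show "k \<in> max_compact sympl_J"
    using realify_props[of u] by (auto simp: max_compact_def realify_unitary_iff intro: unitary_quaternionic_in_Sp_compact)
next
  fix k :: "('n + 'n) cmat" assume k: "k \<in> max_compact sympl_J"
  then have J: "k $ opp a $ opp b = opp_sgn a * opp_sgn b * k $ a $ b" for a b
    by (simp add: max_compact_def commute_sympl_J_iff)
  have "quaternionic k" using k by (simp add: max_compact_def Sp_compact_quaternionic)
  then have "opp_sgn a * opp_sgn b * cnj (k $ a $ b) = opp_sgn a * opp_sgn b * k $ a $ b" for a b
    unfolding quaternionic_def J[symmetric] by simp
  then have real: "cnj (k $ a $ b) = k $ a $ b" for a b by simp
  then have re: "of_real (Re (k $ a $ b)) = k $ a $ b" for a b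
    by (metis Reals_cnj_iff of_real_Re)
  define u where "u = (\<chi> i j. Complex (Re (k $ Inl i $ Inl j)) (Re (k $ Inl i $ Inr j)))"
  have "k $ Inr i $ Inl j = - k $ Inl i $ Inr j" "k $ Inr i $ Inr j = k $ Inl i $ Inl j" for i j
    using J[of "Inl i" "Inl j"] J[of "Inl i" "Inr j"] by simp_all
  then have "k = realify u"
    by (simp add: sum_type_vec_eq_iff u_def re)
  moreover have "u \<in> unitary_group"
  proof -
    have "k \<in> unitary_group" using k by (simp add: max_compact_def Sp_compact_unitary)
    then show ?thesis by (simp only: \<open>k = realify u\<close> realify_unitary_iff)
  qed
  ultimately show "k \<in> U_in_Sp" by (simp add: U_in_Sp_def)
qed

section \<open>The product of two compact symplectic groups as a centralizer\<close>

lemma Sp_pq_eq: "Sp_pq S = real_form (sig_matrix S)"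
  by (simp add: Sp_pq_def real_form_def)

lemma commute_sig_matrix_iff:
  "A ** sig_matrix S = sig_matrix S ** A \<longleftrightarrow> (\<forall>a b. A $ a $ b \<noteq> 0 \<longrightarrow> lies_over a S = lies_over b S)"
proof -
  have "A ** sig_matrix S = sig_matrix S ** A \<longleftrightarrow> (\<forall>a b. A $ a $ b * sig_fun S b = sig_fun S a * A $ a $ b)"
    by (simp add: sig_matrix_eq vec_eq_iff mult_diag_nth diag_mult_nth)
  also have "\<dots> \<longleftrightarrow> (\<forall>a b. A $ a $ b \<noteq> 0 \<longrightarrow> lies_over a S = lies_over b S)"
  proof -
    have *: "x * sig_fun S b = sig_fun S a * x \<longleftrightarrow> (x \<noteq> 0 \<longrightarrow> lies_over a S = lies_over b S)" for x a b
      by (auto simp: sig_fun_def eq_neg_iff_add_eq_0 neg_eq_iff_add_eq_0)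
    show ?thesis by (intro iff_allI) (rule *)
  qed
  finally show ?thesis .
qed

lemma sig_matrix_Compl: "sig_matrix (- S) = - sig_matrix S"
proof -
  have "lies_over a (- S) \<longleftrightarrow> \<not> lies_over a S" for a :: "'a + 'a" by (cases a) simp_all
  then show ?thesis by (simp add: sig_matrix_def vec_eq_iff)
qed

lemma max_compact_sig_Compl: "max_compact (sig_matrix (- S)) = max_compact (sig_matrix S)"
  by (auto simp: max_compact_def sig_matrix_Compl matrix_minus_left matrix_minus_right)

lemma Sp_compact_on_subset: "Sp_compact_on S \<subseteq> max_compact (sig_matrix S)"
proof
  fix g :: "('a + 'a) cmat" assume g: "g \<in> Sp_compact_on S"
  have "lies_over a S = lies_over b S" if nz: "g $ a $ b \<noteq> 0" for a b
  proof (rule ccontr)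
    assume ab: "lies_over a S \<noteq> lies_over b S"
    then have "g $ a $ b = (mat 1 :: ('a + 'a) cmat) $ a $ b" using g by (auto simp: Sp_compact_on_def)
    also have "\<dots> = 0" using ab by (auto simp: mat_def)
    finally show False using nz by simp
  qed
  then have "g ** sig_matrix S = sig_matrix S ** g" unfolding commute_sig_matrix_iff by blast
  moreover have "g \<in> Sp_compact" using g by (simp only: Sp_compact_on_def Sp_compact_def mem_Collect_eq)
  ultimately show "g \<in> max_compact (sig_matrix S)" by (simp only: max_compact_def mem_Collect_eq)
qed

text \<open>Replacing columns suffices to cut out a factor: when \<open>x\<close> is block diagonal,
  this keeps the block over \<open>S\<close> and puts an identity block elsewhere.\<close>

definition restrict_to :: "'n set \<Rightarrow> ('n::finite + 'n) cmat \<Rightarrow> ('n + 'n) cmat" where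
  "restrict_to S x = (\<chi> a b. if lies_over b S then x $ a $ b else if a = b then 1 else 0)"

text \<open>Unitarity is checked on columns: the kept ones are orthonormal, the others are standard
  basis vectors, and a mixed product is, up to conjugation, an entry of \<open>x\<close> outside the
  blocks.\<close>

lemma restrict_to_in_Sp_compact_on:
  assumes x: "x \<in> max_compact (sig_matrix S)"
  shows "restrict_to S x \<in> Sp_compact_on S"
proof -
  have block: "x $ a $ b = 0" if "lies_over a S \<noteq> lies_over b S" for a b
    using x that by (auto simp: max_compact_def commute_sig_matrix_iff)
  have xU: "x \<in> Sp_compact" using x by (simp add: max_compact_def)
  have col: "column b (restrict_to S x) = (if lies_over b S then column b x else axis b 1)" for b
    by (simp add: column_def restrict_to_def vec_eq_iff axis_def)
  have orth: "herm_inner (column b x) (column c x) = (if b = c then 1 else 0)" for b c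
    using Sp_compact_inverse(3)[OF xU] by (simp add: matrix_mul_nth_herm_inner[symmetric] mat_def)
  have ax: "herm_inner y (axis b 1) = cnj (y $ b)" "herm_inner (axis b 1) y = y $ b" for y and b :: "'a + 'a"
    by (simp_all add: herm_inner_def axis_def if_distrib if_distribR cong: if_cong)
  have "herm_inner (column b (restrict_to S x)) (column c (restrict_to S x)) = (if b = c then 1 else 0)" for b c
    unfolding col using block[of b c] block[of c b]
    by (auto simp: orth ax) (auto simp: column_def axis_def)
  then have "restrict_to S x \<in> unitary_group"
    by (simp add: unitary_group_def vec_eq_iff matrix_mul_nth_herm_inner) (simp add: mat_def)
  moreover have "quaternionic (restrict_to S x)"
  proof -
    have "quaternionic x" using xU by (rule Sp_compact_quaternionic)
    then show ?thesis by (auto simp: quaternionic_def restrict_to_def)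
  qed
  ultimately have "restrict_to S x \<in> Sp_compact" by (rule unitary_quaternionic_in_Sp_compact)
  then show ?thesis
    unfolding Sp_compact_on_def Sp_compact_def
  proof (intro CollectI conjI allI impI)
    fix a b assume "\<not> (lies_over a S \<and> lies_over b S)"
    then show "restrict_to S x $ a $ b = (mat 1 :: ('a + 'a) cmat) $ a $ b"
      using block[of a b] by (auto simp: restrict_to_def mat_def)
  qed
qed

lemma restrict_to_mult:
  assumes x: "x \<in> max_compact (sig_matrix S)"
  shows "restrict_to S x ** restrict_to (- S) x = x"
proof -
  have block: "x $ a $ b = 0" if "lies_over a S \<noteq> lies_over b S" for a b
    using x that by (auto simp: max_compact_def commute_sig_matrix_iff)
  have Compl: "lies_over a (- S) \<longleftrightarrow> \<not> lies_over a S" for a :: "'a + 'a" by (cases a) simp_all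
  have "(restrict_to S x ** restrict_to (- S) x) $ a $ c = x $ a $ c" for a c
  proof (cases "lies_over c S")
    case True
    have "(restrict_to S x ** restrict_to (- S) x) $ a $ c = (\<Sum>b\<in>UNIV. if b = c then x $ a $ c else 0)"
      unfolding matrix_matrix_mult_def vec_lambda_beta using True
      by (intro sum.cong refl) (auto simp: restrict_to_def Compl)
    then show ?thesis by simp
  next
    case False
    have "(restrict_to S x ** restrict_to (- S) x) $ a $ c = (\<Sum>b\<in>UNIV. if b = a then x $ a $ c else 0)"
      unfolding matrix_matrix_mult_def vec_lambda_beta using False block[of _ c]
      by (intro sum.cong refl) (auto simp: restrict_to_def Compl)
    then show ?thesis by simp
  qed
  then show ?thesis by (simp add: vec_eq_iff)
qed

lemma Sp_times_Sp_eq: "Sp_times_Sp S = max_compact (sig_matrix S)"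
proof (intro equalityI subsetI)
  fix x assume "x \<in> Sp_times_Sp S"
  then obtain g h where gh: "x = g ** h" "g \<in> Sp_compact_on S" "h \<in> Sp_compact_on (- S)"
    by (auto simp: Sp_times_Sp_def)
  then have "g \<in> max_compact (sig_matrix S)" "h \<in> max_compact (sig_matrix S)"
    using Sp_compact_on_subset[of S] Sp_compact_on_subset[of "- S"] by (auto simp: max_compact_sig_Compl)
  then show "x \<in> max_compact (sig_matrix S)"
    unfolding gh(1) by (rule matrix_group_mult[OF matrix_group_max_compact])
next
  fix x assume x: "x \<in> max_compact (sig_matrix S)"
  then have "x \<in> max_compact (sig_matrix (- S))" by (simp add: max_compact_sig_Compl)
  then have "restrict_to (- S) x \<in> Sp_compact_on (- S)" by (rule restrict_to_in_Sp_compact_on)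
  with restrict_to_in_Sp_compact_on[OF x] restrict_to_mult[OF x, symmetric]
  show "x \<in> Sp_times_Sp S" unfolding Sp_times_Sp_def by blast
qed

section \<open>Dimension of the noncompact part of the Lie algebra\<close>

lemma dim_eq_card_dual_basis:
  fixes V :: "'a::euclidean_space set" and c :: "'i \<Rightarrow> 'a \<Rightarrow> real"
  assumes V: "subspace V" and I: "finite I" and M: "\<And>i. i \<in> I \<Longrightarrow> M i \<in> V"
    and c: "\<And>i. i \<in> I \<Longrightarrow> linear (c i)"
    and dual: "\<And>i k. i \<in> I \<Longrightarrow> k \<in> I \<Longrightarrow> c i (M k) = (if i = k then 1 else 0)"
    and sep: "\<And>x. x \<in> V \<Longrightarrow> (\<And>i. i \<in> I \<Longrightarrow> c i x = 0) \<Longrightarrow> x = 0"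
  shows "dim V = card I"
proof -
  have inj: "inj_on M I"
    by (rule inj_onI) (metis dual zero_neq_one)
  have coord: "c k (\<Sum>i\<in>I. f i *\<^sub>R M i) = f k" if k: "k \<in> I" for f k
  proof -
    interpret linear "c k" by (rule c[OF k])
    have "c k (\<Sum>i\<in>I. f i *\<^sub>R M i) = (\<Sum>i\<in>I. f i * c k (M i))" by (simp add: sum scaleR)
    also have "\<dots> = (\<Sum>i\<in>I. if i = k then f k else 0)" using k by (intro sum.cong refl) (auto simp: dual)
    finally show ?thesis using I k by simp
  qed
  have "independent (M ` I)"
  proof (rule independent_if_scalars_zero)
    fix f x assume s: "(\<Sum>x\<in>M ` I. f x *\<^sub>R x) = 0" and "x \<in> M ` I"
    then obtain k where k: "k \<in> I" "x = M k" by blast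
    have "(\<Sum>i\<in>I. f (M i) *\<^sub>R M i) = 0" using s by (simp add: sum.reindex[OF inj] o_def)
    then have "c k 0 = f x" using coord[OF k(1), of "\<lambda>i. f (M i)"] k(2) by simp
    then show "f x = 0" using linear_0[OF c[OF k(1)]] by simp
  qed (use I in simp)
  moreover have "V \<subseteq> span (M ` I)"
  proof
    fix x assume x: "x \<in> V"
    \<comment> \<open>The expected expansion of \<open>x\<close>. Its difference from
      \<open>x\<close> is annihilated by all functionals \<open>c i\<close>, so \<open>sep\<close>
      makes it zero.\<close>
    define y where "y = (\<Sum>i\<in>I. c i x *\<^sub>R M i)"
    have "y \<in> V" unfolding y_def using V M by (intro subspace_sum subspace_scale) auto
    have "x - y = 0"
    proof (rule sep)
      show "x - y \<in> V" using V x \<open>y \<in> V\<close> by (rule subspace_diff)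
      fix i assume i: "i \<in> I"
      show "c i (x - y) = 0" using coord[OF i] linear_diff[OF c[OF i]] by (simp add: y_def)
    qed
    then have "x = y" by simp
    also have "y \<in> span (M ` I)" unfolding y_def by (intro span_sum span_scale span_base) auto
    finally show "x \<in> span (M ` I)" .
  qed
  ultimately have "dim V = card (M ` I)" using M by (intro dim_unique) auto
  then show ?thesis using card_image[OF inj] by simp
qed

definition hermitian_part :: "('n::finite + 'n) cmat \<Rightarrow> ('n + 'n) cmat set" where
  "hermitian_part \<sigma> = {X \<in> lie_algebra (real_form \<sigma>). conj_transpose X = X}"

lemma subspace_lie_algebra_real_form: "subspace (lie_algebra (real_form \<sigma>))"
proof -
  have l: "linear (\<lambda>X. transpose X ** sympl_J + sympl_J ** X)" "linear (\<lambda>X. conj_transpose X ** \<sigma> + \<sigma> ** X)"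
    by (intro linear_compose_add bounded_linear.linear[OF bounded_linear_compose[OF matrix_mult.bounded_linear_left]]
        bounded_linear.linear[OF matrix_mult.bounded_linear_right] bounded_linear_transpose bounded_linear_conj_transpose)+
  show ?thesis
    using subspace_inter[OF linear_subspace_kernel[OF l(1)] linear_subspace_kernel[OF l(2)]]
    by (simp add: lie_algebra_real_form Collect_conj_eq)
qed

lemma lie_algebra_max_compact_skew:
  "lie_algebra (max_compact \<sigma>) = {X \<in> lie_algebra (real_form \<sigma>). conj_transpose X = - X}"
proof -
  have "X ** \<sigma> = \<sigma> ** X \<longleftrightarrow> conj_transpose X ** \<sigma> + \<sigma> ** X = 0" if "conj_transpose X = - X" for X
    using that by (auto simp: matrix_minus_left)
  then show ?thesis
    unfolding lie_algebra_max_compact lie_algebra_real_form using skew_sympl_iff_quaternionic by blast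
qed

text \<open>Transposition permutes the entries, and complex conjugation preserves the real inner
  product on C. The orthogonality of Hermitian and skew-Hermitian matrices rests on this.\<close>

lemma inner_conj_transpose: "conj_transpose X \<bullet> conj_transpose Y = X \<bullet> (Y :: 'm::finite cmat)"
proof -
  have "conj_transpose X \<bullet> conj_transpose Y = (\<Sum>a\<in>UNIV. \<Sum>b\<in>UNIV. X $ b $ a \<bullet> Y $ b $ a)"
    by (simp add: inner_vec_def conj_transpose_def inner_complex_def)
  also have "\<dots> = X \<bullet> Y" by (subst sum.swap) (simp add: inner_vec_def)
  finally show ?thesis .
qed

lemma conj_transpose_zero: "conj_transpose 0 = (0 :: 'm::finite cmat)"
  by (simp add: conj_transpose_def vec_eq_iff)

text \<open>Up to sign this is the Cartan involution. Each defining relation is multiplied on both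
  sides by its matrix, J or \<sigma>, whose square is a nonzero scalar that can be
  cancelled.\<close>

lemma conj_transpose_in_lie_algebra:
  assumes X: "X \<in> lie_algebra (real_form \<sigma>)" and \<sigma>: "\<sigma> ** \<sigma> = mat c" "c \<noteq> 0"
  shows "conj_transpose X \<in> lie_algebra (real_form \<sigma>)"
proof -
  have 1: "transpose X ** sympl_J + sympl_J ** X = 0" and 2: "conj_transpose X ** \<sigma> + \<sigma> ** X = 0"
    using X by (simp_all add: lie_algebra_real_form)
  have "conj_transpose (transpose X) ** sympl_J + sympl_J ** conj_transpose X = 0"
  proof -
    have "conj_transpose (transpose X ** sympl_J + sympl_J ** X) = conj_transpose 0" using 1 by simp
    then have "sympl_J ** conj_transpose (transpose X) = - (conj_transpose X ** sympl_J)"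
      by (simp add: conj_transpose_add conj_transpose_mul matrix_minus_left matrix_minus_right
          conj_transpose_zero minus_equation_iff eq_neg_iff_add_eq_0 add.commute)
    then have "sympl_J ** (sympl_J ** conj_transpose (transpose X)) ** sympl_J
        = sympl_J ** (- (conj_transpose X ** sympl_J)) ** sympl_J" by simp
    also have "\<dots> = - (sympl_J ** conj_transpose X ** (sympl_J ** sympl_J))"
      by (simp only: matrix_minus_left matrix_minus_right matrix_mul_assoc)
    also have "\<dots> = sympl_J ** conj_transpose X" by (simp add: matrix_minus_right)
    finally have "- (conj_transpose (transpose X) ** sympl_J) = sympl_J ** conj_transpose X"
      by (simp add: matrix_mul_assoc matrix_minus_left)
    then show ?thesis by (metis add.right_inverse)
  qed
  moreover have "transpose (conj_transpose X) = conj_transpose (transpose X)"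
    by (simp add: vec_eq_iff transpose_def conj_transpose_def)
  moreover have "X ** \<sigma> + \<sigma> ** conj_transpose X = 0"
  proof -
    have "0 = \<sigma> ** (conj_transpose X ** \<sigma> + \<sigma> ** X) ** \<sigma>" by (simp add: 2 matrix_mult.zero_left matrix_mult.zero_right)
    also have "\<dots> = \<sigma> ** conj_transpose X ** (\<sigma> ** \<sigma>) + (\<sigma> ** \<sigma>) ** X ** \<sigma>"
      by (simp add: matrix_mult.add_left matrix_mult.add_right matrix_mul_assoc)
    also have "\<dots> = mat c ** (\<sigma> ** conj_transpose X + X ** \<sigma>)"
      by (simp add: \<sigma>(1) mat_commute[symmetric] matrix_mult.add_right matrix_mul_assoc)
    finally have "c * (\<sigma> ** conj_transpose X + X ** \<sigma>) $ a $ b = 0" for a b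
      by (metis mat_mult_nth zero_index)
    then have "\<sigma> ** conj_transpose X + X ** \<sigma> = 0" using \<sigma>(2) by (simp add: vec_eq_iff)
    then show ?thesis by (simp add: add.commute)
  qed
  ultimately show ?thesis by (simp add: lie_algebra_real_form)
qed

lemma dim_lie_algebra_real_form:
  assumes \<sigma>: "\<sigma> ** \<sigma> = mat c" "c \<noteq> 0"
  shows "dim (lie_algebra (real_form \<sigma>)) = dim (lie_algebra (max_compact \<sigma>)) + dim (hermitian_part \<sigma>)"
proof -
  let ?G = "lie_algebra (real_form \<sigma>)" and ?K = "lie_algebra (max_compact \<sigma>)"
  have "linear (\<lambda>X :: ('a + 'a) cmat. conj_transpose X + X)"
    by (intro linear_compose_add bounded_linear.linear[OF bounded_linear_conj_transpose] linear_ident)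
  from subspace_inter[OF subspace_lie_algebra_real_form linear_subspace_kernel[OF this], of \<sigma>]
  have K: "subspace ?K" unfolding lie_algebra_max_compact_skew by (simp add: Int_def eq_neg_iff_add_eq_0)
  have sub: "?K \<subseteq> ?G" unfolding lie_algebra_max_compact_skew by blast
  have "{Y \<in> ?G. \<forall>X\<in>?K. orthogonal X Y} = hermitian_part \<sigma>"
  proof (intro equalityI subsetI)
    fix Y assume Y: "Y \<in> {Y \<in> ?G. \<forall>X\<in>?K. orthogonal X Y}"
    \<comment> \<open>\<open>Z\<close> lies in the Lie algebra of K, hence is orthogonal to
      \<open>Y\<close> and, by the isometry, to its conjugate transpose. Being their difference,
      \<open>Z\<close> is orthogonal to itself and vanishes.\<close>
    define Z where "Z = Y - conj_transpose Y"
    have skew: "conj_transpose Z = - Z" by (simp add: Z_def conj_transpose_diff)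
    have "Z \<in> ?G" unfolding Z_def
      using Y conj_transpose_in_lie_algebra[OF _ \<sigma>] by (intro subspace_diff subspace_lie_algebra_real_form) auto
    then have "Z \<in> ?K" using skew by (simp add: lie_algebra_max_compact_skew)
    then have "Z \<bullet> Y = 0" using Y by (simp add: orthogonal_def)
    moreover have "Z \<bullet> conj_transpose Y = - (Z \<bullet> Y)"
      using inner_conj_transpose[of Z "conj_transpose Y"] by (simp add: skew)
    ultimately have "Z \<bullet> (Y - conj_transpose Y) = 0" by (simp add: inner_diff_right)
    then have "Z \<bullet> Z = 0" by (simp only: Z_def)
    then show "Y \<in> hermitian_part \<sigma>" using Y by (simp add: Z_def hermitian_part_def)
  next
    fix Y assume Y: "Y \<in> hermitian_part \<sigma>"
    have "orthogonal X Y" if "X \<in> ?K" for X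
    proof -
      have "X \<bullet> Y = - (X \<bullet> Y)"
        using inner_conj_transpose[of X Y] that Y by (simp add: lie_algebra_max_compact_skew hermitian_part_def)
      then show ?thesis by (simp add: orthogonal_def)
    qed
    then show "Y \<in> {Y \<in> ?G. \<forall>X\<in>?K. orthogonal X Y}" using Y by (simp add: hermitian_part_def)
  qed
  then show ?thesis
    using dim_subspace_orthogonal_to_vectors[OF K subspace_lie_algebra_real_form sub] by simp
qed

lemma subspace_hermitian_part: "subspace (hermitian_part \<sigma>)"
proof -
  have "linear (\<lambda>X :: ('a + 'a) cmat. conj_transpose X - X)"
    by (intro linear_compose_sub bounded_linear.linear[OF bounded_linear_conj_transpose] linear_ident)
  from subspace_inter[OF subspace_lie_algebra_real_form linear_subspace_kernel[OF this], of \<sigma>]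
  show ?thesis by (simp add: hermitian_part_def Int_def)
qed

text \<open>The transpose of a Hermitian matrix is its complex conjugate, so the sign is opposite to
  the skew-Hermitian case: here \<open>\<i>\<close> times \<open>X\<close> is quaternionic. The
  entrywise form shows which entries are free.\<close>

lemma hermitian_part_iff:
  fixes X :: "('n::finite + 'n) cmat"
  shows "X \<in> hermitian_part \<sigma> \<longleftrightarrow> (\<forall>a b. X $ b $ a = cnj (X $ a $ b)) \<and>
    (\<forall>a b. X $ opp a $ opp b = - (opp_sgn a * opp_sgn b * cnj (X $ a $ b))) \<and> X ** \<sigma> + \<sigma> ** X = 0"
proof -
  have herm: "conj_transpose X = X \<longleftrightarrow> (\<forall>a b. X $ b $ a = cnj (X $ a $ b))"
    by (simp only: conj_transpose_def vec_eq_iff vec_lambda_beta)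
      (intro iffI allI; drule spec, drule spec, erule sym)
  have "transpose X ** sympl_J + sympl_J ** X = 0 \<longleftrightarrow>
      (\<forall>a b. X $ opp a $ opp b = - (opp_sgn a * opp_sgn b * cnj (X $ a $ b)))"
    if h: "\<forall>a b. X $ b $ a = cnj (X $ a $ b)"
  proof -
    have "(transpose X ** sympl_J + sympl_J ** X) $ a $ opp b = opp_sgn b * cnj (X $ a $ b) + opp_sgn a * X $ opp a $ opp b" for a b
      using h[rule_format, of a b] by (simp add: sympl_J_mult_nth mult_sympl_J_nth transpose_def)
    then have "transpose X ** sympl_J + sympl_J ** X = 0 \<longleftrightarrow>
        (\<forall>a b. opp_sgn b * cnj (X $ a $ b) + opp_sgn a * X $ opp a $ opp b = 0)"
      unfolding vec_eq_iff zero_index by (subst (2) all_opp) (simp only:)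
    also have "\<dots> \<longleftrightarrow> (\<forall>a b. X $ opp a $ opp b = - (opp_sgn a * opp_sgn b * cnj (X $ a $ b)))"
    proof -
      have *: "opp_sgn b * y + opp_sgn a * x = 0 \<longleftrightarrow> x = - (opp_sgn a * opp_sgn b * y)" for a b :: "'n + 'n" and x y
        by (cases a; cases b) (auto simp: add_eq_0_iff equation_minus_iff)
      show ?thesis by (intro iff_allI) (rule *)
    qed
    finally show ?thesis .
  qed
  moreover have "X \<in> hermitian_part \<sigma> \<longleftrightarrow> conj_transpose X = X \<and>
      transpose X ** sympl_J + sympl_J ** X = 0 \<and> X ** \<sigma> + \<sigma> ** X = 0"
    unfolding hermitian_part_def lie_algebra_real_form by auto
  ultimately show ?thesis using herm by blast
qed

lemma anticommute_sympl_J_iff: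
  fixes X :: "('n::finite + 'n) cmat"
  shows "X ** sympl_J + sympl_J ** X = 0 \<longleftrightarrow> (\<forall>a b. X $ opp a $ opp b = - (opp_sgn a * opp_sgn b * X $ a $ b))"
proof -
  have "(X ** sympl_J + sympl_J ** X) $ a $ opp b = opp_sgn b * X $ a $ b + opp_sgn a * X $ opp a $ opp b" for a b
    by (simp add: sympl_J_mult_nth mult_sympl_J_nth)
  then have "X ** sympl_J + sympl_J ** X = 0 \<longleftrightarrow>
      (\<forall>a b. opp_sgn b * X $ a $ b + opp_sgn a * X $ opp a $ opp b = 0)"
    unfolding vec_eq_iff zero_index by (subst (2) all_opp) (simp only:)
  also have "\<dots> \<longleftrightarrow> (\<forall>a b. X $ opp a $ opp b = - (opp_sgn a * opp_sgn b * X $ a $ b))"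
  proof -
    have *: "opp_sgn b * y + opp_sgn a * x = 0 \<longleftrightarrow> x = - (opp_sgn a * opp_sgn b * y)" for a b :: "'n + 'n" and x y
      by (cases a; cases b) (auto simp: add_eq_0_iff equation_minus_iff)
    show ?thesis by (intro iff_allI) (rule *)
  qed
  finally show ?thesis .
qed

lemma linear_Re_nth: "linear (\<lambda>X :: ('m::finite) cmat. Re (X $ a $ b))"
  and linear_Im_nth: "linear (\<lambda>X :: ('m::finite) cmat. Im (X $ a $ b))"
  by (simp_all add: linear_iff)

text \<open>The unordered pairs of indices label the entries of a symmetric matrix; the Hermitian part of
  \<open>Sp(2n, R)\<close> consists of the real block matrices with rows \<open>(A, B)\<close> and \<open>(B, -A)\<close>, \<open>A\<close> and \<open>B\<close> symmetric.\<close>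

lemma dim_hermitian_part_sympl_J:
  "dim (hermitian_part (sympl_J :: ('n::finite + 'n) cmat)) = CARD('n) * (CARD('n) + 1)"
proof -
  \<comment> \<open>Sets with one or two elements are the unordered pairs with repetition, one for
    each position on or above the diagonal.\<close>
  define PS where "PS = {A :: 'n set. A \<subseteq> UNIV \<and> card A = 1} \<union> {A. A \<subseteq> UNIV \<and> card A = 2}"
  have "\<exists>i j. A = {i, j}" if "A \<in> PS" for A
    using that by (auto simp: PS_def card_1_singleton_iff card_2_iff)
  then obtain r s where rs: "\<And>A. A \<in> PS \<Longrightarrow> A = {r A, s A}" by metis
  have pair: "{i, j} \<in> PS" for i j :: 'n by (cases "i = j") (auto simp: PS_def)
  define idx :: "'n + 'n \<Rightarrow> 'n" where "idx = case_sum id id"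
  \<comment> \<open>With E the symmetric 0-1 matrix supported on the chosen pair, the flag
    \<open>False\<close> gives the blocks E and -E on the diagonal, and \<open>True\<close> gives E
    in both off-diagonal blocks.\<close>
  define M :: "'n set \<times> bool \<Rightarrow> ('n + 'n) cmat" where "M = (\<lambda>(A, \<beta>). \<chi> a b.
    if {idx a, idx b} = A then (if \<beta> then (if isl a = isl b then 0 else 1) else (if isl a = isl b then opp_sgn a else 0)) else 0)"
  define c :: "'n set \<times> bool \<Rightarrow> ('n + 'n) cmat \<Rightarrow> real" where
    "c = (\<lambda>(A, \<beta>) X. Re (X $ Inl (r A) $ (if \<beta> then Inr (s A) else Inl (s A))))"
  have "dim (hermitian_part (sympl_J :: ('n + 'n) cmat)) = card (PS \<times> (UNIV :: bool set))"
  proof (rule dim_eq_card_dual_basis[where M = M and c = c])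
    show "subspace (hermitian_part (sympl_J :: ('n + 'n) cmat))" by (rule subspace_hermitian_part)
  next
    fix k :: "'n set \<times> bool"
    obtain A \<beta> where k: "k = (A, \<beta>)" by (cases k)
    show "linear (c k)" unfolding k c_def prod.case by (rule linear_Re_nth)
    have *: "M k $ b $ a = M k $ a $ b" "cnj (M k $ a $ b) = M k $ a $ b"
      "M k $ opp a $ opp b = - (opp_sgn a * opp_sgn b * M k $ a $ b)" for a b
      unfolding k M_def by (cases a; cases b; simp add: idx_def insert_commute)+
    show "M k \<in> hermitian_part sympl_J"
      unfolding hermitian_part_iff anticommute_sympl_J_iff using * by simp
  next
    fix k l :: "'n set \<times> bool" assume kl: "k \<in> PS \<times> UNIV" "l \<in> PS \<times> UNIV"
    obtain A \<beta> B \<gamma> where k: "k = (A, \<beta>)" "l = (B, \<gamma>)" by (cases k; cases l)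
    have "{r A, s A} = A" using rs[of A] kl(1) k(1) by simp
    then show "c k (M l) = (if k = l then 1 else 0)"
      unfolding k c_def M_def by (cases \<beta>; cases \<gamma>) (simp_all add: idx_def)
  next
    fix X :: "('n + 'n) cmat" assume X: "X \<in> hermitian_part sympl_J"
      and c0: "\<And>k. k \<in> PS \<times> UNIV \<Longrightarrow> c k X = 0"
    have h: "X $ b $ a = cnj (X $ a $ b)" and o: "X $ opp a $ opp b = - (opp_sgn a * opp_sgn b * cnj (X $ a $ b))"
      and j: "X $ opp a $ opp b = - (opp_sgn a * opp_sgn b * X $ a $ b)" for a b
      using X unfolding hermitian_part_iff anticommute_sympl_J_iff by blast+
    have real: "cnj (X $ a $ b) = X $ a $ b" for a b
    proof -
      have "opp_sgn a * opp_sgn b * cnj (X $ a $ b) = opp_sgn a * opp_sgn b * X $ a $ b"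
        using o[of a b] j[of a b] by simp
      then show ?thesis by simp
    qed
    then have Im0: "Im (X $ a $ b) = 0" for a b by (metis Reals_cnj_iff complex_is_Real_iff)
    have sym1: "X $ Inl i $ Inl k = X $ Inl k $ Inl i" for i k using h real by metis
    have sym2: "X $ Inl i $ Inr k = X $ Inl k $ Inr i" for i k
      using j[of "Inl i" "Inr k"] h[of "Inl k" "Inr i"] real by simp
    have "Re (X $ Inl (r A) $ Inl (s A)) = 0" "Re (X $ Inl (r A) $ Inr (s A)) = 0" if "A \<in> PS" for A
      using c0[of "(A, False)"] c0[of "(A, True)"] that by (simp_all add: c_def)
    then have rs0: "X $ Inl (r A) $ Inl (s A) = 0" "X $ Inl (r A) $ Inr (s A) = 0" if "A \<in> PS" for A
      using that Im0 by (simp_all add: complex_eq_iff)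
    have top: "X $ Inl i $ Inl k = 0" "X $ Inl i $ Inr k = 0" for i k
    proof -
      \<comment> \<open>The choice of \<open>r\<close> and \<open>s\<close> orders the pair in an
        unspecified way; symmetry of both blocks covers the other order.\<close>
      have "(i = r {i, k} \<and> k = s {i, k}) \<or> (i = s {i, k} \<and> k = r {i, k})"
        using rs[OF pair[of i k]] unfolding doubleton_eq_iff .
      then show "X $ Inl i $ Inl k = 0" "X $ Inl i $ Inr k = 0"
        using rs0[OF pair[of i k]] sym1 sym2 by metis+
    qed
    have "X $ a $ b = 0" for a b
      using top j[of "opp a" "opp b"] by (cases a; cases b) simp_all
    then show "X = 0" by (simp add: vec_eq_iff)
  qed simp
  also have "\<dots> = 2 * card PS" by (simp add: card_cartesian_product)
  also have "card PS = CARD('n) + (CARD('n) choose 2)"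
    unfolding PS_def by (subst card_Un_disjoint) (auto simp: n_subsets[of UNIV, simplified])
  also have "2 * (CARD('n) + (CARD('n) choose 2)) = CARD('n) * (CARD('n) + 1)"
  proof -
    have "2 * (CARD('n) choose 2) = CARD('n) * (CARD('n) - 1)"
      by (simp add: choose_two)
    then show ?thesis by (cases "CARD('n)") (simp_all add: algebra_simps)
  qed
  finally show ?thesis .
qed

lemma anticommute_sig_matrix_iff:
  "X ** sig_matrix S + sig_matrix S ** X = 0 \<longleftrightarrow> (\<forall>a b. lies_over a S = lies_over b S \<longrightarrow> X $ a $ b = 0)"
proof -
  have "(X ** sig_matrix S + sig_matrix S ** X) $ a $ b = 0 \<longleftrightarrow> (lies_over a S = lies_over b S \<longrightarrow> X $ a $ b = 0)" for a b
    by (auto simp: sig_matrix_eq mult_diag_nth diag_mult_nth sig_fun_def)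
  then show ?thesis unfolding vec_eq_iff zero_index by (intro iff_allI)
qed

text \<open>The Hermitian part of \<open>sp(p, q)\<close> is parametrized by its quaternionic off-diagonal \<open>p \<times> q\<close> block;
  the basis arises by symmetrizing single entries of that block.\<close>

lemma dim_hermitian_part_sig_matrix:
  fixes S :: "'n::finite set"
  shows "dim (hermitian_part (sig_matrix S)) = 4 * card S * card (- S)"
proof -
  define Q where "Q = {b :: 'n + 'n. \<not> lies_over b S}"
  \<comment> \<open>Row \<open>Inl i\<close> over \<open>S\<close>, any of the 2q columns not over
    \<open>S\<close>, and real or imaginary part: 4pq labels. The rows \<open>Inr i\<close> follow
    by the quaternionic symmetry.\<close>
  define I where "I = S \<times> Q \<times> (UNIV :: bool set)"
  define E :: "'n \<times> ('n + 'n) \<times> bool \<Rightarrow> 'n + 'n \<Rightarrow> 'n + 'n \<Rightarrow> complex" where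
    "E = (\<lambda>(i, b, t) x y. if x = Inl i \<and> y = b then (if t then \<i> else 1) else 0)"
  \<comment> \<open>The single entry is summed over its images under the Hermitian symmetry, the
    quaternionic symmetry and their composition.\<close>
  define M :: "'n \<times> ('n + 'n) \<times> bool \<Rightarrow> ('n + 'n) cmat" where "M k = (\<chi> x y. E k x y + cnj (E k y x)
      - opp_sgn x * opp_sgn y * (cnj (E k (opp x) (opp y)) + E k (opp y) (opp x)))" for k
  define c :: "'n \<times> ('n + 'n) \<times> bool \<Rightarrow> ('n + 'n) cmat \<Rightarrow> real" where
    "c = (\<lambda>(i, b, t) X. if t then Im (X $ Inl i $ b) else Re (X $ Inl i $ b))"
  have "dim (hermitian_part (sig_matrix S)) = card I"
  proof (rule dim_eq_card_dual_basis[where M = M and c = c])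
    show "subspace (hermitian_part (sig_matrix S))" by (rule subspace_hermitian_part)
    show "finite I" by simp
  next
    fix k assume k: "k \<in> I"
    obtain i b t where k': "k = (i, b, t)" by (cases k)
    show "linear (c k)" unfolding k' c_def prod.case by (cases t) (simp_all add: linear_Re_nth linear_Im_nth)
    have herm: "M k $ b $ a = cnj (M k $ a $ b)" for a b
      unfolding M_def vec_lambda_beta by (simp add: algebra_simps)
    have opp: "M k $ opp a $ opp b = - (opp_sgn a * opp_sgn b * cnj (M k $ a $ b))" for a b
      unfolding M_def vec_lambda_beta by (cases a; cases b) simp_all
    have E0: "E k x y = 0" if "lies_over x S = lies_over y S" for x y
      using k that by (auto simp: E_def k' I_def Q_def)
    have "M k $ a $ b = 0" if "lies_over a S = lies_over b S" for a b
      unfolding M_def vec_lambda_beta using that by (simp add: E0)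
    with herm opp show "M k \<in> hermitian_part (sig_matrix S)"
      unfolding hermitian_part_iff anticommute_sig_matrix_iff by blast
  next
    fix k l assume kl: "k \<in> I" "l \<in> I"
    obtain i b t j d u where k: "k = (i, b, t)" "l = (j, d, u)" by (cases k; cases l)
    have "i \<in> S" "b \<in> Q" "j \<in> S" "d \<in> Q" using kl by (simp_all add: I_def k)
    then have ne: "b \<noteq> Inl i'" "b \<noteq> Inr i'" "d \<noteq> Inl i'" "d \<noteq> Inr i'" if "i' \<in> S" for i'
      using that by (auto simp: Q_def)
    \<comment> \<open>At a labelled position the other three terms vanish: they are supported in the
      opposite block or in rows of the second half.\<close>
    have "M l $ Inl i $ b = E l (Inl i) b"
      unfolding M_def vec_lambda_beta using ne[OF \<open>i \<in> S\<close>] ne[OF \<open>j \<in> S\<close>]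
      by (cases b) (auto simp: E_def k)
    then show "c k (M l) = (if k = l then 1 else 0)"
      unfolding k c_def by (cases t; cases u) (auto simp: E_def)
  next
    fix X assume X: "X \<in> hermitian_part (sig_matrix S)" and c0: "\<And>k. k \<in> I \<Longrightarrow> c k X = 0"
    have h: "X $ b $ a = cnj (X $ a $ b)" and o: "X $ opp a $ opp b = - (opp_sgn a * opp_sgn b * cnj (X $ a $ b))"
      and j: "lies_over a S = lies_over b S \<Longrightarrow> X $ a $ b = 0" for a b
      using X unfolding hermitian_part_iff anticommute_sig_matrix_iff by blast+
    have 1: "X $ Inl i $ b = 0" if "i \<in> S" "\<not> lies_over b S" for i b
      using c0[of "(i, b, False)"] c0[of "(i, b, True)"] that by (simp add: c_def I_def Q_def complex_eq_iff)
    have 2: "X $ a $ b = 0" if "lies_over a S" "\<not> lies_over b S" for a b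
    proof (cases a)
      case (Inl i)
      then show ?thesis using 1 that by simp
    next
      case (Inr i)
      then have "X $ Inl i $ opp b = 0" using 1[of i "opp b"] that by simp
      then show ?thesis using o[of "Inl i" "opp b"] Inr by simp
    qed
    have "X $ a $ b = 0" for a b
    proof (cases "lies_over a S = lies_over b S")
      case False
      then show ?thesis using 2[of a b] 2[of b a] h[of a b] by (cases "lies_over a S") simp_all
    qed (rule j)
    then show "X = 0" by (simp add: vec_eq_iff)
  qed
  also have "card I = card S * (card Q * 2)" by (simp add: I_def card_cartesian_product)
  also have "card Q = 2 * card (- S)"
  proof -
    have "b \<in> Q \<longleftrightarrow> b \<in> (- S) <+> (- S)" for b by (cases b) (auto simp: Q_def)
    then have "Q = (- S) <+> (- S)" by blast
    then show ?thesis by (simp add: card_Plus)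
  qed
  finally show ?thesis by simp
qed

theorem proposition8p1:
  fixes n p q :: nat and S :: "('n::finite) set"
  assumes "n = CARD('n)" and "p + q = n" and "card S = p"
  shows
    "(let G = (Sp_real :: ('n + 'n) cmat set); K = U_in_Sp in
        (\<forall>T. compact_cartan_subgroup G T \<and> T \<subseteq> K \<longrightarrow> weyl_index Sp_complex K T = 2 ^ n) \<and>
        q_inv G K = real (n * (n + 1)) / 2 \<and>
        eps_sign G K = (- 1) ^ (n * (n + 1) div 2)) \<and>
     (let G = Sp_pq S; K = Sp_times_Sp S in
        (\<forall>T. compact_cartan_subgroup G T \<and> T \<subseteq> K \<longrightarrow> weyl_index Sp_complex K T = n choose p) \<and>
        q_inv G K = real (2 * p * q) \<and>
        eps_sign G K = 1)"
proof -
  have J: "sympl_J ** sympl_J = (mat (- 1) :: ('n + 'n) cmat)"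
    by (simp add: vec_eq_iff mat_def)
  have sig: "sig_matrix S ** sig_matrix S = mat 1"
    by (simp add: sig_matrix_eq diag_mult mat_eq_diag fun_eq_iff sig_fun_def)
  have q1: "q_inv Sp_real (U_in_Sp :: ('n + 'n) cmat set) = real (n * (n + 1)) / 2"
    unfolding q_inv_def Sp_real_eq U_in_Sp_eq using dim_lie_algebra_real_form[OF J]
    by (simp add: dim_hermitian_part_sympl_J assms(1))
  have "card (- S) = q" using assms by (simp add: Compl_eq_Diff_UNIV card_Diff_subset)
  then have q2: "q_inv (Sp_pq S) (Sp_times_Sp S) = real (2 * p * q)"
    unfolding q_inv_def Sp_pq_eq Sp_times_Sp_eq using dim_lie_algebra_real_form[OF sig]
    by (simp add: dim_hermitian_part_sig_matrix assms(3))
  \<comment> \<open>One of n and n + 1 is even, so the floor in \<open>eps_sign\<close> loses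
    nothing.\<close>
  have "real (n * (n + 1)) / 2 = real (n * (n + 1) div 2)"
    by (subst real_of_nat_div) auto
  then have "nat \<lfloor>q_inv Sp_real (U_in_Sp :: ('n + 'n) cmat set)\<rfloor> = n * (n + 1) div 2"
    unfolding q1 by (simp only: floor_of_nat nat_int)
  then have e1: "eps_sign Sp_real (U_in_Sp :: ('n + 'n) cmat set) = (- 1) ^ (n * (n + 1) div 2)"
    by (simp only: eps_sign_def)
  have "nat \<lfloor>q_inv (Sp_pq S) (Sp_times_Sp S)\<rfloor> = 2 * p * q"
    unfolding q2 by (simp only: floor_of_nat nat_int)
  then have e2: "eps_sign (Sp_pq S) (Sp_times_Sp S) = 1"
    by (simp add: eps_sign_def)
  show ?thesis
    unfolding Let_def
  proof (intro conjI allI impI q1 q2 e1 e2)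
    fix T :: "('n + 'n) cmat set"
    assume "compact_cartan_subgroup Sp_real T \<and> T \<subseteq> U_in_Sp"
    then show "weyl_index Sp_complex U_in_Sp T = 2 ^ n"
      unfolding Sp_real_eq U_in_Sp_eq assms(1) by (intro weyl_index_Sp_real_form) simp_all
  next
    fix T assume "compact_cartan_subgroup (Sp_pq S) T \<and> T \<subseteq> Sp_times_Sp S"
    then show "weyl_index Sp_complex (Sp_times_Sp S) T = n choose p"
      unfolding Sp_pq_eq Sp_times_Sp_eq assms(1) assms(3)[symmetric]
      by (intro weyl_index_Sp_pq_form) simp_all
  qed
qed

end
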